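(* Let $i\in[n]$ and $I\in\binom{[n]}{k}$. Suppose $f,s_if,fs_i,s_ifs_i\in\mathbf{B}_{k,n}$ and $\ell(s_ifs_i)=\ell(f)+2$. If $i+1\in I$ implies $i\in I$, then $\Pi^\circ_{f,I}$ admits a decomposition $\Pi^\circ_{f,I}=Z'_I\sqcup U'_I$, where $Z'_I$ is closed, $U'_I$ is its open complement, and $$Z'_I\cong\Pi^\circ_{s_ifs_i,\,s_iI}\times\mathbb{C},\qquad U'_I\cong\Pi^\circ_{fs_i,\,s_iI}\times\mathbb{C}^*.$$
   Context: Let $n\ge2$, $0\le k\le n$, $[n]=\{1,\dots,n\}$; indices are read modulo $n$ (so for $i=n$, $i+1$ means $1$ as an element of $[n]$). An $n$-periodic affine permutation is a bijection $f:\mathbb{Z}\to\mathbb{Z}$ with $f(a+n)=f(a)+n$. Products are read left to right: $(fg)(a)=g(f(a))$. $\mathbf{B}_{k,n}$ is the set of those with $\frac1n\sum_{a=1}^n(f(a)-a)=k$ and $a\le f(a)\le a+n$ for all $a$. Length: $\ell(f)=\#\{(a,b):a\in[n],b\in\mathbb{Z},a<b,f(a)>f(b)\}$. $s_i$ exchanges $i+mn$ and $i+1+mn$ for all $m$ and fixes all other integers; $s_iI$ is the image of $I$ under the induced transposition of $[n]$ (exchanging $i$ and $i+1$ mod $n$). For $f\in\mathbf{B}_{k,n}$ and $j\in[n]$ let $\overrightarrow{I_j}(f)=\{f(a):a<j,\ f(a)\ge j\}\bmod n\in\binom{[n]}{k}$ (target Grassmann necklace). Let $\le_j$ be the order $j<_jj+1<_j\dots<_jj-1$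 on $[n]$, and compare $k$-subsets entrywise after sorting with respect to $<_j$. Let $\mathcal{M}(f)=\{J\in\binom{[n]}{k}: J\ge_j\overrightarrow{I_j}(f)\text{ for all }j\in[n]\}$. The open positroid variety is $$\Pi^\circ_f=\{x\in\operatorname{Gr}(k,n):\Delta_J(x)=0\ \forall J\notin\mathcal{M}(f),\ \Delta_{\overrightarrow{I_j}(f)}(x)\ne0\ \forall j\in[n]\},$$ where $\operatorname{Gr}(k,n)$ is the complex Grassmannian of $k$-dimensional subspaces of $\mathbb{C}^n$ and $\Delta_J$ are Plücker coordinates (minors of a $k\times n$ matrix with given row span, in columns $J$). $\Pi^\circ_{f,I}=\Pi^\circ_f\cap\{\Delta_I\ne0\}$ (possibly empty). "$\cong$" means isomorphism of complex algebraic varieties; empty varieties are allowed. *)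

theory Defs
  imports
    "HOL-Analysis.Abstract_Topology"
    "HOL-Computational_Algebra.Polynomial"
    "Jordan_Normal_Form.Determinant"
    "Jordan_Normal_Form.DL_Submatrix"
    "Jordan_Normal_Form.VS_Connect"
begin

section \<open>Complex varieties as spaces with functions\<close>

text \<open>
  A variety is presented in the classical (Serre) way, by its set of complex points with the
  Zariski topology and the sheaf of regular functions, viewed as complex-valued functions.
  Here \<open>regular X U f\<close> says that \<open>f\<close> is regular on the open set \<open>U\<close>; only the values
  of \<open>f\<close> on \<open>U\<close> matter. The record does not itself carry axioms: it is only ever instantiated by
  the Grassmannian, the affine line, their subspaces, and products of these.
\<close>

record 'a variety =
  zariski :: "'a topology"
  regular :: "'a set \<Rightarrow> ('a \<Rightarrow> complex) \<Rightarrow> bool"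

abbreviation points :: "'a variety \<Rightarrow> 'a set" where
  "points X \<equiv> topspace (zariski X)"

definition morphism :: "'a variety \<Rightarrow> 'b variety \<Rightarrow> ('a \<Rightarrow> 'b) \<Rightarrow> bool" where
  "morphism X Y \<phi> \<longleftrightarrow>
     continuous_map (zariski X) (zariski Y) \<phi> \<and>
     (\<forall>V f. openin (zariski Y) V \<longrightarrow> regular Y V f \<longrightarrow>
        regular X {x \<in> points X. \<phi> x \<in> V} (f \<circ> \<phi>))"

definition var_iso :: "'a variety \<Rightarrow> 'b variety \<Rightarrow> bool" (infix "\<cong>\<^sub>v" 50) where
  "X \<cong>\<^sub>v Y \<longleftrightarrow>
     (\<exists>\<phi> \<psi>. morphism X Y \<phi> \<and> morphism Y X \<psi> \<and>
        (\<forall>x \<in> points X. \<psi> (\<phi> x) = x) \<and> (\<forall>y \<in> points Y. \<phi> (\<psi> y) = y))"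

text \<open>
  The reduced structure induced on a locally closed subset \<open>S\<close>: regular functions are those
  that locally extend to regular functions on open subsets of the ambient variety.
\<close>

definition subvariety :: "'a variety \<Rightarrow> 'a set \<Rightarrow> 'a variety" where
  "subvariety X S = \<lparr>
     zariski = subtopology (zariski X) S,
     regular = (\<lambda>U f. openin (subtopology (zariski X) S) U \<and>
       (\<forall>x \<in> U. \<exists>V g. openin (zariski X) V \<and> x \<in> V \<and> regular X V g \<and>
          (\<forall>y \<in> U \<inter> V. f y = g y))) \<rparr>"

text \<open>
  The product in the category of varieties. Its topology is finer than the product topology:
  basic open sets are the loci in \<open>U \<times> V\<close> where a function in
  \<open>\<O>(U) \<otimes> \<O>(V)\<close> does not vanish, and regular functions are locally quotients of such functions.
\<close>

definition tensor_fun ::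
    "'a variety \<Rightarrow> 'b variety \<Rightarrow> 'a set \<Rightarrow> 'b set \<Rightarrow> ('a \<times> 'b \<Rightarrow> complex) \<Rightarrow> bool" where
  "tensor_fun X Y U V F \<longleftrightarrow>
     (\<exists>(m::nat) g h. (\<forall>l<m. regular X U (g l) \<and> regular Y V (h l)) \<and>
        F = (\<lambda>(x, y). \<Sum>l<m. g l x * h l y))"

definition prod_zariski :: "'a variety \<Rightarrow> 'b variety \<Rightarrow> ('a \<times> 'b) topology" where
  "prod_zariski X Y = topology_generated_by
     {{p \<in> U \<times> V. F p \<noteq> 0} | U V F.
        openin (zariski X) U \<and> openin (zariski Y) V \<and> tensor_fun X Y U V F}"

definition var_prod :: "'a variety \<Rightarrow> 'b variety \<Rightarrow> ('a \<times> 'b) variety" (infixr "\<times>\<^sub>v" 80) where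
  "X \<times>\<^sub>v Y = \<lparr>
     zariski = prod_zariski X Y,
     regular = (\<lambda>W f. openin (prod_zariski X Y) W \<and>
       (\<forall>p \<in> W. \<exists>U V F G N.
          openin (zariski X) U \<and> openin (zariski Y) V \<and>
          tensor_fun X Y U V F \<and> tensor_fun X Y U V G \<and>
          openin (prod_zariski X Y) N \<and> p \<in> N \<and> N \<subseteq> W \<inter> (U \<times> V) \<and>
          (\<forall>q \<in> N. G q \<noteq> 0 \<and> f q = F q / G q))) \<rparr>"

definition line_zariski :: "complex topology" where
  "line_zariski = topology_generated_by {{t. poly p t \<noteq> 0} | p. True}"

definition affine_line :: "complex variety" where
  "affine_line = \<lparr>
     zariski = line_zariski,
     regular = (\<lambda>U f. openin line_zariski U \<and>
       (\<forall>x \<in> U. \<exists>p q V. openin line_zariski V \<and> x \<in> V \<and> V \<subseteq> U \<and>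
          (\<forall>t \<in> V. poly q t \<noteq> 0 \<and> f t = poly p t / poly q t))) \<rparr>"

definition punctured_line :: "complex variety" where
  "punctured_line = subvariety affine_line (- {0})"


section \<open>The complex Grassmannian\<close>

definition Gr :: "nat \<Rightarrow> nat \<Rightarrow> complex vec set set" where
  "Gr k n = {W. subspace class_ring W (module_vec TYPE(complex) n) \<and>
     vectorspace.dim class_ring ((module_vec TYPE(complex) n)\<lparr>carrier := W\<rparr>) = k}"

definition ksubsets :: "nat \<Rightarrow> nat \<Rightarrow> int set set" where
  "ksubsets k n = {J. J \<subseteq> {1..int n} \<and> card J = k}"

text \<open>
  A chosen \<open>k \<times> n\<close> matrix with row span \<open>W\<close>. Another choice rescales all Pluecker coordinates of
  \<open>W\<close> by a common nonzero factor, so neither their vanishing nor a quotient of two forms of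
  equal degree depends on it. Columns are indexed by \<open>[n]\<close>, while matrix indices start at 0.
\<close>

definition row_matrix :: "nat \<Rightarrow> nat \<Rightarrow> complex vec set \<Rightarrow> complex mat" where
  "row_matrix k n W = (SOME A. A \<in> carrier_mat k n \<and> vec_space.row_space n A = W)"

definition plucker :: "nat \<Rightarrow> nat \<Rightarrow> int set \<Rightarrow> complex vec set \<Rightarrow> complex" where
  "plucker k n J W = det (submatrix (row_matrix k n W) UNIV ((\<lambda>j. nat (j - 1)) ` J))"

text \<open>\<open>plucker_form k n d F\<close>: \<open>F\<close> is a homogeneous polynomial of degree \<open>d\<close> in the Pluecker
  coordinates.\<close>

inductive plucker_form :: "nat \<Rightarrow> nat \<Rightarrow> nat \<Rightarrow> (complex vec set \<Rightarrow> complex) \<Rightarrow> bool"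
  for k n where
  const: "plucker_form k n 0 (\<lambda>W. c)"
| coord: "J \<in> ksubsets k n \<Longrightarrow> plucker_form k n 1 (plucker k n J)"
| add: "plucker_form k n d F \<Longrightarrow> plucker_form k n d G \<Longrightarrow> plucker_form k n d (\<lambda>W. F W + G W)"
| mult: "plucker_form k n d F \<Longrightarrow> plucker_form k n e G \<Longrightarrow>
    plucker_form k n (d + e) (\<lambda>W. F W * G W)"

definition Gr_zariski :: "nat \<Rightarrow> nat \<Rightarrow> complex vec set topology" where
  "Gr_zariski k n = topology_generated_by
     {{W \<in> Gr k n. F W \<noteq> 0} | d F. plucker_form k n d F}"

definition grassmannian :: "nat \<Rightarrow> nat \<Rightarrow> complex vec set variety" where
  "grassmannian k n = \<lparr>
     zariski = Gr_zariski k n,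
     regular = (\<lambda>U f. openin (Gr_zariski k n) U \<and>
       (\<forall>x \<in> U. \<exists>d F G V. plucker_form k n d F \<and> plucker_form k n d G \<and>
          openin (Gr_zariski k n) V \<and> x \<in> V \<and> V \<subseteq> U \<and>
          (\<forall>W \<in> V. G W \<noteq> 0 \<and> f W = F W / G W))) \<rparr>"


section \<open>Bounded affine permutations\<close>

definition affine_perm :: "nat \<Rightarrow> (int \<Rightarrow> int) \<Rightarrow> bool" where
  "affine_perm n f \<longleftrightarrow> bij f \<and> (\<forall>a. f (a + int n) = f a + int n)"

definition bounded_affine :: "nat \<Rightarrow> nat \<Rightarrow> (int \<Rightarrow> int) set" where
  "bounded_affine k n = {f. affine_perm n f \<and>
     real_of_int (\<Sum>a = 1..int n. f a - a) / real n = real k \<and>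
     (\<forall>a. a \<le> f a \<and> f a \<le> a + int n)}"

text \<open>Products are read from left to right.\<close>

definition aff_mult :: "(int \<Rightarrow> int) \<Rightarrow> (int \<Rightarrow> int) \<Rightarrow> int \<Rightarrow> int" (infixl "\<star>" 70) where
  "(f \<star> g) a = g (f a)"

definition aff_length :: "nat \<Rightarrow> (int \<Rightarrow> int) \<Rightarrow> nat" where
  "aff_length n f = card {(a, b). a \<in> {1..int n} \<and> a < b \<and> f a > f b}"

text \<open>For \<open>n \<ge> 2\<close>, exchanges \<open>i + m n\<close> and \<open>i + 1 + m n\<close> for all \<open>m\<close>.\<close>

definition simple_refl :: "nat \<Rightarrow> int \<Rightarrow> int \<Rightarrow> int" where
  "simple_refl n i a =
     (if a mod int n = i mod int n then a + 1
      else if a mod int n = (i + 1) mod int n then a - 1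
      else a)"

text \<open>The representative in \<open>[n]\<close> of a residue class modulo \<open>n\<close>.\<close>

definition residue :: "nat \<Rightarrow> int \<Rightarrow> int" where
  "residue n a = (a - 1) mod int n + 1"

definition refl_set :: "nat \<Rightarrow> int \<Rightarrow> int set \<Rightarrow> int set" where
  "refl_set n i I = (\<lambda>a. residue n (simple_refl n i a)) ` I"


section \<open>Open positroid varieties\<close>

definition target_necklace :: "nat \<Rightarrow> (int \<Rightarrow> int) \<Rightarrow> int \<Rightarrow> int set" where
  "target_necklace n f j = residue n ` {f a | a. a < j \<and> f a \<ge> j}"

text \<open>The position of \<open>a \<in> [n]\<close> in the cyclically rotated order \<open>j < j + 1 < \<dots> < j - 1\<close>.\<close>

definition cyc_pos :: "nat \<Rightarrow> int \<Rightarrow> int \<Rightarrow> int" where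
  "cyc_pos n j a = (a - j) mod int n"

definition gale_le :: "nat \<Rightarrow> int \<Rightarrow> int set \<Rightarrow> int set \<Rightarrow> bool" where
  "gale_le n j I J \<longleftrightarrow>
     list_all2 (\<lambda>a b. cyc_pos n j a \<le> cyc_pos n j b)
       (sort_key (cyc_pos n j) (sorted_list_of_set I))
       (sort_key (cyc_pos n j) (sorted_list_of_set J))"

definition positroid :: "nat \<Rightarrow> nat \<Rightarrow> (int \<Rightarrow> int) \<Rightarrow> int set set" where
  "positroid k n f =
     {J \<in> ksubsets k n. \<forall>j \<in> {1..int n}. gale_le n j (target_necklace n f j) J}"

definition open_positroid :: "nat \<Rightarrow> nat \<Rightarrow> (int \<Rightarrow> int) \<Rightarrow> complex vec set set" where
  "open_positroid k n f =
     {W \<in> Gr k n.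
        (\<forall>J \<in> ksubsets k n. J \<notin> positroid k n f \<longrightarrow> plucker k n J W = 0) \<and>
        (\<forall>j \<in> {1..int n}. plucker k n (target_necklace n f j) W \<noteq> 0)}"

definition open_positroid_chart ::
    "nat \<Rightarrow> nat \<Rightarrow> (int \<Rightarrow> int) \<Rightarrow> int set \<Rightarrow> complex vec set set" where
  "open_positroid_chart k n f I = {W \<in> open_positroid k n f. plucker k n I W \<noteq> 0}"

abbreviation Gr_sub :: "nat \<Rightarrow> nat \<Rightarrow> complex vec set set \<Rightarrow> complex vec set variety" where
  "Gr_sub k n S \<equiv> subvariety (grassmannian k n) S"

end

theory Submission
  imports Defs "HOL-Number_Theory.Cong" "HOL-Library.Function_Algebras"
begin

text \<open>
  Let \<open>v\<^sub>a\<close> be the columns of a matrix representing a point, extended periodically. Membership in an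
  open positroid variety is a condition on the ranks of the cyclic intervals of columns. The
  permutations \<open>f\<close>, \<open>fs\<close> and \<open>sfs\<close> prescribe the same ranks for all intervals that do not separate
  \<open>i\<close> from \<open>i + 1\<close>. Given these, there are spans \<open>L\<close> (of an interval ending at \<open>i - 1\<close>) and \<open>R\<close> (of an
  interval starting at \<open>i + 2\<close>) such that exactly one line of the formal plane spanned by
  \<open>v\<^sub>i, v\<^sub>i\<^sub>+\<^sub>1\<close> lands in \<open>L\<close>, and one in \<open>R\<close>. Then \<open>f\<close> is the case \<open>v\<^sub>i \<notin> L, v\<^sub>i\<^sub>+\<^sub>1 \<notin> R\<close>, \<open>fs\<close> the
  case \<open>v\<^sub>i \<in> L, v\<^sub>i\<^sub>+\<^sub>1 \<notin> R\<close>, and \<open>sfs\<close> the case \<open>v\<^sub>i \<in> L, v\<^sub>i\<^sub>+\<^sub>1 \<in> R\<close>.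

  For a point of type \<open>f\<close> let \<open>\<beta>\<close> be the scalar with \<open>v\<^sub>i\<^sub>+\<^sub>1 - \<beta> v\<^sub>i \<in> L\<close>, and replace
  \<open>(v\<^sub>i, v\<^sub>i\<^sub>+\<^sub>1)\<close> by \<open>(v\<^sub>i\<^sub>+\<^sub>1 - \<beta> v\<^sub>i, v\<^sub>i)\<close>. The result has type \<open>sfs\<close> if \<open>v\<^sub>i \<in> R\<close> and type \<open>fs\<close>
  otherwise, and the point is recovered from it together with \<open>\<beta>\<close>. In the first case \<open>\<beta>\<close> is
  arbitrary; in the second it avoids one value depending on the result, and shifting by that value
  gives a coordinate in the punctured line. The scalars are quotients of Pluecker coordinates, and
  the assumption on \<open>I\<close> makes \<open>\<Delta>\<^sub>I\<close> correspond to \<open>\<Delta>\<^sub>s\<^sub>I\<close> up to sign.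
\<close>

section \<open>Spaces with functions\<close>

text \<open>Endpoints: adjoining \<open>v_i, v_{i+1}\<close> to the columns \<open>j..i-1\<close>
  raises the rank by the number of preimages of \<open>i\<close> and \<open>i + 1\<close> under
  \<open>f\<close> that lie before \<open>j\<close>. The length condition orders these preimages
  strictly, so starting at the larger one the gain is exactly one; hence \<open>L\<close> starts
  there, and \<open>R\<close> ends at \<open>f i\<close> for the mirror reason. The replacement is
  invertible on the pair of columns, so ranks of intervals that do not separate them are untouched
  and only two memberships have to be followed. The scalar must be globally regular. Cramer's rule
  in the necklace basis attached to the start of \<open>L\<close> writes \<beta> as one quotient
  whose denominator vanishes nowhere on points of type \<open>f\<close>, so no covering is required.
  The excluded value is -\<alpha>, where \<alpha> is the scalar that puts
  \<open>w_i - \<alpha> w_{i+1}\<close> into \<open>R\<close> for the new columns \<open>w\<close>: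
  at \<beta> = -\<alpha> this vector is \<open>v_{i+1}\<close>. Varieties are records without
  axioms, so the laws of regular functions are derived for every construction in use. On a chart,
  division by its Pluecker coordinate turns homogeneous coordinates into global functions.\<close>

locale space_with_functions =
  fixes X :: "'a variety"
  assumes regular_open: "regular X U f \<Longrightarrow> openin (zariski X) U"
    and regular_restrict: "regular X U f \<Longrightarrow> openin (zariski X) V \<Longrightarrow> V \<subseteq> U \<Longrightarrow> regular X V f"
    and regular_local: "openin (zariski X) U \<Longrightarrow>
      (\<And>x. x \<in> U \<Longrightarrow> \<exists>V g. openin (zariski X) V \<and> x \<in> V \<and> regular X V g \<and>
        (\<forall>y \<in> U \<inter> V. f y = g y)) \<Longrightarrow> regular X U f"
    and regular_const: "openin (zariski X) U \<Longrightarrow> regular X U (\<lambda>_. c)"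
    and regular_add: "regular X U f \<Longrightarrow> regular X U g \<Longrightarrow> regular X U (\<lambda>x. f x + g x)"
    and regular_mult: "regular X U f \<Longrightarrow> regular X U g \<Longrightarrow> regular X U (\<lambda>x. f x * g x)"
    and regular_inverse: "regular X U f \<Longrightarrow> (\<And>x. x \<in> U \<Longrightarrow> f x \<noteq> 0) \<Longrightarrow>
      regular X U (\<lambda>x. inverse (f x))"
    and open_nonzero: "regular X U f \<Longrightarrow> openin (zariski X) {x \<in> U. f x \<noteq> 0}"
begin

lemma regular_divide:
  assumes "regular X U f" "regular X U g" "\<And>x. x \<in> U \<Longrightarrow> g x \<noteq> 0"
  shows "regular X U (\<lambda>x. f x / g x)"
  using regular_mult[OF assms(1) regular_inverse[OF assms(2,3)]] by (simp add: divide_inverse)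

lemma regular_uminus: "regular X U f \<Longrightarrow> regular X U (\<lambda>x. - f x)"
  using regular_mult[OF regular_const[OF regular_open, of U f "-1"], of f] by simp

lemma regular_diff:
  "regular X U f \<Longrightarrow> regular X U g \<Longrightarrow> regular X U (\<lambda>x. f x - g x)"
  using regular_add[OF _ regular_uminus] by fastforce

lemma regular_sum:
  assumes "openin (zariski X) U" "finite A" "\<And>l. l \<in> A \<Longrightarrow> regular X U (g l)"
  shows "regular X U (\<lambda>x. \<Sum>l\<in>A. g l x)"
  using assms(2,3) by (induction A) (auto intro: regular_add regular_const assms(1))

lemma regular_poly:
  assumes "regular X U f"
  shows "regular X U (\<lambda>x. poly p (f x))"
proof (induction p)
  case 0
  then show ?case using regular_const[OF regular_open[OF assms]] by simp
next
  case (pCons a p)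
  show ?case
    using regular_add[OF regular_const[OF regular_open[OF assms]] regular_mult[OF assms pCons.IH]]
    by simp
qed

end

text \<open>The axioms only need to be checked on the local models of the regular functions.\<close>

lemma space_with_functionsI:
  fixes X :: "'a variety" and P :: "'a set \<Rightarrow> ('a \<Rightarrow> complex) \<Rightarrow> bool"
  assumes reg: "\<And>U f. regular X U f \<longleftrightarrow> openin (zariski X) U \<and>
      (\<forall>x \<in> U. \<exists>V h. P V h \<and> x \<in> V \<and> V \<subseteq> U \<and> (\<forall>y \<in> V. f y = h y))"
    and P_open: "\<And>U f. P U f \<Longrightarrow> openin (zariski X) U"
    and P_restrict: "\<And>U V f. P U f \<Longrightarrow> openin (zariski X) V \<Longrightarrow> V \<subseteq> U \<Longrightarrow> P V f"
    and P_const: "\<And>U c x. openin (zariski X) U \<Longrightarrow> x \<in> U \<Longrightarrow> \<exists>V. P V (\<lambda>_. c) \<and> x \<in> V \<and> V \<subseteq> U"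
    and P_add: "\<And>U f g. P U f \<Longrightarrow> P U g \<Longrightarrow> P U (\<lambda>x. f x + g x)"
    and P_mult: "\<And>U f g. P U f \<Longrightarrow> P U g \<Longrightarrow> P U (\<lambda>x. f x * g x)"
    and P_inverse: "\<And>U f. P U f \<Longrightarrow> (\<And>x. x \<in> U \<Longrightarrow> f x \<noteq> 0) \<Longrightarrow> P U (\<lambda>x. inverse (f x))"
    and P_nonzero: "\<And>U f. P U f \<Longrightarrow> openin (zariski X) {x \<in> U. f x \<noteq> 0}"
  shows "space_with_functions X"
proof
  fix U f assume "regular X U f" then show "openin (zariski X) U" by (simp add: reg)
next
  fix U V f assume *: "regular X U f" "openin (zariski X) V" "V \<subseteq> U"
  show "regular X V f" unfolding reg
  proof (intro conjI ballI)
    fix x assume "x \<in> V"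
    then obtain W h where W: "P W h" "x \<in> W" "W \<subseteq> U" "\<forall>y \<in> W. f y = h y"
      using * unfolding reg by blast
    have "P (W \<inter> V) h" using P_restrict[OF W(1), of "W \<inter> V"] P_open[OF W(1)] * by auto
    with W \<open>x \<in> V\<close> show "\<exists>V' h. P V' h \<and> x \<in> V' \<and> V' \<subseteq> V \<and> (\<forall>y \<in> V'. f y = h y)"
      by (intro exI[of _ "W \<inter> V"] exI[of _ h]) auto
  qed (use * in auto)
next
  fix U f assume U: "openin (zariski X) U" and
    loc: "\<And>x. x \<in> U \<Longrightarrow> \<exists>V g. openin (zariski X) V \<and> x \<in> V \<and> regular X V g \<and>
        (\<forall>y \<in> U \<inter> V. f y = g y)"
  show "regular X U f" unfolding reg
  proof (intro conjI ballI U)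
    fix x assume x: "x \<in> U"
    obtain V g where V: "openin (zariski X) V" "x \<in> V" "regular X V g" "\<forall>y \<in> U \<inter> V. f y = g y"
      using loc[OF x] by blast
    obtain W h where W: "P W h" "x \<in> W" "W \<subseteq> V" "\<forall>y \<in> W. g y = h y"
      using V(2,3) unfolding reg by blast
    have "P (W \<inter> U) h" using P_restrict[OF W(1), of "W \<inter> U"] P_open[OF W(1)] U by auto
    with W V x show "\<exists>V' h. P V' h \<and> x \<in> V' \<and> V' \<subseteq> U \<and> (\<forall>y \<in> V'. f y = h y)"
      by (intro exI[of _ "W \<inter> U"] exI[of _ h]) auto
  qed
next
  fix U c assume U: "openin (zariski X) U"
  show "regular X U (\<lambda>_. c)" unfolding reg using U P_const[OF U] by blast
next
  have two: "regular X U (\<lambda>x. F (f x) (g x))"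
    if F: "\<And>U f g. P U f \<Longrightarrow> P U g \<Longrightarrow> P U (\<lambda>x. F (f x) (g x))" and *: "regular X U f" "regular X U g"
    for F :: "complex \<Rightarrow> complex \<Rightarrow> complex" and U f g
    unfolding reg
  proof (intro conjI ballI)
    fix x assume x: "x \<in> U"
    obtain V h where V: "P V h" "x \<in> V" "V \<subseteq> U" "\<forall>y \<in> V. f y = h y"
      using *(1) x unfolding reg by blast
    obtain W h' where W: "P W h'" "x \<in> W" "W \<subseteq> U" "\<forall>y \<in> W. g y = h' y"
      using *(2) x unfolding reg by blast
    have o: "openin (zariski X) (V \<inter> W)" using P_open V W by blast
    have "P (V \<inter> W) (\<lambda>x. F (h x) (h' x))"
      using P_restrict[OF V(1) o] P_restrict[OF W(1) o] by (intro F) auto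
    with V W show "\<exists>V h. P V h \<and> x \<in> V \<and> V \<subseteq> U \<and> (\<forall>y \<in> V. F (f y) (g y) = h y)"
      by (intro exI[of _ "V \<inter> W"] exI[of _ "\<lambda>x. F (h x) (h' x)"]) auto
  qed (use * reg in auto)
  fix U f g assume *: "regular X U f" "regular X U g"
  show "regular X U (\<lambda>x. f x + g x)" by (rule two[OF P_add *])
  show "regular X U (\<lambda>x. f x * g x)" by (rule two[OF P_mult *])
next
  fix U f assume *: "regular X U f" "\<And>x. x \<in> U \<Longrightarrow> f x \<noteq> 0"
  show "regular X U (\<lambda>x. inverse (f x))" unfolding reg
  proof (intro conjI ballI)
    fix x assume x: "x \<in> U"
    obtain V h where V: "P V h" "x \<in> V" "V \<subseteq> U" "\<forall>y \<in> V. f y = h y"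
      using *(1) x unfolding reg by blast
    have "P V (\<lambda>x. inverse (h x))" using V(1) by (rule P_inverse) (metis V(3,4) *(2) subsetD)
    with V show "\<exists>V h. P V h \<and> x \<in> V \<and> V \<subseteq> U \<and> (\<forall>y \<in> V. inverse (f y) = h y)"
      by (intro exI[of _ V] exI[of _ "\<lambda>x. inverse (h x)"]) auto
  qed (use * reg in auto)
next
  fix U f assume *: "regular X U f"
  show "openin (zariski X) {x \<in> U. f x \<noteq> 0}"
  proof (subst openin_subopen, intro ballI)
    fix x assume "x \<in> {x \<in> U. f x \<noteq> 0}"
    then have x: "x \<in> U" "f x \<noteq> 0" by auto
    obtain V h where V: "P V h" "x \<in> V" "V \<subseteq> U" "\<forall>y \<in> V. f y = h y"
      using *(1) x unfolding reg by blast
    show "\<exists>T. openin (zariski X) T \<and> x \<in> T \<and> T \<subseteq> {x \<in> U. f x \<noteq> 0}"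
      using P_nonzero[OF V(1)] V x by (intro exI[of _ "{x \<in> V. h x \<noteq> 0}"]) auto
  qed
qed

text \<open>\<open>Q N F G\<close> says that \<open>F\<close> and \<open>G\<close> may be used as numerator and denominator on \<open>N\<close>.\<close>

lemma space_with_quotientsI:
  fixes X :: "'a variety" and Q :: "'a set \<Rightarrow> ('a \<Rightarrow> complex) \<Rightarrow> ('a \<Rightarrow> complex) \<Rightarrow> bool"
  assumes reg: "\<And>U f. regular X U f \<longleftrightarrow> openin (zariski X) U \<and> (\<forall>x \<in> U. \<exists>N F G. Q N F G \<and>
      openin (zariski X) N \<and> x \<in> N \<and> N \<subseteq> U \<and> (\<forall>y \<in> N. G y \<noteq> 0 \<and> f y = F y / G y))"
    and Q_restrict: "\<And>N N' F G. Q N F G \<Longrightarrow> N' \<subseteq> N \<Longrightarrow> Q N' F G"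
    and Q_const: "\<And>N c. openin (zariski X) N \<Longrightarrow> Q N (\<lambda>_. c) (\<lambda>_. 1)"
    and Q_add: "\<And>N F G F' G'. Q N F G \<Longrightarrow> Q N F' G' \<Longrightarrow>
      Q N (\<lambda>x. F x * G' x + F' x * G x) (\<lambda>x. G x * G' x)"
    and Q_mult: "\<And>N F G F' G'. Q N F G \<Longrightarrow> Q N F' G' \<Longrightarrow> Q N (\<lambda>x. F x * F' x) (\<lambda>x. G x * G' x)"
    and Q_swap: "\<And>N F G. Q N F G \<Longrightarrow> Q N G F"
    and Q_nonzero: "\<And>N F G. Q N F G \<Longrightarrow> openin (zariski X) N \<Longrightarrow> openin (zariski X) {x \<in> N. F x \<noteq> 0}"
  shows "space_with_functions X"
proof (rule space_with_functionsI[where P = "\<lambda>N f. openin (zariski X) N \<and>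
    (\<exists>F G. Q N F G \<and> (\<forall>y \<in> N. G y \<noteq> 0 \<and> f y = F y / G y))"], goal_cases)
  case (1 U f)
  have "(\<exists>N F G. Q N F G \<and> openin (zariski X) N \<and> x \<in> N \<and> N \<subseteq> U \<and> (\<forall>y \<in> N. G y \<noteq> 0 \<and> f y = F y / G y)) \<longleftrightarrow>
    (\<exists>N h. (openin (zariski X) N \<and> (\<exists>F G. Q N F G \<and> (\<forall>y \<in> N. G y \<noteq> 0 \<and> h y = F y / G y))) \<and>
      x \<in> N \<and> N \<subseteq> U \<and> (\<forall>y \<in> N. f y = h y))" (is "?l \<longleftrightarrow> ?r") for x
  proof
    assume ?l
    then show ?r by (elim exE, rule_tac x = N in exI, rule_tac x = f in exI) auto
  next
    assume ?r
    then obtain N h F G where "Q N F G" "openin (zariski X) N" "x \<in> N" "N \<subseteq> U"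
      "\<forall>y \<in> N. G y \<noteq> 0 \<and> h y = F y / G y" "\<forall>y \<in> N. f y = h y" by (elim exE conjE) (rule that)
    then show ?l by (rule_tac x = N in exI, rule_tac x = F in exI, rule_tac x = G in exI) auto
  qed
  then show ?case unfolding reg by simp
next
  case (3 U V f)
  then show ?case using Q_restrict by (metis subsetD)
next
  case (4 U c x)
  then show ?case using Q_const[of U c] by (rule_tac x = U in exI) (auto intro!: exI)
next
  case (5 U f g)
  from conjunct2[OF 5(1)] conjunct2[OF 5(2)] obtain F G F' G' where
    *: "Q U F G" "\<forall>y \<in> U. G y \<noteq> 0 \<and> f y = F y / G y" "Q U F' G'" "\<forall>y \<in> U. G' y \<noteq> 0 \<and> g y = F' y / G' y"
    by (elim exE conjE) (rule that)
  show ?case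
    by (rule conjI[OF conjunct1[OF 5(1)]], rule exI[of _ "\<lambda>x. F x * G' x + F' x * G x"],
      rule exI[of _ "\<lambda>x. G x * G' x"]) (use Q_add[OF *(1,3)] *(2,4) in \<open>auto simp: field_simps\<close>)
next
  case (6 U f g)
  from conjunct2[OF 6(1)] conjunct2[OF 6(2)] obtain F G F' G' where
    *: "Q U F G" "\<forall>y \<in> U. G y \<noteq> 0 \<and> f y = F y / G y" "Q U F' G'" "\<forall>y \<in> U. G' y \<noteq> 0 \<and> g y = F' y / G' y"
    by (elim exE conjE) (rule that)
  show ?case
    by (rule conjI[OF conjunct1[OF 6(1)]], rule exI[of _ "\<lambda>x. F x * F' x"],
      rule exI[of _ "\<lambda>x. G x * G' x"]) (use Q_mult[OF *(1,3)] *(2,4) in auto)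
next
  case (7 U f)
  from conjunct2[OF 7(1)] obtain F G where Q: "Q U F G" "\<forall>y \<in> U. G y \<noteq> 0 \<and> f y = F y / G y"
    by (elim exE conjE) (rule that)
  have "F y \<noteq> 0 \<and> inverse (f y) = G y / F y" if "y \<in> U" for y
    using Q(2) 7(2)[OF that] that by auto
  with Q_swap[OF Q(1)] show ?case
    by (rule_tac conjI[OF conjunct1[OF 7(1)]], rule_tac exI[of _ G], rule_tac exI[of _ F]) auto
next
  case (8 U f)
  from conjunct2[OF 8] obtain F G where Q: "Q U F G" "\<forall>y \<in> U. G y \<noteq> 0 \<and> f y = F y / G y"
    by (elim exE conjE) (rule that)
  then have "{x \<in> U. f x \<noteq> 0} = {x \<in> U. F x \<noteq> 0}" by auto
  then show ?case using Q_nonzero[OF Q(1)] 8 by simp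
qed auto

section \<open>Subvarieties\<close>

lemma zariski_subvariety [simp]: "zariski (subvariety X S) = subtopology (zariski X) S"
  by (simp add: subvariety_def)

lemma regular_subvariety: "regular (subvariety X S) U f \<longleftrightarrow> openin (subtopology (zariski X) S) U \<and>
  (\<forall>x \<in> U. \<exists>V g. openin (zariski X) V \<and> x \<in> V \<and> regular X V g \<and> (\<forall>y \<in> U \<inter> V. f y = g y))"
  by (simp add: subvariety_def)

text \<open>The local models are restrictions of functions regular on an ambient open set containing
  \<open>V\<close>. Operations are carried out on the ambient set, shrunk to a common domain or, for
  inverses, to the locus where the extension does not vanish.\<close>

lemma (in space_with_functions) space_with_functions_subvariety:
  "space_with_functions (subvariety X S)"
proof (rule space_with_functionsI[where P = "\<lambda>V h. openin (subtopology (zariski X) S) V \<and>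
    (\<exists>V' g. V \<subseteq> V' \<and> regular X V' g \<and> (\<forall>y\<in>V. h y = g y))"], goal_cases)
  case (1 U f)
  show ?case unfolding regular_subvariety zariski_subvariety
  proof (intro conj_cong refl ball_cong iffI, goal_cases)
    case (1 x)
    then have U: "openin (subtopology (zariski X) S) U" and x: "x \<in> U" by auto
    from 1 obtain V g where V: "openin (zariski X) V" "x \<in> V" "regular X V g" "\<forall>y \<in> U \<inter> V. f y = g y"
      by blast
    have "U \<inter> V = U \<inter> (V \<inter> S)" using openin_subset[OF U] by auto
    moreover have "openin (subtopology (zariski X) S) (V \<inter> S)"
      using V by (auto simp: openin_subtopology)
    ultimately have "openin (subtopology (zariski X) S) (U \<inter> V)" using U by auto
    then show "\<exists>V h. (openin (subtopology (zariski X) S) V \<and>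
      (\<exists>V' g. V \<subseteq> V' \<and> regular X V' g \<and> (\<forall>y\<in>V. h y = g y))) \<and> x \<in> V \<and> V \<subseteq> U \<and> (\<forall>y\<in>V. f y = h y)"
      using V x by (intro exI[of _ "U \<inter> V"] exI[of _ f]) blast
  next
    case (2 x)
    then have U: "openin (subtopology (zariski X) S) U" and x: "x \<in> U" by auto
    from 2 obtain V h V' g where V: "openin (subtopology (zariski X) S) V" "V \<subseteq> V'" "regular X V' g"
      "\<forall>y\<in>V. h y = g y" "x \<in> V" "V \<subseteq> U" "\<forall>y\<in>V. f y = h y" by blast
    obtain T where T: "openin (zariski X) T" "V = T \<inter> S" using V(1) by (auto simp: openin_subtopology)
    have "openin (zariski X) (T \<inter> V')" using T regular_open[OF V(3)] by auto
    moreover have "regular X (T \<inter> V') g" using regular_restrict[OF V(3)] calculation by auto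
    moreover have "U \<inter> (T \<inter> V') \<subseteq> V" using T openin_subset[OF U] by auto
    ultimately show "\<exists>V g. openin (zariski X) V \<and> x \<in> V \<and> regular X V g \<and> (\<forall>y \<in> U \<inter> V. f y = g y)"
      using V T by (intro exI[of _ "T \<inter> V'"] exI[of _ g]) auto
  qed
next
  case (3 U V f)
  then obtain V' g where "U \<subseteq> V'" "regular X V' g" "\<forall>y\<in>U. f y = g y" by auto
  with 3 show ?case by (intro conjI exI[of _ V'] exI[of _ g]) auto
next
  case (4 U c x)
  then obtain T where T: "openin (zariski X) T" "U = T \<inter> S" by (auto simp: openin_subtopology)
  have "\<exists>V' g. U \<subseteq> V' \<and> regular X V' g \<and> (\<forall>y\<in>U. c = g y)"
    using T regular_const[OF T(1)] by (intro exI[of _ T] exI[of _ "\<lambda>_. c"]) auto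
  with 4 show ?case by auto
next
  case (5 U f g)
  then obtain V' h V'' h' where V: "U \<subseteq> V'" "regular X V' h" "\<forall>y\<in>U. f y = h y"
    "U \<subseteq> V''" "regular X V'' h'" "\<forall>y\<in>U. g y = h' y" by auto
  have o: "openin (zariski X) (V' \<inter> V'')" using V regular_open by blast
  show ?case
    by (intro conjI exI[of _ "V' \<inter> V''"] exI[of _ "\<lambda>x. h x + h' x"] regular_add)
      (use 5 V o in \<open>auto intro: regular_restrict\<close>)
next
  case (6 U f g)
  then obtain V' h V'' h' where V: "U \<subseteq> V'" "regular X V' h" "\<forall>y\<in>U. f y = h y"
    "U \<subseteq> V''" "regular X V'' h'" "\<forall>y\<in>U. g y = h' y" by auto
  have o: "openin (zariski X) (V' \<inter> V'')" using V regular_open by blast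
  show ?case
    by (intro conjI exI[of _ "V' \<inter> V''"] exI[of _ "\<lambda>x. h x * h' x"] regular_mult)
      (use 6 V o in \<open>auto intro: regular_restrict\<close>)
next
  case (7 U f)
  then obtain V' h where V: "U \<subseteq> V'" "regular X V' h" "\<forall>y\<in>U. f y = h y" by auto
  have o: "openin (zariski X) {x \<in> V'. h x \<noteq> 0}" using V open_nonzero by blast
  show ?case
    by (intro conjI exI[of _ "{x \<in> V'. h x \<noteq> 0}"] exI[of _ "\<lambda>x. inverse (h x)"] regular_inverse)
      (use 7 V o in \<open>auto intro: regular_restrict\<close>)
next
  case (8 U f)
  then obtain V' h where V: "U \<subseteq> V'" "regular X V' h" "\<forall>y\<in>U. f y = h y" by auto
  have o: "openin (zariski X) {x \<in> V'. h x \<noteq> 0}" using V open_nonzero by blast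
  have eq: "{x \<in> U. f x \<noteq> 0} = U \<inter> ({x \<in> V'. h x \<noteq> 0} \<inter> S)"
    using V openin_subset[of "subtopology (zariski X) S" U] 8 by auto
  show ?case unfolding eq zariski_subvariety
    by (rule openin_Int) (use 8 o in \<open>auto simp: openin_subtopology\<close>)
qed auto

section \<open>Morphisms\<close>

lemma morphism_comp:
  assumes "morphism X Y \<phi>" "morphism Y Z \<psi>"
  shows "morphism X Z (\<psi> \<circ> \<phi>)"
  unfolding morphism_def
proof (intro conjI allI impI)
  show "continuous_map (zariski X) (zariski Z) (\<psi> \<circ> \<phi>)"
    using assms by (auto simp: morphism_def intro: continuous_map_compose)
  fix V f assume V: "openin (zariski Z) V" "regular Z V f"
  have o: "openin (zariski Y) {y \<in> points Y. \<psi> y \<in> V}"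
    using assms(2) V by (auto simp: morphism_def continuous_map_def)
  have "regular Y {y \<in> points Y. \<psi> y \<in> V} (f \<circ> \<psi>)"
    using assms(2) V by (auto simp: morphism_def)
  with o have "regular X {x \<in> points X. \<phi> x \<in> {y \<in> points Y. \<psi> y \<in> V}} ((f \<circ> \<psi>) \<circ> \<phi>)"
    using assms(1) unfolding morphism_def by blast
  moreover have "{x \<in> points X. \<phi> x \<in> {y \<in> points Y. \<psi> y \<in> V}} = {x \<in> points X. (\<psi> \<circ> \<phi>) x \<in> V}"
    using assms(1) by (auto simp: morphism_def continuous_map_def)
  ultimately show "regular X {x \<in> points X. (\<psi> \<circ> \<phi>) x \<in> V} (f \<circ> (\<psi> \<circ> \<phi>))"
    by (simp add: o_assoc)
qed

lemma morphism_subvariety_inclusion: "morphism (subvariety X S) X id"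
  unfolding morphism_def
proof (intro conjI allI impI)
  show "continuous_map (zariski (subvariety X S)) (zariski X) id"
    by (simp add: continuous_map_from_subtopology)
  fix V f assume V: "openin (zariski X) V" "regular X V f"
  then have "{x \<in> points (subvariety X S). id x \<in> V} = V \<inter> S"
    using openin_subset by fastforce
  then show "regular (subvariety X S) {x \<in> points (subvariety X S). id x \<in> V} (f \<circ> id)"
    unfolding regular_subvariety using V by (auto simp: openin_subtopology)
qed

lemma morphism_regular:
  assumes "morphism X Y \<phi>" "regular Y (points Y) f"
  shows "regular X (points X) (f \<circ> \<phi>)"
proof -
  have "regular X {x \<in> points X. \<phi> x \<in> points Y} (f \<circ> \<phi>)"
    using assms by (auto simp: morphism_def)
  moreover have "{x \<in> points X. \<phi> x \<in> points Y} = points X"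
    using assms(1) by (auto simp: morphism_def continuous_map_def)
  ultimately show ?thesis by simp
qed

context space_with_functions begin

lemma morphism_into_subvariety:
  assumes "morphism X Y \<phi>" "\<phi> ` points X \<subseteq> S"
  shows "morphism X (subvariety Y S) \<phi>"
  unfolding morphism_def
proof (intro conjI allI impI)
  show cont: "continuous_map (zariski X) (zariski (subvariety Y S)) \<phi>"
    using assms by (auto simp: morphism_def continuous_map_in_subtopology)
  fix V f assume V: "openin (zariski (subvariety Y S)) V" "regular (subvariety Y S) V f"
  show "regular X {x \<in> points X. \<phi> x \<in> V} (f \<circ> \<phi>)"
  proof (rule regular_local)
    show "openin (zariski X) {x \<in> points X. \<phi> x \<in> V}"
      using cont V by (auto simp: continuous_map_def)
    fix x assume x: "x \<in> {x \<in> points X. \<phi> x \<in> V}"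
    obtain V' g where g: "openin (zariski Y) V'" "\<phi> x \<in> V'" "regular Y V' g" "\<forall>y \<in> V \<inter> V'. f y = g y"
      using V(2) x unfolding regular_subvariety by blast
    show "\<exists>W h. openin (zariski X) W \<and> x \<in> W \<and> regular X W h \<and>
        (\<forall>y \<in> {x \<in> points X. \<phi> x \<in> V} \<inter> W. (f \<circ> \<phi>) y = h y)"
      using assms(1) g x
      by (intro exI[of _ "{x \<in> points X. \<phi> x \<in> V'}"] exI[of _ "g \<circ> \<phi>"])
        (auto simp: morphism_def continuous_map_def)
  qed
qed

end

section \<open>The affine line\<close>

lemma zariski_affine_line [simp]: "zariski affine_line = line_zariski"
  by (simp add: affine_line_def)

lemma openin_line_nonzero: "openin line_zariski {t. poly p t \<noteq> 0}"
  unfolding line_zariski_def by (rule topology_generated_by_Basis) auto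

lemma points_affine_line [simp]: "topspace line_zariski = UNIV"
proof -
  have "UNIV = {t::complex. poly 1 t \<noteq> 0}" by simp
  then show ?thesis using openin_line_nonzero openin_subset by (metis top.extremum_uniqueI)
qed

lemma regular_affine_line_id: "regular affine_line UNIV id"
proof -
  have "openin line_zariski UNIV" using openin_topspace[of line_zariski] by simp
  then show ?thesis unfolding affine_line_def
    by (simp, intro allI exI[of _ "[:0, 1:]"] exI[of _ "1::complex poly"] exI[of _ "UNIV::complex set"]) simp
qed

interpretation affine_line: space_with_functions affine_line
proof (rule space_with_quotientsI[where Q = "\<lambda>N F G. \<exists>p q. F = poly p \<and> G = poly q"], goal_cases)
  case (1 U f)
  have "(\<exists>p q V. openin line_zariski V \<and> x \<in> V \<and> V \<subseteq> U \<and> (\<forall>t\<in>V. poly q t \<noteq> 0 \<and> f t = poly p t / poly q t)) \<longleftrightarrow>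
    (\<exists>N F G. (\<exists>p q. F = poly p \<and> G = poly q) \<and> openin line_zariski N \<and> x \<in> N \<and> N \<subseteq> U \<and>
      (\<forall>y\<in>N. G y \<noteq> 0 \<and> f y = F y / G y))" for x by blast
  then show ?case unfolding affine_line_def by simp
next
  case (3 N c)
  show ?case by (rule exI[of _ "[:c:]"], rule exI[of _ 1]) auto
next
  case (4 N F G F' G')
  then obtain p q p' q' where "F = poly p" "G = poly q" "F' = poly p'" "G' = poly q'" by blast
  then show ?case by (intro exI[of _ "p * q' + p' * q"] exI[of _ "q * q'"]) auto
next
  case (5 N F G F' G')
  then obtain p q p' q' where "F = poly p" "G = poly q" "F' = poly p'" "G' = poly q'" by blast
  then show ?case by (intro exI[of _ "p * p'"] exI[of _ "q * q'"]) auto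
next
  case (7 N F G)
  then obtain p where "F = poly p" by blast
  then have "{x \<in> N. F x \<noteq> 0} = N \<inter> {t. poly p t \<noteq> 0}" by auto
  then show ?case using 7 openin_line_nonzero by auto
qed auto

text \<open>Open sets and regular functions of the line come from polynomials, and a polynomial in
  \<open>f\<close> is regular by the ring axioms.\<close>

lemma (in space_with_functions) morphism_affine_line:
  assumes "regular X (points X) f"
  shows "morphism X affine_line f"
  unfolding morphism_def
proof (intro conjI allI impI)
  have f: "regular X (points X) (\<lambda>x. poly p (f x))" for p using regular_poly[OF assms] .
  have pre: "openin (zariski X) {x \<in> points X. poly p (f x) \<noteq> 0}" for p using open_nonzero[OF f] .
  show cont: "continuous_map (zariski X) (zariski affine_line) f"
    unfolding zariski_affine_line line_zariski_def
  proof (rule continuous_on_generated_topo)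
    fix U :: "complex set" assume "U \<in> {{t. poly p t \<noteq> 0} | p. True}"
    then obtain p where "U = {t. poly p t \<noteq> 0}" by auto
    then have "f -` U \<inter> points X = {x \<in> points X. poly p (f x) \<noteq> 0}" by auto
    then show "openin (zariski X) (f -` U \<inter> points X)" using pre by simp
  next
    show "f ` points X \<subseteq> \<Union> {{t. poly p t \<noteq> 0} | p. True}"
    proof
      fix z :: complex
      have "{t. poly 1 t \<noteq> (0::complex)} \<in> {{t. poly p t \<noteq> 0} | p. True}"
        by (intro CollectI exI[of _ 1]) simp
      then show "z \<in> \<Union> {{t. poly p t \<noteq> 0} | p. True}" by (rule UnionI) simp
    qed
  qed
  fix V g assume V: "openin (zariski affine_line) V" "regular affine_line V g"
  show "regular X {x \<in> points X. f x \<in> V} (g \<circ> f)"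
  proof (rule regular_local)
    show "openin (zariski X) {x \<in> points X. f x \<in> V}" using cont V by (auto simp: continuous_map_def)
    fix x assume "x \<in> {x \<in> points X. f x \<in> V}"
    then have x: "x \<in> points X" "f x \<in> V" by auto
    obtain p q W where W: "openin line_zariski W" "f x \<in> W" "W \<subseteq> V"
      "\<forall>t \<in> W. poly q t \<noteq> 0 \<and> g t = poly p t / poly q t"
    proof -
      have "\<forall>x \<in> V. \<exists>p q W. openin line_zariski W \<and> x \<in> W \<and> W \<subseteq> V \<and>
          (\<forall>t \<in> W. poly q t \<noteq> 0 \<and> g t = poly p t / poly q t)"
        using V(2) by (simp add: affine_line_def)
      then show thesis using x(2) that by blast
    qed
    have o: "openin (zariski X) {x \<in> points X. f x \<in> W}" using cont W by (auto simp: continuous_map_def)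
    have "regular X {x \<in> points X. f x \<in> W} (\<lambda>x. poly p (f x) / poly q (f x))"
      using W(4) by (intro regular_divide regular_restrict[OF f o]) auto
    then show "\<exists>V' h. openin (zariski X) V' \<and> x \<in> V' \<and> regular X V' h \<and>
        (\<forall>y \<in> {x \<in> points X. f x \<in> V} \<inter> V'. (g \<circ> f) y = h y)"
      using x W o by (intro exI[of _ "{x \<in> points X. f x \<in> W}"]
        exI[of _ "\<lambda>x. poly p (f x) / poly q (f x)"]) auto
  qed
qed

section \<open>Products\<close>

lemma tensor_fun_finite:
  assumes "finite A" "\<And>l. l \<in> A \<Longrightarrow> regular X U (g l)" "\<And>l. l \<in> A \<Longrightarrow> regular Y V (h l)"
  shows "tensor_fun X Y U V (\<lambda>(x, y). \<Sum>l\<in>A. g l x * h l y)"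
proof -
  \<comment> \<open>Enumerating \<open>A\<close> admits arbitrary finite index sets: disjoint unions
    for sums of tensors, Cartesian products for their products.\<close>
  obtain e where e: "bij_betw e {0..<card A} A" using ex_bij_betw_nat_finite[OF assms(1)] by blast
  then have e: "bij_betw e {..<card A} A" by (simp add: lessThan_atLeast0)
  have "(\<Sum>l\<in>A. g l x * h l y) = (\<Sum>l<card A. g (e l) x * h (e l) y)" for x y
    by (rule sum.reindex_bij_betw[OF e, symmetric])
  moreover have "e l \<in> A" if "l < card A" for l using e that by (auto simp: bij_betw_def)
  ultimately show ?thesis unfolding tensor_fun_def
    using assms by (intro exI[of _ "card A"] exI[of _ "\<lambda>l. g (e l)"] exI[of _ "\<lambda>l. h (e l)"]) auto
qed

lemma tensor_funE:
  assumes "tensor_fun X Y U V F"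
  obtains m :: nat and g h where "\<And>l. l < m \<Longrightarrow> regular X U (g l)" "\<And>l. l < m \<Longrightarrow> regular Y V (h l)"
    "\<And>x y. F (x, y) = (\<Sum>l<m. g l x * h l y)"
  using assms unfolding tensor_fun_def by (elim exE conjE) (rule that; auto)

lemma tensor_fun_add:
  assumes "tensor_fun X Y U V F" "tensor_fun X Y U V G"
  shows "tensor_fun X Y U V (\<lambda>p. F p + G p)"
proof -
  obtain m :: nat and g h where F: "\<And>l. l < m \<Longrightarrow> regular X U (g l)" "\<And>l. l < m \<Longrightarrow> regular Y V (h l)"
    "\<And>x y. F (x, y) = (\<Sum>l<m. g l x * h l y)" using assms(1) by (rule tensor_funE) auto
  obtain m' :: nat and g' h' where G: "\<And>l. l < m' \<Longrightarrow> regular X U (g' l)"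
    "\<And>l. l < m' \<Longrightarrow> regular Y V (h' l)"
    "\<And>x y. G (x, y) = (\<Sum>l<m'. g' l x * h' l y)" using assms(2) by (rule tensor_funE) auto
  have "tensor_fun X Y U V (\<lambda>(x, y). \<Sum>l \<in> {..<m} <+> {..<m'}.
      case_sum g g' l x * case_sum h h' l y)"
    using F G by (intro tensor_fun_finite) auto
  also have "(\<lambda>(x, y). \<Sum>l \<in> {..<m} <+> {..<m'}. case_sum g g' l x * case_sum h h' l y) =
      (\<lambda>p. F p + G p)"
    using F(3) G(3) by (auto simp: sum.Plus)
  finally show ?thesis .
qed

lemma tensor_fun_mult:
  assumes "space_with_functions X" "space_with_functions Y"
    and "tensor_fun X Y U V F" "tensor_fun X Y U V G"
  shows "tensor_fun X Y U V (\<lambda>p. F p * G p)"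
proof -
  obtain m :: nat and g h where F: "\<And>l. l < m \<Longrightarrow> regular X U (g l)" "\<And>l. l < m \<Longrightarrow> regular Y V (h l)"
    "\<And>x y. F (x, y) = (\<Sum>l<m. g l x * h l y)" using assms(3) by (rule tensor_funE) auto
  obtain m' :: nat and g' h' where G: "\<And>l. l < m' \<Longrightarrow> regular X U (g' l)"
    "\<And>l. l < m' \<Longrightarrow> regular Y V (h' l)"
    "\<And>x y. G (x, y) = (\<Sum>l<m'. g' l x * h' l y)" using assms(4) by (rule tensor_funE) auto
  have "tensor_fun X Y U V (\<lambda>(x, y). \<Sum>l \<in> {..<m} \<times> {..<m'}.
      (g (fst l) x * g' (snd l) x) * (h (fst l) y * h' (snd l) y))"
    using F G by (intro tensor_fun_finite space_with_functions.regular_mult[OF assms(1)]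
        space_with_functions.regular_mult[OF assms(2)]) auto
  also have "(\<lambda>(x, y). \<Sum>l \<in> {..<m} \<times> {..<m'}.
      (g (fst l) x * g' (snd l) x) * (h (fst l) y * h' (snd l) y)) = (\<lambda>p. F p * G p)"
  proof (intro ext, clarify)
    fix x y
    have "F (x, y) * G (x, y) = (\<Sum>i<m. \<Sum>j<m'. (g i x * g' j x) * (h i y * h' j y))"
      unfolding F(3) G(3) sum_product by (simp add: mult_ac)
    then show "(\<Sum>l \<in> {..<m} \<times> {..<m'}. (g (fst l) x * g' (snd l) x) * (h (fst l) y * h' (snd l) y)) =
        F (x, y) * G (x, y)"
      by (simp add: sum.cartesian_product case_prod_beta)
  qed
  finally show ?thesis .
qed

lemma tensor_fun_restrict:
  assumes "space_with_functions X" "space_with_functions Y" "tensor_fun X Y U V F"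
    and "openin (zariski X) U'" "U' \<subseteq> U" "openin (zariski Y) V'" "V' \<subseteq> V"
  shows "tensor_fun X Y U' V' F"
proof -
  obtain m :: nat and g h where F: "\<And>l. l < m \<Longrightarrow> regular X U (g l)" "\<And>l. l < m \<Longrightarrow> regular Y V (h l)"
    "\<And>x y. F (x, y) = (\<Sum>l<m. g l x * h l y)" using assms(3) by (rule tensor_funE) auto
  have "tensor_fun X Y U' V' (\<lambda>(x, y). \<Sum>l<m. g l x * h l y)"
  proof (rule tensor_fun_finite)
    fix l assume "l \<in> {..<m}"
    then show "regular X U' (g l)" "regular Y V' (h l)"
      using space_with_functions.regular_restrict[OF assms(1) F(1) assms(4,5)]
        space_with_functions.regular_restrict[OF assms(2) F(2) assms(6,7)] by auto
  qed simp
  also have "(\<lambda>(x, y). \<Sum>l<m. g l x * h l y) = F" using F(3) by auto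
  finally show ?thesis .
qed

lemma tensor_fun_fst:
  assumes "space_with_functions Y" "regular X U f" "openin (zariski Y) V"
  shows "tensor_fun X Y U V (\<lambda>p. f (fst p))"
proof -
  have "tensor_fun X Y U V (\<lambda>(x, y). \<Sum>l<(1::nat). f x * 1)"
    using assms space_with_functions.regular_const[OF assms(1,3), of 1]
    by (intro tensor_fun_finite) auto
  then show ?thesis by (simp add: case_prod_beta')
qed

lemma tensor_fun_snd:
  assumes "space_with_functions X" "regular Y V f" "openin (zariski X) U"
  shows "tensor_fun X Y U V (\<lambda>p. f (snd p))"
proof -
  have "tensor_fun X Y U V (\<lambda>(x, y). \<Sum>l<(1::nat). 1 * f y)"
    using assms space_with_functions.regular_const[OF assms(1,3), of 1]
    by (intro tensor_fun_finite) auto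
  then show ?thesis by (simp add: case_prod_beta')
qed

lemma tensor_fun_const:
  assumes "space_with_functions X" "space_with_functions Y" "openin (zariski X) U" "openin (zariski Y) V"
  shows "tensor_fun X Y U V (\<lambda>_. c)"
  using tensor_fun_fst[OF assms(2) space_with_functions.regular_const[OF assms(1,3)] assms(4)] .

lemma openin_prod_nonzero:
  "openin (zariski X) U \<Longrightarrow> openin (zariski Y) V \<Longrightarrow> tensor_fun X Y U V F \<Longrightarrow>
    openin (prod_zariski X Y) {p \<in> U \<times> V. F p \<noteq> 0}"
  unfolding prod_zariski_def by (rule topology_generated_by_Basis) blast

lemma zariski_var_prod [simp]: "zariski (X \<times>\<^sub>v Y) = prod_zariski X Y"
  by (simp add: var_prod_def)

lemma regular_var_prod: "regular (X \<times>\<^sub>v Y) W f \<longleftrightarrow> openin (prod_zariski X Y) W \<and>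
   (\<forall>p \<in> W. \<exists>U V F G N. openin (zariski X) U \<and> openin (zariski Y) V \<and>
      tensor_fun X Y U V F \<and> tensor_fun X Y U V G \<and>
      openin (prod_zariski X Y) N \<and> p \<in> N \<and> N \<subseteq> W \<inter> (U \<times> V) \<and>
      (\<forall>q \<in> N. G q \<noteq> 0 \<and> f q = F q / G q))"
  by (simp add: var_prod_def)

locale two_spaces_with_functions =
  X: space_with_functions X + Y: space_with_functions Y
  for X :: "'a variety" and Y :: "'b variety"
begin

lemma openin_prod_Times:
  assumes "openin (zariski X) U" "openin (zariski Y) V"
  shows "openin (prod_zariski X Y) (U \<times> V)"
proof -
  have "openin (prod_zariski X Y) {p \<in> U \<times> V. (1::complex) \<noteq> 0}"
    by (intro openin_prod_nonzero assms tensor_fun_const X.space_with_functions_axioms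
        Y.space_with_functions_axioms)
  then show ?thesis by simp
qed

lemma points_prod [simp]: "topspace (prod_zariski X Y) = points X \<times> points Y"
proof
  show "topspace (prod_zariski X Y) \<subseteq> points X \<times> points Y"
    unfolding prod_zariski_def topology_generated_by_topspace by (auto dest!: openin_subset)
  show "points X \<times> points Y \<subseteq> topspace (prod_zariski X Y)"
    by (intro openin_subset openin_prod_Times) auto
qed

text \<open>Numerators and denominators given on two rectangles become combinable after restriction
  to the intersection \<open>(U \<inter> U') \<times> (V \<inter> V')\<close>, where tensor
  functions are closed under sums and products.\<close>

lemma space_with_functions_prod: "space_with_functions (X \<times>\<^sub>v Y)"
proof (rule space_with_quotientsI[where Q = "\<lambda>N F G. \<exists>U V. openin (zariski X) U \<and> openin (zariski Y) V \<and>
    tensor_fun X Y U V F \<and> tensor_fun X Y U V G \<and> N \<subseteq> U \<times> V"], goal_cases)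
  case (1 W f)
  have "(\<exists>U V F G N. openin (zariski X) U \<and> openin (zariski Y) V \<and> tensor_fun X Y U V F \<and> tensor_fun X Y U V G \<and>
      openin (prod_zariski X Y) N \<and> p \<in> N \<and> N \<subseteq> W \<inter> (U \<times> V) \<and> (\<forall>q \<in> N. G q \<noteq> 0 \<and> f q = F q / G q)) \<longleftrightarrow>
    (\<exists>N F G. (\<exists>U V. openin (zariski X) U \<and> openin (zariski Y) V \<and>
      tensor_fun X Y U V F \<and> tensor_fun X Y U V G \<and> N \<subseteq> U \<times> V) \<and> openin (prod_zariski X Y) N \<and>
      p \<in> N \<and> N \<subseteq> W \<and> (\<forall>q \<in> N. G q \<noteq> 0 \<and> f q = F q / G q))" for p by (simp only: le_inf_iff) blast
  then show ?case unfolding regular_var_prod by simp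
next
  case (2 N N' F G)
  then show ?case by blast
next
  case (3 W c)
  then have "W \<subseteq> points X \<times> points Y" using openin_subset by fastforce
  moreover have "tensor_fun X Y (points X) (points Y) (\<lambda>_. c)" for c
    by (rule tensor_fun_const[OF X.space_with_functions_axioms Y.space_with_functions_axioms
        openin_topspace openin_topspace])
  ultimately show ?case by (intro exI[of _ "points X"] exI[of _ "points Y"]) simp
next
  note r = tensor_fun_restrict[OF X.space_with_functions_axioms Y.space_with_functions_axioms]
  note m = tensor_fun_mult[OF X.space_with_functions_axioms Y.space_with_functions_axioms]
  case (4 N F G F' G')
  then obtain U V U' V' where *: "openin (zariski X) U" "openin (zariski Y) V" "tensor_fun X Y U V F"
      "tensor_fun X Y U V G" "N \<subseteq> U \<times> V" "openin (zariski X) U'" "openin (zariski Y) V'"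
      "tensor_fun X Y U' V' F'" "tensor_fun X Y U' V' G'" "N \<subseteq> U' \<times> V'" by (elim exE conjE) (rule that)
  have o: "openin (zariski X) (U \<inter> U')" "openin (zariski Y) (V \<inter> V')" using * by auto
  note t = r[OF *(3) o(1) _ o(2)] r[OF *(4) o(1) _ o(2)] r[OF *(8) o(1) _ o(2)] r[OF *(9) o(1) _ o(2)]
  show ?case
    by (rule exI[of _ "U \<inter> U'"], rule exI[of _ "V \<inter> V'"]) (use t o *(5,10) in \<open>auto intro!: tensor_fun_add m\<close>)
next
  note r = tensor_fun_restrict[OF X.space_with_functions_axioms Y.space_with_functions_axioms]
  note m = tensor_fun_mult[OF X.space_with_functions_axioms Y.space_with_functions_axioms]
  case (5 N F G F' G')
  then obtain U V U' V' where *: "openin (zariski X) U" "openin (zariski Y) V" "tensor_fun X Y U V F"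
      "tensor_fun X Y U V G" "N \<subseteq> U \<times> V" "openin (zariski X) U'" "openin (zariski Y) V'"
      "tensor_fun X Y U' V' F'" "tensor_fun X Y U' V' G'" "N \<subseteq> U' \<times> V'" by (elim exE conjE) (rule that)
  have o: "openin (zariski X) (U \<inter> U')" "openin (zariski Y) (V \<inter> V')" using * by auto
  note t = r[OF *(3) o(1) _ o(2)] r[OF *(4) o(1) _ o(2)] r[OF *(8) o(1) _ o(2)] r[OF *(9) o(1) _ o(2)]
  show ?case
    by (rule exI[of _ "U \<inter> U'"], rule exI[of _ "V \<inter> V'"]) (use t o *(5,10) in \<open>auto intro!: m\<close>)
next
  case (6 N F G)
  then show ?case by blast
next
  case (7 N F G)
  then obtain U V where *: "openin (zariski X) U" "openin (zariski Y) V" "tensor_fun X Y U V F" "N \<subseteq> U \<times> V"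
    by blast
  then have "{q \<in> N. F q \<noteq> 0} = N \<inter> {q \<in> U \<times> V. F q \<noteq> 0}" by auto
  then show ?case using 7(2) openin_prod_nonzero[OF *(1-3)] by auto
qed

lemma morphism_fst: "morphism (X \<times>\<^sub>v Y) X fst"
  unfolding morphism_def
proof (intro conjI allI impI)
  have pre: "{p \<in> points (X \<times>\<^sub>v Y). fst p \<in> U} = U \<times> points Y" if "openin (zariski X) U" for U
    using openin_subset[OF that] by auto
  show "continuous_map (zariski (X \<times>\<^sub>v Y)) (zariski X) fst"
    unfolding continuous_map_def using openin_prod_Times[of _ "points Y"] pre by auto
  fix V f assume V: "openin (zariski X) V" "regular X V f"
  show "regular (X \<times>\<^sub>v Y) {p \<in> points (X \<times>\<^sub>v Y). fst p \<in> V} (f \<circ> fst)"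
    unfolding pre[OF V(1)] regular_var_prod
  proof (intro conjI ballI)
    show o: "openin (prod_zariski X Y) (V \<times> points Y)" using V openin_prod_Times by auto
    fix p assume "p \<in> V \<times> points Y"
    then show "\<exists>U V' F G N. openin (zariski X) U \<and> openin (zariski Y) V' \<and>
      tensor_fun X Y U V' F \<and> tensor_fun X Y U V' G \<and>
      openin (prod_zariski X Y) N \<and> p \<in> N \<and> N \<subseteq> (V \<times> points Y) \<inter> (U \<times> V') \<and>
      (\<forall>q \<in> N. G q \<noteq> 0 \<and> (f \<circ> fst) q = F q / G q)"
      using V o tensor_fun_fst[OF Y.space_with_functions_axioms V(2) openin_topspace]
        tensor_fun_const[OF X.space_with_functions_axioms Y.space_with_functions_axioms, of "V" "points Y" 1]
      by (rule_tac exI[of _ V], rule_tac exI[of _ "points Y"], rule_tac exI[of _ "\<lambda>p. f (fst p)"],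
        rule_tac exI[of _ "\<lambda>_. 1"], rule_tac exI[of _ "V \<times> points Y"])
        auto
  qed
qed

lemma morphism_snd: "morphism (X \<times>\<^sub>v Y) Y snd"
  unfolding morphism_def
proof (intro conjI allI impI)
  have pre: "{p \<in> points (X \<times>\<^sub>v Y). snd p \<in> U} = points X \<times> U" if "openin (zariski Y) U" for U
    using openin_subset[OF that] by auto
  show "continuous_map (zariski (X \<times>\<^sub>v Y)) (zariski Y) snd"
    unfolding continuous_map_def using openin_prod_Times[of "points X"] pre by auto
  fix V f assume V: "openin (zariski Y) V" "regular Y V f"
  show "regular (X \<times>\<^sub>v Y) {p \<in> points (X \<times>\<^sub>v Y). snd p \<in> V} (f \<circ> snd)"
    unfolding pre[OF V(1)] regular_var_prod
  proof (intro conjI ballI)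
    show o: "openin (prod_zariski X Y) (points X \<times> V)" using V openin_prod_Times by auto
    fix p assume "p \<in> points X \<times> V"
    then show "\<exists>U V' F G N. openin (zariski X) U \<and> openin (zariski Y) V' \<and>
      tensor_fun X Y U V' F \<and> tensor_fun X Y U V' G \<and>
      openin (prod_zariski X Y) N \<and> p \<in> N \<and> N \<subseteq> (points X \<times> V) \<inter> (U \<times> V') \<and>
      (\<forall>q \<in> N. G q \<noteq> 0 \<and> (f \<circ> snd) q = F q / G q)"
      using V o tensor_fun_snd[OF X.space_with_functions_axioms V(2) openin_topspace]
        tensor_fun_const[OF X.space_with_functions_axioms Y.space_with_functions_axioms, of "points X" "V" 1]
      by (rule_tac exI[of _ "points X"], rule_tac exI[of _ V], rule_tac exI[of _ "\<lambda>p. f (snd p)"],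
        rule_tac exI[of _ "\<lambda>_. 1"], rule_tac exI[of _ "points X \<times> V"])
        auto
  qed
qed

end

text \<open>The computation behind the universal property of the product: both families of factors
  pull back to regular functions on a common open set, and a tensor function is a finite sum of
  products of them.\<close>

lemma (in space_with_functions) regular_tensor_fun:
  assumes \<phi>: "morphism X Y \<phi>" "morphism X Z \<psi>" and F: "tensor_fun Y Z U V F"
    and "openin (zariski Y) U" "openin (zariski Z) V"
  shows "regular X {x \<in> points X. \<phi> x \<in> U \<and> \<psi> x \<in> V} (\<lambda>x. F (\<phi> x, \<psi> x))"
proof -
  obtain m :: nat and g h where *: "\<And>l. l < m \<Longrightarrow> regular Y U (g l)" "\<And>l. l < m \<Longrightarrow> regular Z V (h l)"
    "\<And>x y. F (x, y) = (\<Sum>l<m. g l x * h l y)" using F by (rule tensor_funE) auto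
  have o: "openin (zariski X) {x \<in> points X. \<phi> x \<in> U}" "openin (zariski X) {x \<in> points X. \<psi> x \<in> V}"
    using assms by (auto simp: morphism_def continuous_map_def)
  have "{x \<in> points X. \<phi> x \<in> U} \<inter> {x \<in> points X. \<psi> x \<in> V} = {x \<in> points X. \<phi> x \<in> U \<and> \<psi> x \<in> V}"
    by auto
  then have W: "openin (zariski X) {x \<in> points X. \<phi> x \<in> U \<and> \<psi> x \<in> V}"
    using openin_Int[OF o] by simp
  have "regular X {x \<in> points X. \<phi> x \<in> U \<and> \<psi> x \<in> V} (\<lambda>x. g l (\<phi> x))" if "l < m" for l
    using \<phi>(1) *(1)[OF that] assms(4) W
    by (rule_tac regular_restrict[of "{x \<in> points X. \<phi> x \<in> U}" "\<lambda>x. g l (\<phi> x)"])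
      (auto simp: morphism_def comp_def)
  moreover have "regular X {x \<in> points X. \<phi> x \<in> U \<and> \<psi> x \<in> V} (\<lambda>x. h l (\<psi> x))" if "l < m" for l
    using \<phi>(2) *(2)[OF that] assms(5) W
    by (rule_tac regular_restrict[of "{x \<in> points X. \<psi> x \<in> V}" "\<lambda>x. h l (\<psi> x)"])
      (auto simp: morphism_def comp_def)
  ultimately show ?thesis unfolding *(3) using W by (intro regular_sum regular_mult) auto
qed

lemma (in space_with_functions) morphism_Pair:
  assumes "space_with_functions Y" "space_with_functions Z"
    and \<phi>: "morphism X Y \<phi>" "morphism X Z \<psi>"
  shows "morphism X (Y \<times>\<^sub>v Z) (\<lambda>x. (\<phi> x, \<psi> x))"
  unfolding morphism_def
proof (intro conjI allI impI)
  interpret P: two_spaces_with_functions Y Z using assms by (simp add: two_spaces_with_functions_def)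
  note reg = regular_tensor_fun[OF \<phi>]
  show cont: "continuous_map (zariski X) (zariski (Y \<times>\<^sub>v Z)) (\<lambda>x. (\<phi> x, \<psi> x))"
    unfolding zariski_var_prod prod_zariski_def
  proof (rule continuous_on_generated_topo)
    fix W assume "W \<in> {{p \<in> U \<times> V. F p \<noteq> 0} | U V F.
        openin (zariski Y) U \<and> openin (zariski Z) V \<and> tensor_fun Y Z U V F}"
    then obtain U V F where *: "W = {p \<in> U \<times> V. F p \<noteq> 0}" "openin (zariski Y) U"
      "openin (zariski Z) V" "tensor_fun Y Z U V F" by auto
    have "(\<lambda>x. (\<phi> x, \<psi> x)) -` W \<inter> points X =
        {x \<in> {x \<in> points X. \<phi> x \<in> U \<and> \<psi> x \<in> V}. F (\<phi> x, \<psi> x) \<noteq> 0}"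
      using * by auto
    then show "openin (zariski X) ((\<lambda>x. (\<phi> x, \<psi> x)) -` W \<inter> points X)"
      using open_nonzero[OF reg[OF *(4,2,3)]] by simp
  next
    have "(\<lambda>x. (\<phi> x, \<psi> x)) ` points X \<subseteq> topspace (prod_zariski Y Z)"
      using \<phi> by (auto simp: morphism_def continuous_map_def)
    then show "(\<lambda>x. (\<phi> x, \<psi> x)) ` points X \<subseteq> \<Union> {{p \<in> U \<times> V. F p \<noteq> 0} | U V F.
        openin (zariski Y) U \<and> openin (zariski Z) V \<and> tensor_fun Y Z U V F}"
      unfolding prod_zariski_def topology_generated_by_topspace .
  qed
  fix W f assume W: "openin (zariski (Y \<times>\<^sub>v Z)) W" "regular (Y \<times>\<^sub>v Z) W f"
  show "regular X {x \<in> points X. (\<phi> x, \<psi> x) \<in> W} (f \<circ> (\<lambda>x. (\<phi> x, \<psi> x)))"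
  proof (rule regular_local)
    show "openin (zariski X) {x \<in> points X. (\<phi> x, \<psi> x) \<in> W}"
      using cont W by (auto simp: continuous_map_def)
    fix x assume "x \<in> {x \<in> points X. (\<phi> x, \<psi> x) \<in> W}"
    then have x: "x \<in> points X" "(\<phi> x, \<psi> x) \<in> W" by auto
    obtain U V F G N where *: "openin (zariski Y) U" "openin (zariski Z) V"
      "tensor_fun Y Z U V F" "tensor_fun Y Z U V G"
      "openin (prod_zariski Y Z) N" "(\<phi> x, \<psi> x) \<in> N" "N \<subseteq> W \<inter> (U \<times> V)"
      "\<forall>q \<in> N. G q \<noteq> 0 \<and> f q = F q / G q" 
    proof -
      have "\<exists>U V F G N. openin (zariski Y) U \<and> openin (zariski Z) V \<and>
        tensor_fun Y Z U V F \<and> tensor_fun Y Z U V G \<and> openin (prod_zariski Y Z) N \<and>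
        (\<phi> x, \<psi> x) \<in> N \<and> N \<subseteq> W \<inter> (U \<times> V) \<and> (\<forall>q \<in> N. G q \<noteq> 0 \<and> f q = F q / G q)"
        using W(2) x(2) unfolding regular_var_prod by (elim conjE) (rule bspec)
      then show thesis by (elim exE conjE) (rule that)
    qed
    define T where "T = {x \<in> points X. (\<phi> x, \<psi> x) \<in> N}"
    have T: "openin (zariski X) T" unfolding T_def using cont * by (auto simp: continuous_map_def)
    have sub: "T \<subseteq> {x \<in> points X. \<phi> x \<in> U \<and> \<psi> x \<in> V}" using * by (auto simp: T_def)
    have "regular X T (\<lambda>x. F (\<phi> x, \<psi> x) / G (\<phi> x, \<psi> x))"
      using * by (intro regular_divide regular_restrict[OF reg T sub]) (auto simp: T_def)
    then show "\<exists>V g. openin (zariski X) V \<and> x \<in> V \<and> regular X V g \<and>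
        (\<forall>y \<in> {x \<in> points X. (\<phi> x, \<psi> x) \<in> W} \<inter> V. (f \<circ> (\<lambda>x. (\<phi> x, \<psi> x))) y = g y)"
      using T x * by (intro exI[of _ T] exI[of _ "\<lambda>x. F (\<phi> x, \<psi> x) / G (\<phi> x, \<psi> x)"])
        (auto simp: T_def)
  qed
qed

section \<open>The Grassmannian\<close>

lemma zariski_grassmannian [simp]: "zariski (grassmannian k n) = Gr_zariski k n"
  by (simp add: grassmannian_def)

lemma openin_Gr_nonzero: "plucker_form k n d F \<Longrightarrow> openin (Gr_zariski k n) {W \<in> Gr k n. F W \<noteq> 0}"
  unfolding Gr_zariski_def by (rule topology_generated_by_Basis) auto

lemma points_Gr [simp]: "topspace (Gr_zariski k n) = Gr k n"
proof
  show "topspace (Gr_zariski k n) \<subseteq> Gr k n"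
    unfolding Gr_zariski_def topology_generated_by_topspace by auto
  have "Gr k n = {W \<in> Gr k n. (1::complex) \<noteq> 0}" by simp
  also have "\<dots> \<subseteq> topspace (Gr_zariski k n)"
    by (rule openin_subset[OF openin_Gr_nonzero]) (rule plucker_form.const)
  finally show "Gr k n \<subseteq> topspace (Gr_zariski k n)" .
qed

lemma regular_grassmannian: "regular (grassmannian k n) U f \<longleftrightarrow> openin (Gr_zariski k n) U \<and>
       (\<forall>x \<in> U. \<exists>d F G V. plucker_form k n d F \<and> plucker_form k n d G \<and>
          openin (Gr_zariski k n) V \<and> x \<in> V \<and> V \<subseteq> U \<and>
          (\<forall>W \<in> V. G W \<noteq> 0 \<and> f W = F W / G W))"
  by (simp add: grassmannian_def)

lemma space_with_functions_grassmannian: "space_with_functions (grassmannian k n)"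
proof (rule space_with_quotientsI[where Q = "\<lambda>N F G. \<exists>d. plucker_form k n d F \<and> plucker_form k n d G"], goal_cases)
  case (1 U f)
  have "(\<exists>d F G V. plucker_form k n d F \<and> plucker_form k n d G \<and> openin (Gr_zariski k n) V \<and> x \<in> V \<and> V \<subseteq> U \<and>
      (\<forall>W \<in> V. G W \<noteq> 0 \<and> f W = F W / G W)) \<longleftrightarrow>
    (\<exists>N F G. (\<exists>d. plucker_form k n d F \<and> plucker_form k n d G) \<and> openin (Gr_zariski k n) N \<and>
      x \<in> N \<and> N \<subseteq> U \<and> (\<forall>y \<in> N. G y \<noteq> 0 \<and> f y = F y / G y))" for x by blast
  then show ?case unfolding regular_grassmannian by simp
next
  case (3 N c)
  show ?case by (intro exI[of _ 0] conjI plucker_form.const)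
next
  case (4 N F G F' G')
  then obtain d d' where *: "plucker_form k n d F" "plucker_form k n d G" "plucker_form k n d' F'" "plucker_form k n d' G'"
    by blast
  have "plucker_form k n (d + d') (\<lambda>W. F' W * G W)"
    using plucker_form.mult[OF *(3,2)] by (simp add: add.commute)
  with * show ?case
    by (rule_tac exI[of _ "d + d'"]) (intro conjI plucker_form.add plucker_form.mult[OF *(1,4)]
        plucker_form.mult[OF *(2,4)])
next
  case (5 N F G F' G')
  then show ?case by (blast intro: plucker_form.mult)
next
  case (7 N F G)
  then obtain d where d: "plucker_form k n d F" by blast
  have "N \<subseteq> Gr k n" using 7(2) openin_subset by fastforce
  then have "{x \<in> N. F x \<noteq> 0} = N \<inter> {W \<in> Gr k n. F W \<noteq> 0}" by auto
  then show ?case using 7(2) openin_Gr_nonzero[OF d] by auto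
qed auto

text \<open>Homogeneity makes a family of functions proportional to the Pluecker coordinates enough to
  control the pull-back of every form and of every quotient of forms of equal degree.\<close>

lemma (in space_with_functions) morphism_grassmannian:
  assumes Gr: "\<And>x. x \<in> points X \<Longrightarrow> \<phi> x \<in> Gr k n"
    and reg: "\<And>J. J \<in> ksubsets k n \<Longrightarrow> regular X (points X) (p J)"
    and coords: "\<And>x. x \<in> points X \<Longrightarrow> \<exists>c. c \<noteq> 0 \<and> (\<forall>J \<in> ksubsets k n. plucker k n J (\<phi> x) = c * p J x)"
  shows "morphism X (grassmannian k n) \<phi>"
proof -
  \<comment> \<open>A pointwise choice without any regularity: it enters only through the nonzero
    factor \<open>c x ^ d\<close>, which cancels in quotients.\<close>
  obtain c where c: "\<And>x. x \<in> points X \<Longrightarrow> c x \<noteq> 0"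
    "\<And>x J. x \<in> points X \<Longrightarrow> J \<in> ksubsets k n \<Longrightarrow> plucker k n J (\<phi> x) = c x * p J x"
    using coords by metis
  have form: "\<exists>F'. regular X (points X) F' \<and> (\<forall>x \<in> points X. F (\<phi> x) = c x ^ d * F' x)"
    if "plucker_form k n d F" for d F
    using that
  proof induction
    case (const a)
    then show ?case by (intro exI[of _ "\<lambda>_. a"]) (auto intro: regular_const)
  next
    case (coord J)
    then show ?case using reg c by (intro exI[of _ "p J"]) auto
  next
    case (add d F G)
    then obtain F' G' where "regular X (points X) F'" "\<forall>x \<in> points X. F (\<phi> x) = c x ^ d * F' x"
      "regular X (points X) G'" "\<forall>x \<in> points X. G (\<phi> x) = c x ^ d * G' x" by auto
    then show ?case by (intro exI[of _ "\<lambda>x. F' x + G' x"]) (auto intro: regular_add simp: algebra_simps)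
  next
    case (mult d F e G)
    then obtain F' G' where "regular X (points X) F'" "\<forall>x \<in> points X. F (\<phi> x) = c x ^ d * F' x"
      "regular X (points X) G'" "\<forall>x \<in> points X. G (\<phi> x) = c x ^ e * G' x" by auto
    then show ?case by (intro exI[of _ "\<lambda>x. F' x * G' x"]) (auto intro: regular_mult simp: power_add)
  qed
  show ?thesis unfolding morphism_def
  proof (intro conjI allI impI)
    show cont: "continuous_map (zariski X) (zariski (grassmannian k n)) \<phi>"
      unfolding zariski_grassmannian Gr_zariski_def
    proof (rule continuous_on_generated_topo)
      fix U assume "U \<in> {{W \<in> Gr k n. F W \<noteq> 0} | d F. plucker_form k n d F}"
      then obtain d F where *: "U = {W \<in> Gr k n. F W \<noteq> 0}" "plucker_form k n d F" by auto
      obtain F' where F': "regular X (points X) F'" "\<forall>x \<in> points X. F (\<phi> x) = c x ^ d * F' x"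
        using form[OF *(2)] by auto
      have "\<phi> -` U \<inter> points X = {x \<in> points X. F' x \<noteq> 0}" using Gr * F' c by auto
      then show "openin (zariski X) (\<phi> -` U \<inter> points X)" using open_nonzero[OF F'(1)] by simp
    next
      have "\<phi> ` points X \<subseteq> topspace (Gr_zariski k n)" using Gr by auto
      then show "\<phi> ` points X \<subseteq> \<Union> {{W \<in> Gr k n. F W \<noteq> 0} | d F. plucker_form k n d F}"
        unfolding Gr_zariski_def topology_generated_by_topspace .
    qed
    fix V f assume V: "openin (zariski (grassmannian k n)) V" "regular (grassmannian k n) V f"
    show "regular X {x \<in> points X. \<phi> x \<in> V} (f \<circ> \<phi>)"
    proof (rule regular_local)
      show "openin (zariski X) {x \<in> points X. \<phi> x \<in> V}" using cont V by (auto simp: continuous_map_def)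
      fix x assume "x \<in> {x \<in> points X. \<phi> x \<in> V}"
      then have x: "x \<in> points X" "\<phi> x \<in> V" by auto
      obtain d F G T where T: "plucker_form k n d F" "plucker_form k n d G"
        "openin (Gr_zariski k n) T" "\<phi> x \<in> T" "T \<subseteq> V" "\<forall>W \<in> T. G W \<noteq> 0 \<and> f W = F W / G W"
        
      proof -
        have "\<exists>d F G T. plucker_form k n d F \<and> plucker_form k n d G \<and> openin (Gr_zariski k n) T \<and>
          \<phi> x \<in> T \<and> T \<subseteq> V \<and> (\<forall>W \<in> T. G W \<noteq> 0 \<and> f W = F W / G W)"
          using V(2) x(2) unfolding regular_grassmannian by (elim conjE) (rule bspec)
        then show thesis by (elim exE conjE) (rule that)
      qed
      obtain F' where F': "regular X (points X) F'" "\<forall>x \<in> points X. F (\<phi> x) = c x ^ d * F' x"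
        using form[OF T(1)] by auto
      obtain G' where G': "regular X (points X) G'" "\<forall>x \<in> points X. G (\<phi> x) = c x ^ d * G' x"
        using form[OF T(2)] by auto
      define S where "S = {x \<in> points X. \<phi> x \<in> T}"
      have S: "openin (zariski X) S" unfolding S_def using cont T by (auto simp: continuous_map_def)
      have eq: "G' y \<noteq> 0 \<and> f (\<phi> y) = F' y / G' y" if "y \<in> S" for y
        using that F'(2) G'(2) T(6) c(1) by (auto simp: S_def)
      have "regular X S (\<lambda>x. F' x / G' x)"
        using eq by (intro regular_divide regular_restrict[OF F'(1) S] regular_restrict[OF G'(1) S])
          (auto simp: S_def)
      then show "\<exists>V' h. openin (zariski X) V' \<and> x \<in> V' \<and> regular X V' h \<and>
          (\<forall>y \<in> {x \<in> points X. \<phi> x \<in> V} \<inter> V'. (f \<circ> \<phi>) y = h y)"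
        using S x T eq by (intro exI[of _ S] exI[of _ "\<lambda>x. F' x / G' x"]) (auto simp: S_def)
    qed
  qed
qed

section \<open>Affine permutations\<close>

abbreviation (input) inv_perm :: "(int \<Rightarrow> int) \<Rightarrow> int \<Rightarrow> int" where
  "inv_perm f \<equiv> inv_into UNIV f"

lemma simple_refl_cases:
  "simple_refl n i a = (if [a = i] (mod int n) then a + 1 else if [a = i + 1] (mod int n) then a - 1 else a)"
  by (simp add: simple_refl_def cong_def)

lemma not_cong_add1:
  fixes a :: int
  assumes "n \<ge> 2"
  shows "\<not> [a + 1 = a] (mod int n)"
proof
  assume "[a + 1 = a] (mod int n)"
  then have "int n dvd 1" by (simp add: cong_iff_dvd_diff)
  with assms show False by (simp add: zdvd1_eq)
qed

lemma cong_add_int: "[a + int n = b] (mod int n) \<longleftrightarrow> [a = b] (mod int n)"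
  by (simp add: cong_def)

lemma cong_diff_int: "[a - int n = b] (mod int n) \<longleftrightarrow> [a = b] (mod int n)"
  using cong_add_int[of "a - int n" n b] by simp

lemma cong_imp_eq:
  fixes x y :: int
  assumes "[x = y] (mod int n)" "x \<le> y" "y < x + int n"
  shows "x = y"
proof -
  obtain m where m: "y - x = int n * m" using assms(1) by (metis cong_iff_lin add_diff_cancel_left')
  have "0 < int n" using assms by linarith
  moreover have "int n * 0 \<le> int n * m" "int n * m < int n * 1"
    unfolding m[symmetric] mult_zero_right mult_1_right using assms by linarith+
  ultimately have "0 \<le> m" "m < 1"
    using mult_le_cancel_left_pos[of "int n" 0 m] mult_less_cancel_left_pos[of "int n" m 1] by blast+
  then have "m = 0" by linarith
  with m show ?thesis by simp
qed

lemma simple_refl_involution: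
  assumes "n \<ge> 2"
  shows "simple_refl n i (simple_refl n i a) = a"
proof -
  have 1: "[a + 1 = i + 1] (mod int n)" if "[a = i] (mod int n)" using that by (simp add: cong_add_rcancel)
  have 2: "\<not> [a + 1 = i] (mod int n)" if "[a = i] (mod int n)"
    using not_cong_add1[OF assms, of a] that cong_trans cong_sym by blast
  have 3: "[a - 1 = i] (mod int n)" if "[a = i + 1] (mod int n)"
    using cong_diff[OF that cong_refl[of 1]] by simp
  show ?thesis using 1 2 3 by (auto simp: simple_refl_cases)
qed

lemma simple_refl_period: "simple_refl n i (a + int n) = simple_refl n i a + int n"
  by (simp add: simple_refl_cases cong_add_int)

lemma simple_refl_left: "simple_refl n i i = i + 1"
  by (simp add: simple_refl_cases)

lemma simple_refl_right: "n \<ge> 2 \<Longrightarrow> simple_refl n i (i + 1) = i"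
  using not_cong_add1[of n i] by (simp add: simple_refl_cases)

lemma simple_refl_other:
  "\<not> [a = i] (mod int n) \<Longrightarrow> \<not> [a = i + 1] (mod int n) \<Longrightarrow> simple_refl n i a = a"
  by (simp add: simple_refl_cases)

text \<open>\<open>s\<close> moves an integer by at most one, so it can reverse only neighbours, and
  among these only the pairs that it exchanges.\<close>

lemma simple_refl_mono:
  assumes "n \<ge> 2" "a < b" "\<not> ([a = i] (mod int n) \<and> b = a + 1)"
  shows "simple_refl n i a < simple_refl n i b"
proof -
  have "simple_refl n i a \<noteq> simple_refl n i b"
    using simple_refl_involution[OF assms(1)] assms(2) by (metis less_irrefl)
  moreover have "\<not> [b = i + 1] (mod int n)" if "[a = i + 1] (mod int n)" "b = a + 1"
    using not_cong_add1[OF assms(1), of a] that cong_trans cong_sym by blast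
  moreover have "[b = i + 1] (mod int n)" if "[a = i] (mod int n)" "b = a + 1"
    using that by (simp add: cong_add_rcancel)
  moreover have "[a = i] (mod int n)" if "[b = i + 1] (mod int n)" "b = a + 1"
    using that by (simp add: cong_add_rcancel)
  ultimately show ?thesis using assms(2,3) unfolding simple_refl_cases
    by (auto split: if_splits)
qed

lemma bounded_affine_bij: "f \<in> bounded_affine k n \<Longrightarrow> bij f"
  and bounded_affine_period: "f \<in> bounded_affine k n \<Longrightarrow> f (a + int n) = f a + int n"
  and bounded_affine_ge: "f \<in> bounded_affine k n \<Longrightarrow> a \<le> f a"
  and bounded_affine_le: "f \<in> bounded_affine k n \<Longrightarrow> f a \<le> a + int n"
  by (auto simp: bounded_affine_def affine_perm_def)

lemma period_mult:
  fixes g :: "int \<Rightarrow> int"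
  assumes "\<And>a. g (a + int n) = g a + int n"
  shows "g (a + int n * m) = g a + int n * m"
proof -
  have *: "g (a + int n * int l) = g a + int n * int l" for a l
  proof (induction l)
    case (Suc l)
    have "g (a + int n * int (Suc l)) = g (a + int n * int l + int n)" by (simp add: algebra_simps)
    also have "\<dots> = g (a + int n * int l) + int n" by (rule assms)
    finally show ?case using Suc by (simp add: algebra_simps)
  qed simp
  show ?thesis
  proof (cases "m \<ge> 0")
    case True
    then show ?thesis using *[of a "nat m"] by simp
  next
    case False
    then show ?thesis using *[of "a + int n * m" "nat (- m)"] by simp
  qed
qed

lemma bounded_affine_inv_period:
  assumes "f \<in> bounded_affine k n"
  shows "inv_perm f (a + int n) = inv_perm f a + int n"
proof -
  have b: "bij f" using assms by (rule bounded_affine_bij)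
  have "f (inv_perm f a + int n) = a + int n"
    using bounded_affine_period[OF assms] b by (simp add: bij_is_surj surj_f_inv_f)
  then show ?thesis using b by (metis bij_inv_eq_iff)
qed

section \<open>Inversions and double ascents\<close>

definition inversions :: "nat \<Rightarrow> (int \<Rightarrow> int) \<Rightarrow> (int \<times> int) set" where
  "inversions n f = {(a, b). a \<in> {1..int n} \<and> a < b \<and> f a > f b}"

lemma finite_inversions:
  assumes "f \<in> bounded_affine k n"
  shows "finite (inversions n f)"
proof (rule finite_subset)
  show "inversions n f \<subseteq> {1..int n} \<times> {1..2 * int n}"
  proof (clarsimp simp: inversions_def)
    fix a b assume "1 \<le> a" "a \<le> int n" "a < b" "f b < f a"
    moreover have "b \<le> f b" "f a \<le> a + int n"
      using assms bounded_affine_ge bounded_affine_le by auto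
    ultimately show "b \<le> 2 * int n" by linarith
  qed
qed simp

text \<open>Applying \<open>s\<close> to values reverses only adjacent values congruent to
  \<open>i, i + 1\<close>. Up to translation they occupy one pair of positions, which can become an
  inversion only if the smaller value stands first.\<close>

lemma length_right_mult:
  assumes n: "n \<ge> 2" and f: "f \<in> bounded_affine k n"
  shows "aff_length n (f \<star> simple_refl n i) \<le> aff_length n f + (if inv_perm f i < inv_perm f (i + 1) then 1 else 0)"
proof -
  let ?s = "simple_refl n i"
  have b: "bij f" using f by (rule bounded_affine_bij)
  \<comment> \<open>The candidates for new inversions. They are translates of a single pair, so at
    most one has its first entry in \<open>[n]\<close>.\<close>
  define E where "E = (if inv_perm f i < inv_perm f (i + 1)
    then {p. fst p \<in> {1..int n} \<and> [f (fst p) = i] (mod int n) \<and> snd p = inv_perm f (f (fst p) + 1)} else {})"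
  have shift: "inv_perm f (i + int n * m) = inv_perm f i + int n * m" for i m
    by (rule period_mult) (rule bounded_affine_inv_period[OF f])
  have sub: "inversions n (f \<star> ?s) \<subseteq> inversions n f \<union> E"
  proof (clarify)
    fix a c assume *: "(a, c) \<in> inversions n (f \<star> ?s)" and "(a, c) \<notin> E"
    show "(a, c) \<in> inversions n f"
    proof (rule ccontr)
      assume "(a, c) \<notin> inversions n f"
      with * have le: "f a \<le> f c" and lt: "?s (f c) < ?s (f a)" "a < c" "a \<in> {1..int n}"
        by (auto simp: inversions_def aff_mult_def)
      have ne: "f a \<noteq> f c" using lt by auto
      then have "[f a = i] (mod int n) \<and> f c = f a + 1"
        using simple_refl_mono[OF n, of "f a" "f c" i] le lt by linarith
      moreover from this have "c = inv_perm f (f a + 1)" using b by (metis bij_inv_eq_iff)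
      moreover have "inv_perm f i < inv_perm f (i + 1)"
      proof -
        obtain m where m: "f a = i + int n * m"
          using calculation(1) by (metis cong_iff_lin cong_sym)
        have "a = inv_perm f (i + int n * m)" using m b by (metis bij_inv_eq_iff)
        moreover have "c = inv_perm f ((i + 1) + int n * m)"
          using \<open>c = inv_perm f (f a + 1)\<close> m by (simp add: algebra_simps)
        ultimately show ?thesis using \<open>a < c\<close> unfolding shift by simp
      qed
      ultimately show False using \<open>(a, c) \<notin> E\<close> lt by (simp add: E_def)
    qed
  qed
  have "card E \<le> (if inv_perm f i < inv_perm f (i + 1) then 1 else 0) \<and> finite E"
  proof (cases "inv_perm f i < inv_perm f (i + 1)")
    case True
    have "p = q" if p: "p \<in> E" and q: "q \<in> E" for p q
    proof -
      have "[f (fst p) = f (fst q)] (mod int n)" using p q True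
        by (auto simp: E_def intro: cong_trans cong_sym)
      then obtain m where "f (fst q) = f (fst p) + int n * m" by (metis cong_iff_lin)
      then have "f (fst q) = f (fst p + int n * m)"
        using period_mult[of f n] bounded_affine_period[OF f] by simp
      then have m: "fst q = fst p + int n * m" using b by (simp add: bij_is_inj inj_eq)
      then have "[fst p = fst q] (mod int n)" by (metis cong_iff_lin)
      then have "fst p = fst q"
        using p q True cong_imp_eq[of "fst p" "fst q" n] cong_imp_eq[of "fst q" "fst p" n]
        by (cases "fst p \<le> fst q") (auto simp: E_def cong_sym)
      then show ?thesis using p q True by (auto simp: E_def prod_eq_iff)
    qed
    then have "E = {} \<or> (\<exists>p. E = {p})" by blast
    then show ?thesis using True by auto
  qed (simp add: E_def)
  then have "card (inversions n f \<union> E) \<le> card (inversions n f) + (if inv_perm f i < inv_perm f (i + 1) then 1 else 0)"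
    and fin: "finite (inversions n f \<union> E)"
    using card_Un_le[of "inversions n f" E] finite_inversions[OF f] by auto
  with card_mono[OF fin sub] show ?thesis by (simp add: aff_length_def inversions_def)
qed

text \<open>Here \<open>s\<close> permutes positions. Apart from neighbouring positions congruent to
  \<open>i, i + 1\<close> it carries inversions to inversions, but a first position may leave
  \<open>[n]\<close> and must be translated back.\<close>

lemma length_left_mult:
  assumes n: "n \<ge> 2" and f: "f \<in> bounded_affine k n"
  shows "aff_length n (simple_refl n i \<star> f) \<le> aff_length n f + (if f i < f (i + 1) then 1 else 0)"
proof -
  let ?s = "simple_refl n i" let ?g = "simple_refl n i \<star> f"
  have fper: "f (a + int n * m) = f a + int n * m" for a m
    by (rule period_mult) (rule bounded_affine_period[OF f])
  have sper: "?s (a + int n * m) = ?s a + int n * m" for a m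
    by (rule period_mult) (rule simple_refl_period)
  \<comment> \<open>The multiple of \<open>n\<close> that brings a position into \<open>[n]\<close>.
    Below, \<open>T\<close> applies \<open>s\<close> to both positions and then translates them by
    the same amount.\<close>
  define \<sigma> where "\<sigma> a = - (int n) * ((a - 1) div int n)" for a
  have \<sigma>: "a + \<sigma> a \<in> {1..int n}" for a
  proof -
    have "a - 1 = int n * ((a - 1) div int n) + (a - 1) mod int n" by simp
    moreover have "0 \<le> (a - 1) mod int n" "(a - 1) mod int n < int n" using n by simp_all
    ultimately show ?thesis unfolding \<sigma>_def atLeastAtMost_iff mult_minus_left by linarith
  qed
  define T where "T = (\<lambda>(a, b). (?s a + \<sigma> (?s a), ?s b + \<sigma> (?s a)))"
  define E where "E = {p \<in> inversions n ?g. [fst p = i] (mod int n) \<and> snd p = fst p + 1}"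
  have into: "T p \<in> inversions n f" if "p \<in> inversions n ?g - E" for p
  proof -
    obtain a b where p: "p = (a, b)" by fastforce
    with that have *: "a < b" "f (?s b) < f (?s a)" "\<not> ([a = i] (mod int n) \<and> b = a + 1)"
      by (auto simp: inversions_def E_def aff_mult_def)
    have "?s a < ?s b" using simple_refl_mono[OF n *(1,3)] .
    moreover have "f (?s b + \<sigma> (?s a)) < f (?s a + \<sigma> (?s a))"
      using *(2) fper[of "?s b" "- ((?s a - 1) div int n)"] fper[of "?s a" "- ((?s a - 1) div int n)"]
      by (simp add: \<sigma>_def)
    ultimately show ?thesis using \<sigma>[of "?s a"] by (simp add: p T_def inversions_def)
  qed
  have inj: "inj_on T (inversions n ?g)"
  proof (rule inj_onI)
    fix p q assume *: "p \<in> inversions n ?g" "q \<in> inversions n ?g" "T p = T q"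
    obtain a b a' b' where p: "p = (a, b)" "q = (a', b')" by fastforce
    obtain m where m: "?s a' = ?s a + int n * m" "?s b' = ?s b + int n * m"
    proof
      show "?s a' = ?s a + int n * ((?s a' - 1) div int n - (?s a - 1) div int n)"
        "?s b' = ?s b + int n * ((?s a' - 1) div int n - (?s a - 1) div int n)"
        using *(3) by (auto simp: p T_def \<sigma>_def algebra_simps)
    qed
    have ab: "a' = a + int n * m" "b' = b + int n * m"
      using m sper simple_refl_involution[OF n] by metis+
    then have "[a = a'] (mod int n)" by (metis cong_iff_lin)
    moreover have "a \<in> {1..int n}" "a' \<in> {1..int n}" using * by (auto simp: p inversions_def)
    ultimately have "a = a'"
      using cong_imp_eq[of a a' n] cong_imp_eq[of a' a n] by (cases "a \<le> a'") (auto simp: cong_sym)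
    with ab show "p = q" by (simp add: p)
  qed
  have E: "finite E \<and> card E \<le> (if f i < f (i + 1) then 1 else 0)"
  proof -
    have lt: "f i < f (i + 1)" if pE: "p \<in> E" for p
    proof -
      obtain a where a: "p = (a, a + 1)" using pE by (cases p) (auto simp: E_def)
      have "[i = a] (mod int n)" using pE a by (simp add: E_def cong_sym)
      then obtain m where m: "a = i + int n * m" by (metis cong_iff_lin)
      have "f (?s (a + 1)) < f (?s a)" using pE a by (simp add: E_def inversions_def aff_mult_def)
      moreover have "?s (a + 1) = i + int n * m" "?s a = i + 1 + int n * m"
        using sper[of "i + 1" m] sper[of i m] simple_refl_left[of n i] simple_refl_right[OF n, of i]
        by (auto simp: m algebra_simps)
      ultimately show ?thesis unfolding fper by (simp add: fper)
    qed
    have "p = q" if p: "p \<in> E" and q: "q \<in> E" for p q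
    proof -
      have "[fst p = fst q] (mod int n)" using p q by (auto simp: E_def intro: cong_trans cong_sym)
      then have "fst p = fst q"
        using p q cong_imp_eq[of "fst p" "fst q" n] cong_imp_eq[of "fst q" "fst p" n]
        by (cases "fst p \<le> fst q") (auto simp: E_def inversions_def cong_sym)
      then show ?thesis using p q by (auto simp: E_def prod_eq_iff)
    qed
    then have "E = {} \<or> (\<exists>p. E = {p})" by blast
    then show ?thesis using lt by auto
  qed
  have "finite (inversions n ?g - E)" "card (inversions n ?g - E) \<le> card (inversions n f)"
    using card_inj_on_le[of T "inversions n ?g - E" "inversions n f"] into finite_inversions[OF f]
      inj_on_subset[OF inj] inj_on_finite[of T "inversions n ?g - E" "inversions n f"] by blast+
  moreover have "inversions n ?g = (inversions n ?g - E) \<union> E" by (auto simp: E_def)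
  then have "card (inversions n ?g) \<le> card (inversions n ?g - E) + card E"
    by (metis card_Un_le)
  ultimately show ?thesis using E by (simp add: aff_length_def inversions_def)
qed

text \<open>Each multiplication by \<open>s\<close> gains at most one inversion, and only at an
  ascent, so a gain of two forces both ascents. The outer bounds come from boundedness of the
  products, since \<open>s\<close> pushes a boundary value out of the admissible window; the
  remaining boundary cases contradict bounds already found.\<close>

lemma double_ascent:
  fixes f :: "int \<Rightarrow> int" and i :: int and n k :: nat
  defines "s \<equiv> simple_refl n i"
  assumes n: "n \<ge> 2" and f: "f \<in> bounded_affine k n" and sf: "s \<star> f \<in> bounded_affine k n"
    and fs: "f \<star> s \<in> bounded_affine k n" and sfs: "s \<star> f \<star> s \<in> bounded_affine k n"
    and len: "aff_length n (s \<star> f \<star> s) = aff_length n f + 2"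
  shows "i + 2 - int n \<le> inv_perm f i" "inv_perm f i < inv_perm f (i + 1)" "inv_perm f (i + 1) \<le> i - 1"
    and "i + 2 \<le> f i" "f i < f (i + 1)" "f (i + 1) \<le> i + int n - 1"
proof -
  have b: "bij f" using f by (rule bounded_affine_bij)
  have r: "aff_length n (s \<star> f \<star> s) \<le> aff_length n (s \<star> f) + (if inv_perm (s \<star> f) i < inv_perm (s \<star> f) (i + 1) then 1 else 0)"
    unfolding s_def by (rule length_right_mult[OF n sf[unfolded s_def]])
  have l: "aff_length n (s \<star> f) \<le> aff_length n f + (if f i < f (i + 1) then 1 else 0)"
    unfolding s_def by (rule length_left_mult[OF n f])
  from r l len show cd: "f i < f (i + 1)" by (auto split: if_splits)
  from r l len have ab': "inv_perm (s \<star> f) i < inv_perm (s \<star> f) (i + 1)" by (auto split: if_splits)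
  have si: "s i = i + 1" "s (i + 1) = i"
    using simple_refl_left simple_refl_right[OF n] by (auto simp: s_def)
  have inv: "s (s a) = a" for a unfolding s_def by (rule simple_refl_involution[OF n])
  have sper: "s (a + int n) = s a + int n" for a unfolding s_def by (rule simple_refl_period)
  have fi: "f (inv_perm f a) = a" "inv_perm f (f a) = a" for a
    using b by (auto simp: bij_is_surj surj_f_inv_f bij_is_inj)
  \<comment> \<open>The second ascent is first obtained for \<open>s \<star> f\<close>. It passes to
    \<open>f\<close> at the end, once both preimages are known to lie where \<open>s\<close> fixes
    them.\<close>
  have "inv_perm (s \<star> f) a = s (inv_perm f a)" for a
    by (rule inv_f_eq) (use sf bounded_affine_bij in \<open>auto simp: bij_is_inj aff_mult_def inv fi\<close>)
  with ab' have ab: "s (inv_perm f i) < s (inv_perm f (i + 1))" by simp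
  have c1: "i + 1 \<le> f i" using bounded_affine_ge[OF sf, of "i + 1"] by (simp add: aff_mult_def si)
  have d1: "f (i + 1) \<le> i + int n" using bounded_affine_le[OF sf, of i] by (simp add: aff_mult_def si)
  have "f i \<noteq> i + 1" using bounded_affine_ge[OF sfs, of "i + 1"] by (auto simp: aff_mult_def si)
  with c1 show c2: "i + 2 \<le> f i" by simp
  have "f (i + 1) \<noteq> i + int n"
    using bounded_affine_le[OF sfs, of i] sper[of i] by (auto simp: aff_mult_def si)
  with d1 show d2: "f (i + 1) \<le> i + int n - 1" by simp
  have a1: "i + 1 \<le> inv_perm f i + int n"
    using bounded_affine_le[OF fs, of "inv_perm f i"] by (simp add: aff_mult_def fi si)
  have b1: "inv_perm f (i + 1) \<le> i"
    using bounded_affine_ge[OF fs, of "inv_perm f (i + 1)"] by (simp add: aff_mult_def fi si)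
  have "inv_perm f (i + 1) \<noteq> i" using fi(1)[of "i + 1"] c2 by auto
  with b1 show b2: "inv_perm f (i + 1) \<le> i - 1" by simp
  have "inv_perm f i \<noteq> i + 1 - int n"
    using bounded_affine_period[OF f, of "inv_perm f i"] fi(1)[of i] d2 by auto
  with a1 show a2: "i + 2 - int n \<le> inv_perm f i" by simp
  have ne: "inv_perm f i \<noteq> inv_perm f (i + 1)" by (metis fi(1) add_left_cancel add_0_right zero_neq_one)
  have a3: "inv_perm f i \<le> i" using bounded_affine_ge[OF f, of "inv_perm f i"] fi(1) by simp
  have "inv_perm f i \<noteq> i" using fi(1)[of i] c2 by auto
  have nc: "\<not> [a = i] (mod int n) \<and> \<not> [a = i + 1] (mod int n)" if "i + 2 - int n \<le> a" "a \<le> i - 1" for a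
    using cong_imp_eq[of a i n] cong_imp_eq[of "i + 1 - int n" a n] that
    by (auto simp: cong_diff_int cong_sym)
  have b3: "i + 1 - int n \<le> inv_perm f (i + 1)"
    using bounded_affine_le[OF f, of "inv_perm f (i + 1)"] fi(1) by simp
  have "inv_perm f (i + 1) \<noteq> i + 1 - int n"
  proof
    assume "inv_perm f (i + 1) = i + 1 - int n"
    then have "f (i + 1 - int n) = i + 1" using fi(1) by metis
    then show False using bounded_affine_period[OF f, of "i + 1 - int n"] d2 by simp
  qed
  with nc[of "inv_perm f i"] nc[of "inv_perm f (i + 1)"] ab a2 a3 \<open>inv_perm f i \<noteq> i\<close> b2 b3
  show "inv_perm f i < inv_perm f (i + 1)" by (simp add: s_def simple_refl_other)
qed

section \<open>Crossing numbers\<close>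

text \<open>This is the size of the part of the necklace entry at \<open>j\<close> lying in the
  cyclic interval from \<open>j\<close> to \<open>t\<close>, hence the rank that \<open>f\<close>
  prescribes for the columns \<open>j..t\<close>.\<close>

definition crossings :: "(int \<Rightarrow> int) \<Rightarrow> int \<Rightarrow> int \<Rightarrow> nat" where
  "crossings f j t = card {a. a < j \<and> j \<le> f a \<and> f a \<le> t}"

context
  fixes f k n
  assumes f: "f \<in> bounded_affine k n"
begin

lemma inv_perm_f [simp]: "inv_perm f (f a) = a"
  using bounded_affine_bij[OF f] by (simp add: bij_is_inj)

lemma f_inv_perm [simp]: "f (inv_perm f a) = a"
  using bounded_affine_bij[OF f] by (simp add: bij_is_surj surj_f_inv_f)

lemma f_eq_iff [simp]: "f a = f b \<longleftrightarrow> a = b"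
  by (metis inv_perm_f)

lemma inv_perm_le: "inv_perm f a \<le> a"
  using bounded_affine_ge[OF f, of "inv_perm f a"] by simp

lemma inv_perm_ge: "a - int n \<le> inv_perm f a"
  using bounded_affine_le[OF f, of "inv_perm f a"] by simp

lemma finite_crossings: "finite {a. a < j \<and> j \<le> f a \<and> f a \<le> t}"
proof (rule finite_subset)
  show "{a. a < j \<and> j \<le> f a \<and> f a \<le> t} \<subseteq> {j - int n..j}"
  proof
    fix a assume "a \<in> {a. a < j \<and> j \<le> f a \<and> f a \<le> t}"
    then show "a \<in> {j - int n..j}" using bounded_affine_le[OF f, of a] by auto
  qed
qed simp

lemma crossings_empty: "t < j \<Longrightarrow> crossings f j t = 0"
proof -
  assume "t < j"
  then have "{a. a < j \<and> j \<le> f a \<and> f a \<le> t} = {}" by auto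
  then show ?thesis by (simp only: crossings_def card.empty)
qed

lemma crossings_Suc_right:
  assumes "j \<le> t"
  shows "crossings f j t = crossings f j (t - 1) + (if inv_perm f t < j then 1 else 0)"
proof (cases "inv_perm f t < j")
  case True
  have "a = inv_perm f t" if "f a = t" for a using that by auto
  then have "{a. a < j \<and> j \<le> f a \<and> f a \<le> t} = insert (inv_perm f t) {a. a < j \<and> j \<le> f a \<and> f a \<le> t - 1}"
    using assms True by force
  then show ?thesis using True finite_crossings[of j "t - 1"] by (simp add: crossings_def)
next
  case False
  have "f a \<noteq> t" if "a < j" for a using that False by auto
  then have "{a. a < j \<and> j \<le> f a \<and> f a \<le> t} = {a. a < j \<and> j \<le> f a \<and> f a \<le> t - 1}"
    by force
  then show ?thesis using False by (simp add: crossings_def)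
qed

text \<open>Moving the start from \<open>j\<close> to \<open>j + 1\<close> removes the arc ending at
  \<open>j\<close> and admits the arc starting at \<open>j\<close>. These balance unless
  \<open>f j\<close> lies beyond \<open>t\<close>; at a fixed point there is neither.\<close>

lemma crossings_Suc_left:
  assumes "j \<le> t"
  shows "crossings f j t = crossings f (j + 1) t + (if t < f j then 1 else 0)"
proof -
  define A where "A = {a. a < j \<and> j + 1 \<le> f a \<and> f a \<le> t}"
  have "finite A" unfolding A_def by (rule finite_subset[OF _ finite_crossings[of j t]]) auto
  have S1: "{a. a < j \<and> j \<le> f a \<and> f a \<le> t} = (if f j = j then A else insert (inv_perm f j) A)"
  proof (cases "f j = j")
    case True
    have "j \<le> f a \<longleftrightarrow> j + 1 \<le> f a" if "a < j" for a
    proof -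
      have "f a \<noteq> j" using that f_eq_iff[of a j] True by auto
      then show ?thesis by linarith
    qed
    then show ?thesis using True by (auto simp: A_def)
  next
    case False
    have "inv_perm f j \<noteq> j" using False f_inv_perm[of j] by metis
    then have lt: "inv_perm f j < j" using inv_perm_le[of j] by simp
    show ?thesis unfolding A_def if_not_P[OF False]
    proof (intro equalityI subsetI)
      fix a assume "a \<in> {a. a < j \<and> j \<le> f a \<and> f a \<le> t}"
      then show "a \<in> insert (inv_perm f j) {a. a < j \<and> j + 1 \<le> f a \<and> f a \<le> t}"
        using inv_perm_f[of a] by (cases "f a = j") auto
    next
      fix a assume "a \<in> insert (inv_perm f j) {a. a < j \<and> j + 1 \<le> f a \<and> f a \<le> t}"
      then show "a \<in> {a. a < j \<and> j \<le> f a \<and> f a \<le> t}"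
        using lt assms f_inv_perm[of j] by auto
    qed
  qed
  have S2: "{a. a < j + 1 \<and> j + 1 \<le> f a \<and> f a \<le> t} = (if f j \<noteq> j \<and> f j \<le> t then insert j A else A)"
  proof (intro equalityI subsetI)
    fix a assume "a \<in> {a. a < j + 1 \<and> j + 1 \<le> f a \<and> f a \<le> t}"
    then show "a \<in> (if f j \<noteq> j \<and> f j \<le> t then insert j A else A)"
      by (cases "a = j") (auto simp: A_def)
  next
    fix a assume "a \<in> (if f j \<noteq> j \<and> f j \<le> t then insert j A else A)"
    then show "a \<in> {a. a < j + 1 \<and> j + 1 \<le> f a \<and> f a \<le> t}"
      using bounded_affine_ge[OF f, of j] by (cases "a = j") (auto simp: A_def split: if_splits)
  qed
  have "inv_perm f j \<notin> A" "j \<notin> A" by (auto simp: A_def)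
  then show ?thesis
    using assms \<open>finite A\<close> unfolding crossings_def S1 S2 by auto
qed

lemma crossings_period: "crossings f (j + int n) (t + int n) = crossings f j t"
proof -
  have m: "f (a - int n) = f a - int n" for a using bounded_affine_period[OF f, of "a - int n"] by simp
  have "bij_betw (\<lambda>a. a + int n) {a. a < j \<and> j \<le> f a \<and> f a \<le> t}
      {a. a < j + int n \<and> j + int n \<le> f a \<and> f a \<le> t + int n}"
    by (rule bij_betw_byWitness[where f' = "\<lambda>a. a - int n"])
      (auto simp: bounded_affine_period[OF f] m)
  from bij_betw_same_card[OF this] show ?thesis by (simp add: crossings_def)
qed

text \<open>The next full window drops \<open>j\<close> on the left and adds \<open>j + n\<close> on
  the right. Both corrections occur exactly when \<open>f j = j + n\<close>.\<close>

lemma crossings_full_const: "crossings f (j + 1) (j + int n) = crossings f j (j + int n - 1)"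
proof (cases "n = 0")
  case True
  then show ?thesis using crossings_empty by simp
next
  case False
  have "crossings f (j + 1) (j + int n) = crossings f (j + 1) (j + int n - 1) +
      (if inv_perm f (j + int n) < j + 1 then 1 else 0)"
    using crossings_Suc_right[of "j + 1" "j + int n"] False by simp
  moreover have "crossings f j (j + int n - 1) = crossings f (j + 1) (j + int n - 1) +
      (if j + int n - 1 < f j then 1 else 0)"
    using crossings_Suc_left[of j "j + int n - 1"] False by simp
  moreover have "inv_perm f (j + int n) < j + 1 \<longleftrightarrow> j + int n - 1 < f j"
  proof
    assume "inv_perm f (j + int n) < j + 1"
    then have "inv_perm f (j + int n) = j" using inv_perm_ge[of "j + int n"] by simp
    then show "j + int n - 1 < f j" by (metis f_inv_perm zle_diff1_eq order_refl)
  next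
    assume "j + int n - 1 < f j"
    then have "f j = j + int n" using bounded_affine_le[OF f, of j] by simp
    then show "inv_perm f (j + int n) < j + 1" by (metis inv_perm_f zless_add1_eq)
  qed
  ultimately show ?thesis by simp
qed

lemma crossings_full_eq: "crossings f j (j + int n - 1) = crossings f 1 (int n)"
proof (induction j rule: int_induct[where k = 1])
  case base
  then show ?case by simp
next
  case (step1 i)
  then show ?case using crossings_full_const[of i] by (simp add: algebra_simps)
next
  case (step2 i)
  then show ?case using crossings_full_const[of "i - 1"] by (simp add: algebra_simps)
qed

text \<open>Double counting of pairs with \<open>x < j \<le> f x\<close> modulo simultaneous
  translation by \<open>n\<close>. Normalising \<open>x\<close> gives the sum of
  \<open>f x - x\<close>, which is \<open>n k\<close>; normalising \<open>j\<close> gives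
  \<open>n\<close> times the common full crossing number.\<close>

lemma crossings_full:
  assumes n: "n > 0"
  shows "crossings f j (j + int n - 1) = k"
proof -
  define S where "S = {(a, j). a < j \<and> j \<le> f a}"
  define q where "q x = int n * ((x - 1) div int n)" for x :: int
  have q: "x - q x \<in> {1..int n}" for x
  proof -
    have "x - 1 = q x + (x - 1) mod int n" by (simp add: q_def)
    moreover have "0 \<le> (x - 1) mod int n" "(x - 1) mod int n < int n" using n by simp_all
    ultimately show ?thesis unfolding atLeastAtMost_iff by linarith
  qed
  have q0: "q (x + int n * m) = int n * m" if "x \<in> {1..int n}" for x m
  proof -
    have "x + int n * m - 1 = x - 1 + int n * m" by simp
    then have "(x + int n * m - 1) div int n = (x - 1) div int n + m"
      using n by (simp only: div_mult_self2 of_nat_eq_0_iff add.commute)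
    moreover have "(x - 1) div int n = 0" using that by auto
    ultimately show ?thesis by (simp add: q_def)
  qed
  have S: "(a + int n * m, j + int n * m) \<in> S \<longleftrightarrow> (a, j) \<in> S" for a j m
    using period_mult[of f n a m] bounded_affine_period[OF f] by (simp add: S_def)
  have bij: "bij_betw (\<lambda>(a, j). (a - q j, j - q j)) {(a, j) \<in> S. a \<in> {1..int n}} {(a, j) \<in> S. j \<in> {1..int n}}"
  proof (rule bij_betw_byWitness[where f' = "\<lambda>(a, j). (a - q a, j - q a)"], goal_cases)
    case 1
    have "a - q j - q (a - q j) = a \<and> j - q j - q (a - q j) = j" if "a \<in> {1..int n}" for a j
      using q0[OF that, of "- ((j - 1) div int n)"] by (simp add: q_def)
    then show ?case by auto
  next
    case 2
    have "a - q a - q (j - q a) = a \<and> j - q a - q (j - q a) = j" if "j \<in> {1..int n}" for a j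
      using q0[OF that, of "- ((a - 1) div int n)"] by (simp add: q_def)
    then show ?case by auto
  next
    case 3
    have "(a - q j, j - q j) \<in> S" if "(a, j) \<in> S" for a j
      using S[of a "- ((j - 1) div int n)" j] that by (simp add: q_def)
    then show ?case using q by auto
  next
    case 4
    have "(a - q a, j - q a) \<in> S" if "(a, j) \<in> S" for a j
      using S[of a "- ((a - 1) div int n)" j] that by (simp add: q_def)
    then show ?case using q by auto
  qed
  have "{(a, j) \<in> S. a \<in> {1..int n}} = (SIGMA a:{1..int n}. {a<..f a})" by (auto simp: S_def)
  then have "card {(a, j) \<in> S. a \<in> {1..int n}} = (\<Sum>a = 1..int n. nat (f a - a))" by simp
  also have "int \<dots> = (\<Sum>a = 1..int n. f a - a)" using bounded_affine_ge[OF f] by simp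
  finally have 1: "int (card {(a, j) \<in> S. a \<in> {1..int n}}) = (\<Sum>a = 1..int n. f a - a)" .
  \<comment> \<open>Boundedness makes the upper limit automatic, so a full crossing number counts
    all pairs over its \<open>j\<close>.\<close>
  have cr: "{a. a < j \<and> j \<le> f a} = {a. a < j \<and> j \<le> f a \<and> f a \<le> j + int n - 1}" for j
  proof (intro equalityI subsetI)
    fix a assume "a \<in> {a. a < j \<and> j \<le> f a}"
    then show "a \<in> {a. a < j \<and> j \<le> f a \<and> f a \<le> j + int n - 1}"
      using bounded_affine_le[OF f, of a] by auto
  qed auto
  have "bij_betw prod.swap (SIGMA j:{1..int n}. {a. a < j \<and> j \<le> f a}) {(a, j) \<in> S. j \<in> {1..int n}}"
    by (rule bij_betw_byWitness[where f' = prod.swap]) (auto simp: S_def)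
  from bij_betw_same_card[OF this]
  have "card {(a, j) \<in> S. j \<in> {1..int n}} = card (SIGMA j:{1..int n}. {a. a < j \<and> j \<le> f a})" by simp
  also have "\<dots> = (\<Sum>j = 1..int n. crossings f j (j + int n - 1))"
  proof -
    have "finite {a. a < j \<and> j \<le> f a}" for j unfolding cr by (rule finite_crossings)
    then have "card (SIGMA j:{1..int n}. {a. a < j \<and> j \<le> f a}) =
        (\<Sum>j = 1..int n. card {a. a < j \<and> j \<le> f a})" by (intro card_SigmaI) auto
    then show ?thesis by (simp only: crossings_def cr)
  qed
  also have "\<dots> = n * crossings f 1 (int n)" by (simp add: crossings_full_eq)
  finally have "int n * int (crossings f 1 (int n)) = (\<Sum>a = 1..int n. f a - a)"
    using 1 bij_betw_same_card[OF bij] by simp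
  moreover have "real_of_int (\<Sum>a = 1..int n. f a - a) = real n * real k"
    using f n by (simp add: bounded_affine_def field_simps)
  ultimately have "real n * real (crossings f 1 (int n)) = real n * real k"
    by (metis of_int_mult of_int_of_nat_eq)
  then show ?thesis using n crossings_full_eq by simp
qed

end

section \<open>The Gale order\<close>

lemma card_nth_less:
  assumes "finite A"
  shows "card {a \<in> A. a < m} = card {p. p < card A \<and> sorted_list_of_set A ! p < (m::int)}"
proof -
  let ?l = "sorted_list_of_set A"
  have "bij_betw (\<lambda>p. ?l ! p) {p. p < card A \<and> ?l ! p < m} {a \<in> A. a < m}"
    unfolding bij_betw_def
  proof
    show "inj_on (\<lambda>p. ?l ! p) {p. p < card A \<and> ?l ! p < m}"
      by (rule inj_onI) (use assms in \<open>auto simp: nth_eq_iff_index_eq\<close>)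
    show "(\<lambda>p. ?l ! p) ` {p. p < card A \<and> ?l ! p < m} = {a \<in> A. a < m}"
    proof (intro equalityI subsetI)
      fix a assume "a \<in> {a \<in> A. a < m}"
      moreover from this assms obtain p where "p < card A" "?l ! p = a"
        by (metis (mono_tags, lifting) in_set_conv_nth mem_Collect_eq set_sorted_list_of_set
            sorted_list_of_set.length_sorted_key_list_of_set)
      ultimately show "a \<in> (\<lambda>p. ?l ! p) ` {p. p < card A \<and> ?l ! p < m}" by auto
    next
      fix a assume "a \<in> (\<lambda>p. ?l ! p) ` {p. p < card A \<and> ?l ! p < m}"
      then obtain p where p: "p < length ?l" "?l ! p < m" "a = ?l ! p" using assms by auto
      have "?l ! p \<in> set ?l" using p(1) by (rule nth_mem)
      then show "a \<in> {a \<in> A. a < m}" using p assms by simp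
    qed
  qed
  from bij_betw_same_card[OF this] show ?thesis by simp
qed

text \<open>Counts below a threshold are what ranks control. For the converse the threshold is the
  entry \<open>?a ! p\<close> at a violated position: at most \<open>p\<close> elements of
  \<open>A\<close> lie below it, but at least \<open>p + 1\<close> of \<open>B\<close>.\<close>

lemma list_all2_sorted_iff:
  fixes A B :: "int set"
  assumes "finite A" "finite B" "card A = card B"
  shows "list_all2 (\<le>) (sorted_list_of_set A) (sorted_list_of_set B) \<longleftrightarrow>
    (\<forall>m. card {b \<in> B. b < m} \<le> card {a \<in> A. a < m})"
proof
  assume l: "list_all2 (\<le>) (sorted_list_of_set A) (sorted_list_of_set B)"
  show "\<forall>m. card {b \<in> B. b < m} \<le> card {a \<in> A. a < m}"
  proof
    fix m
    show "card {b \<in> B. b < m} \<le> card {a \<in> A. a < m}"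
      unfolding card_nth_less[OF assms(1)] card_nth_less[OF assms(2)]
    proof (rule card_mono)
      show "{p. p < card B \<and> sorted_list_of_set B ! p < m} \<subseteq> {p. p < card A \<and> sorted_list_of_set A ! p < m}"
        using l assms by (auto simp: list_all2_conv_all_nth)
    qed auto
  qed
next
  assume m: "\<forall>m. card {b \<in> B. b < m} \<le> card {a \<in> A. a < m}"
  let ?a = "sorted_list_of_set A" and ?b = "sorted_list_of_set B"
  show "list_all2 (\<le>) ?a ?b"
    unfolding list_all2_conv_all_nth
  proof (intro conjI allI impI)
    show "length ?a = length ?b" using assms by simp
    fix p assume p: "p < length ?a"
    show "?a ! p \<le> ?b ! p"
    proof (rule ccontr)
      assume "\<not> ?a ! p \<le> ?b ! p"
      then have lt: "?b ! p < ?a ! p" by simp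
      have "{..p} \<subseteq> {q. q < card B \<and> ?b ! q < ?a ! p}"
      proof
        fix q assume "q \<in> {..p}"
        then have "q \<le> p" by simp
        then have "?b ! q \<le> ?b ! p" using p assms by (intro sorted_nth_mono) auto
        then show "q \<in> {q. q < card B \<and> ?b ! q < ?a ! p}" using \<open>q \<le> p\<close> p lt assms by auto
      qed
      then have "card {..p} \<le> card {q. q < card B \<and> ?b ! q < ?a ! p}" by (intro card_mono) auto
      also have "\<dots> = card {b \<in> B. b < ?a ! p}" using card_nth_less[OF assms(2)] by simp
      also have "\<dots> \<le> card {a \<in> A. a < ?a ! p}" using m by blast
      also have "\<dots> = card {q. q < card A \<and> ?a ! q < ?a ! p}" using card_nth_less[OF assms(1)] by simp
      also have "\<dots> \<le> card {..<p}"
      proof (rule card_mono)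
        show "{q. q < card A \<and> ?a ! q < ?a ! p} \<subseteq> {..<p}"
        proof
          fix q assume q: "q \<in> {q. q < card A \<and> ?a ! q < ?a ! p}"
          show "q \<in> {..<p}"
          proof (rule ccontr)
            assume "q \<notin> {..<p}"
            then have "?a ! p \<le> ?a ! q" using q assms by (intro sorted_nth_mono) auto
            with q show False by auto
          qed
        qed
      qed simp
      finally show False by simp
    qed
  qed
qed

section \<open>Residues, cyclic intervals and necklaces\<close>

lemma residue_cong: "[residue n a = a] (mod int n)"
  by (simp add: residue_def cong_def mod_add_left_eq)

lemma residue_in: "n > 0 \<Longrightarrow> residue n a \<in> {1..int n}"
  by (simp add: residue_def) (metis add1_zle_eq of_nat_0_less_iff pos_mod_bound)

lemma residue_id: "a \<in> {1..int n} \<Longrightarrow> residue n a = a"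
  by (simp add: residue_def)

lemma residue_eq_iff: "residue n a = residue n b \<longleftrightarrow> [a = b] (mod int n)"
proof
  assume "residue n a = residue n b"
  then show "[a = b] (mod int n)" using residue_cong[of n] by (metis cong_sym cong_trans)
next
  assume "[a = b] (mod int n)"
  then have "[a - 1 = b - 1] (mod int n)" by (intro cong_diff) auto
  then show "residue n a = residue n b" by (simp add: residue_def cong_def)
qed

lemma cong_inj_window:
  fixes x y :: int
  assumes "[x = y] (mod int n)" "x \<in> {j..j + int n - 1}" "y \<in> {j..j + int n - 1}"
  shows "x = y"
  using cong_imp_eq[of x y n] cong_imp_eq[of y x n] assms by (cases "x \<le> y") (auto simp: cong_sym)

lemma inj_on_residue: "inj_on (residue n) {j..j + int n - 1}"
  by (rule inj_onI) (use cong_inj_window[of _ _ n j] in \<open>simp add: residue_eq_iff\<close>)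

definition cyc_interval :: "nat \<Rightarrow> int \<Rightarrow> int \<Rightarrow> int set" where
  "cyc_interval n j t = residue n ` {j..t}"

lemma cyc_pos_less_iff:
  assumes n: "n > 0" and x: "x \<in> {1..int n}" and t: "t \<in> {j - 1..j + int n - 1}"
  shows "cyc_pos n j x < t + 1 - j \<longleftrightarrow> x \<in> cyc_interval n j t"
proof -
  define y where "y = j + cyc_pos n j x"
  have "[x - j + j = cyc_pos n j x + j] (mod int n)"
    by (intro cong_add) (simp_all add: cyc_pos_def cong_def)
  then have "[x = y] (mod int n)" by (simp add: y_def add.commute)
  then have y: "residue n y = x" using residue_id[OF x] residue_eq_iff by metis
  have yr: "y \<in> {j..j + int n - 1}" using n by (simp add: y_def cyc_pos_def)
  have "cyc_pos n j x < t + 1 - j \<longleftrightarrow> y \<in> {j..t}" using yr by (auto simp: y_def)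
  also have "\<dots> \<longleftrightarrow> x \<in> cyc_interval n j t"
  proof
    assume "x \<in> cyc_interval n j t"
    then obtain z where "z \<in> {j..t}" "residue n z = x" by (auto simp: cyc_interval_def)
    moreover have "z = y"
      using calculation y yr t inj_onD[OF inj_on_residue, of n z y j] by auto
    ultimately show "y \<in> {j..t}" by simp
  qed (use y in \<open>auto simp: cyc_interval_def\<close>)
  finally show ?thesis .
qed

text \<open>\<open>cyc_pos n j\<close> is injective on \<open>[n]\<close> and turns the order
  starting at \<open>j\<close> into the usual one, so initial segments become cyclic intervals
  starting at \<open>j\<close>.\<close>

lemma gale_le_iff:
  assumes n: "n > 0" and I: "I \<subseteq> {1..int n}" and J: "J \<subseteq> {1..int n}" and c: "card I = card J"
  shows "gale_le n j I J \<longleftrightarrow>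
    (\<forall>t \<in> {j - 1..j + int n - 1}. card (J \<inter> cyc_interval n j t) \<le> card (I \<inter> cyc_interval n j t))"
proof -
  let ?p = "cyc_pos n j"
  have fin: "finite I" "finite J" using I J finite_subset by blast+
  have inj: "inj_on ?p {1..int n}"
  proof (rule inj_onI)
    fix x y assume xy: "x \<in> {1..int n}" "y \<in> {1..int n}" "?p x = ?p y"
    then have "[x - j + j = y - j + j] (mod int n)"
      by (intro cong_add) (simp_all add: cyc_pos_def cong_def)
    then have "[x = y] (mod int n)" by simp
    then show "x = y" using xy residue_eq_iff residue_id by metis
  qed
  have sorted: "map ?p (sort_key ?p (sorted_list_of_set K)) = sorted_list_of_set (?p ` K)"
    if K: "K \<subseteq> {1..int n}" for K
  proof (rule sorted_distinct_set_unique)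
    have fK: "finite K" using K finite_subset by blast
    show "distinct (map ?p (sort_key ?p (sorted_list_of_set K)))"
      using inj_on_subset[OF inj K] fK by (simp add: distinct_map)
    show "set (map ?p (sort_key ?p (sorted_list_of_set K))) = set (sorted_list_of_set (?p ` K))"
      using fK by simp
  qed auto
  have cnt: "card {b \<in> ?p ` K. b < t + 1 - j} = card (K \<inter> cyc_interval n j t)"
    if K: "K \<subseteq> {1..int n}" and t: "t \<in> {j - 1..j + int n - 1}" for K t
  proof -
    have "{b \<in> ?p ` K. b < t + 1 - j} = ?p ` (K \<inter> cyc_interval n j t)"
      using cyc_pos_less_iff[OF n _ t] K by blast
    then show ?thesis using card_image[OF inj_on_subset[OF inj, of "K \<inter> cyc_interval n j t"]] K by auto
  qed
  have "gale_le n j I J \<longleftrightarrow> list_all2 (\<le>) (map ?p (sort_key ?p (sorted_list_of_set I)))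
      (map ?p (sort_key ?p (sorted_list_of_set J)))"
    by (simp add: gale_le_def list_all2_map1 list_all2_map2)
  also have "\<dots> \<longleftrightarrow> (\<forall>m. card {b \<in> ?p ` J. b < m} \<le> card {a \<in> ?p ` I. a < m})"
    unfolding sorted[OF I] sorted[OF J]
    by (rule list_all2_sorted_iff)
      (use fin c card_image[OF inj_on_subset[OF inj I]] card_image[OF inj_on_subset[OF inj J]] in auto)
  also have "\<dots> \<longleftrightarrow> (\<forall>t \<in> {j - 1..j + int n - 1}.
      card (J \<inter> cyc_interval n j t) \<le> card (I \<inter> cyc_interval n j t))"
  proof
    assume *: "\<forall>m. card {b \<in> ?p ` J. b < m} \<le> card {a \<in> ?p ` I. a < m}"
    then show "\<forall>t \<in> {j - 1..j + int n - 1}. card (J \<inter> cyc_interval n j t) \<le> card (I \<inter> cyc_interval n j t)"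
      using cnt[OF I] cnt[OF J] by metis
  next
    assume *: "\<forall>t \<in> {j - 1..j + int n - 1}. card (J \<inter> cyc_interval n j t) \<le> card (I \<inter> cyc_interval n j t)"
    show "\<forall>m. card {b \<in> ?p ` J. b < m} \<le> card {a \<in> ?p ` I. a < m}"
    proof
      fix m
      \<comment> \<open>Positions lie between \<open>0\<close> and \<open>n - 1\<close>, so any
        threshold \<open>m\<close> may be clamped to one that cuts out an interval of length at most
        \<open>n\<close>.\<close>
      define t where "t = max (j - 1) (min (j + int n - 1) (m + j - 1))"
      have t: "t \<in> {j - 1..j + int n - 1}" using n by (auto simp: t_def)
      have "b < m \<longleftrightarrow> b < t + 1 - j" if "b \<in> ?p ` K" for b K
      proof -
        have "0 \<le> b" "b < int n" using that n by (auto simp: cyc_pos_def)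
        then show ?thesis by (auto simp: t_def)
      qed
      then have "{b \<in> ?p ` K. b < m} = {b \<in> ?p ` K. b < t + 1 - j}" for K by blast
      then show "card {b \<in> ?p ` J. b < m} \<le> card {a \<in> ?p ` I. a < m}"
        using cnt[OF I t] cnt[OF J t] * t by simp
    qed
  qed
  finally show ?thesis .
qed

lemma target_necklace_eq:
  assumes f: "f \<in> bounded_affine k n"
  shows "target_necklace n f j = residue n ` {b \<in> {j..j + int n - 1}. inv_perm f b < j}"
proof -
  have "{f a | a. a < j \<and> f a \<ge> j} = {b \<in> {j..j + int n - 1}. inv_perm f b < j}"
  proof (intro equalityI subsetI)
    fix b assume "b \<in> {f a | a. a < j \<and> f a \<ge> j}"
    then obtain a where "b = f a" "a < j" "j \<le> f a" by auto
    then show "b \<in> {b \<in> {j..j + int n - 1}. inv_perm f b < j}"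
      using bounded_affine_le[OF f, of a] by (simp add: inv_perm_f[OF f])
  next
    fix b assume "b \<in> {b \<in> {j..j + int n - 1}. inv_perm f b < j}"
    then show "b \<in> {f a | a. a < j \<and> f a \<ge> j}"
      using f_inv_perm[OF f, of b] by (intro CollectI exI[of _ "inv_perm f b"]) auto
  qed
  then show ?thesis by (simp add: target_necklace_def)
qed

text \<open>Residues are injective on the window starting at \<open>j\<close>, so the intersection
  can be formed among integers, where \<open>f\<close> maps the crossing positions bijectively onto
  it.\<close>

lemma card_target_necklace:
  assumes f: "f \<in> bounded_affine k n" and n: "n > 0" and t: "t \<in> {j - 1..j + int n - 1}"
  shows "card (target_necklace n f j \<inter> cyc_interval n j t) = crossings f j t"
proof -
  have inj: "inj_on (residue n) {j..j + int n - 1}" by (rule inj_on_residue)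
  have "target_necklace n f j \<inter> cyc_interval n j t = residue n ` ({b \<in> {j..j + int n - 1}. inv_perm f b < j} \<inter> {j..t})"
    unfolding target_necklace_eq[OF f] cyc_interval_def
    by (rule inj_on_image_Int[OF inj, symmetric]) (use t in auto)
  also have "card \<dots> = card ({b \<in> {j..j + int n - 1}. inv_perm f b < j} \<inter> {j..t})"
    by (rule card_image, rule inj_on_subset[OF inj]) (use t in auto)
  also have "{b \<in> {j..j + int n - 1}. inv_perm f b < j} \<inter> {j..t} = f ` {a. a < j \<and> j \<le> f a \<and> f a \<le> t}"
  proof (intro equalityI subsetI)
    fix b assume "b \<in> {b \<in> {j..j + int n - 1}. inv_perm f b < j} \<inter> {j..t}"
    then show "b \<in> f ` {a. a < j \<and> j \<le> f a \<and> f a \<le> t}"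
      using f_inv_perm[OF f, of b] by (intro image_eqI[of _ _ "inv_perm f b"]) auto
  next
    fix b assume "b \<in> f ` {a. a < j \<and> j \<le> f a \<and> f a \<le> t}"
    then show "b \<in> {b \<in> {j..j + int n - 1}. inv_perm f b < j} \<inter> {j..t}"
      using t by (auto simp: inv_perm_f[OF f])
  qed
  also have "card \<dots> = crossings f j t"
    unfolding crossings_def by (rule card_image) (use f_eq_iff[OF f] in \<open>auto simp: inj_on_def\<close>)
  finally show ?thesis .
qed

lemma target_necklace_ksubsets:
  assumes f: "f \<in> bounded_affine k n" and n: "n > 0"
  shows "target_necklace n f j \<in> ksubsets k n"
proof -
  have sub: "target_necklace n f j \<subseteq> cyc_interval n j (j + int n - 1)"
    unfolding target_necklace_eq[OF f] cyc_interval_def by auto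
  then have "card (target_necklace n f j) = k"
    using card_target_necklace[OF f n, of "j + int n - 1" j] crossings_full[OF f n, of j] n
    by (simp add: Int_absorb2)
  moreover have "target_necklace n f j \<subseteq> {1..int n}"
    using sub residue_in[OF n] by (auto simp: cyc_interval_def)
  ultimately show ?thesis by (simp add: ksubsets_def)
qed

lemma target_necklace_cong:
  assumes f: "f \<in> bounded_affine k n"
  shows "target_necklace n f (j + int n) = target_necklace n f j"
proof -
  have "{b \<in> {j + int n..j + int n + int n - 1}. inv_perm f b < j + int n} =
      (\<lambda>b. b + int n) ` {b \<in> {j..j + int n - 1}. inv_perm f b < j}"
  proof (intro equalityI subsetI)
    fix b assume "b \<in> {b \<in> {j + int n..j + int n + int n - 1}. inv_perm f b < j + int n}"
    then show "b \<in> (\<lambda>b. b + int n) ` {b \<in> {j..j + int n - 1}. inv_perm f b < j}"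
      using bounded_affine_inv_period[OF f, of "b - int n"] by (intro image_eqI[of _ _ "b - int n"]) auto
  next
    fix b assume "b \<in> (\<lambda>b. b + int n) ` {b \<in> {j..j + int n - 1}. inv_perm f b < j}"
    then show "b \<in> {b \<in> {j + int n..j + int n + int n - 1}. inv_perm f b < j + int n}"
      using bounded_affine_inv_period[OF f] by auto
  qed
  moreover have "residue n (b + int n) = residue n b" for b
    by (simp add: residue_eq_iff cong_add_int)
  ultimately show ?thesis unfolding target_necklace_eq[OF f] by (simp add: image_image)
qed

section \<open>Ranks of finite families of vectors\<close>

context vector_space begin

text \<open>The columns will live in an infinite-dimensional function space; finiteness of the
  family takes the place of finiteness of the ambient dimension.\<close>

lemma dim_insert_finite:
  assumes "finite S"
  shows "dim (insert x S) = (if x \<in> span S then dim S else Suc (dim S))"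
proof (cases "x \<in> span S")
  case True
  then show ?thesis by (simp add: span_eq_dim[OF span_redundant])
next
  case False
  obtain B where B: "B \<subseteq> S" "independent B" "S \<subseteq> span B" "card B = dim S"
    using basis_exists[of S] by blast
  have "span B = span S" using B by (metis span_mono span_minimal subspace_span subset_antisym)
  then have x: "x \<notin> span B" using False by simp
  have "independent (insert x B)" using x B by (simp add: independent_insertI)
  moreover have "insert x S \<subseteq> span (insert x B)"
    using B span_mono[of B "insert x B"] span_base[of x "insert x B"] by auto
  ultimately have "dim (insert x S) = card (insert x B)"
    using B by (intro basis_card_eq_dim[symmetric]) auto
  also have "\<dots> = Suc (card B)"
    using B finite_subset[OF B(1) assms] x span_base[of x B] by (intro card_insert_disjoint) auto
  finally show ?thesis using False B by simp
qed

lemma independent_card_le_dim_finite: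
  assumes "finite S" "independent B" "B \<subseteq> span S"
  shows "finite B \<and> card B \<le> dim S"
proof -
  obtain C where C: "C \<subseteq> S" "independent C" "S \<subseteq> span C" "card C = dim S"
    using basis_exists[of S] by blast
  have "B \<subseteq> span C" using assms C by (metis span_minimal subspace_span subset_trans)
  then show ?thesis using independent_span_bound[of C B] assms C finite_subset by metis
qed

lemma dim_empty_finite: "dim {} = 0"
  using dim_le_card[of "{}" "{}"] by simp

text \<open>If \<open>p\<close> and \<open>q\<close> add only one dimension to \<open>X\<close>, the vectors of their span lying in \<open>span X\<close>
  form a line. As long as this also holds for a larger \<open>Y\<close>, it is the same line.\<close>

lemma pencil_mono:
  assumes "finite X" "finite Y" "X \<subseteq> span Y"
    and X: "dim (insert p (insert q X)) = Suc (dim X)"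
    and Y: "dim (insert p (insert q Y)) = Suc (dim Y)"
  shows "p \<in> span X \<longleftrightarrow> p \<in> span Y"
proof
  show "p \<in> span Y" if "p \<in> span X" using that assms(3) by (metis span_minimal subspace_span subsetD)
  show "p \<in> span X" if pY: "p \<in> span Y"
  proof (rule ccontr)
    \<comment> \<open>Otherwise \<open>X\<close> and \<open>p\<close> would already span
      \<open>q\<close>, so \<open>span Y\<close> would contain both vectors and gain no dimension
      from them.\<close>
    assume pX: "p \<notin> span X"
    have "dim (insert q (insert p X)) = dim (insert p X)"
      using X pX dim_insert_finite[OF assms(1), of p] by (simp add: insert_commute)
    then have "q \<in> span (insert p X)"
      using dim_insert_finite[of "insert p X" q] assms(1) by (metis finite_insert n_not_Suc_n)
    moreover have "insert p X \<subseteq> span Y" using pY assms(3) by auto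
    ultimately have qY: "q \<in> span Y" by (metis span_minimal subspace_span subsetD)
    have "dim (insert p (insert q Y)) = dim Y"
      using qY pY dim_insert_finite[OF assms(2), of q] dim_insert_finite[of "insert q Y" p] assms(2)
        span_mono[of Y "insert q Y"] by auto
    with Y show False by simp
  qed
qed

text \<open>\<open>P\<close> and \<open>R\<close> encode whether the pair adds nothing, one
  dimension or two to \<open>Y\<close>. The outer cases are decided by dimension alone; in the
  middle case \<open>pencil_mono\<close> compares the line for \<open>Y\<close> with that for
  \<open>X\<close>.\<close>

lemma pencil_member:
  assumes fin: "finite X" "finite Y"
    and X: "dim (insert p (insert q X)) = Suc (dim X)"
    and Y: "dim (insert p (insert q Y)) = dim Y + (if P then 0 else 1) + (if R then 0 else 1)"
    and PR: "P \<Longrightarrow> R" and sub: "R \<Longrightarrow> X \<subseteq> Y"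
  shows "p \<in> span Y \<longleftrightarrow> P \<or> R \<and> p \<in> span X"
proof -
  have q: "dim (insert p Y) \<le> dim (insert p (insert q Y))" "dim (insert p (insert q Y)) \<le> Suc (dim (insert p Y))"
    using dim_insert_finite[of "insert p Y" q] fin(2) by (simp_all add: insert_commute)
  have p: "p \<in> span Y \<longleftrightarrow> dim (insert p Y) \<le> dim Y" using dim_insert_finite[OF fin(2), of p] by simp
  show ?thesis
  proof (cases "P = R")
    case True
    then show ?thesis using p q Y by (cases P) auto
  next
    case False
    then have "\<not> P" "R" using PR by auto
    moreover from this have "p \<in> span X \<longleftrightarrow> p \<in> span Y"
      using pencil_mono[OF fin _ X] Y sub span_superset[of Y] by auto
    ultimately show ?thesis by simp
  qed
qed

lemma pencil_complement:
  assumes "finite X" "dim (insert p (insert q X)) = Suc (dim X)" "p \<in> span X"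
  shows "q \<notin> span X"
proof -
  have "p \<in> span (insert q X)" using assms(3) span_mono[of X "insert q X"] by blast
  then show ?thesis
    using assms dim_insert_finite[OF assms(1), of q] dim_insert_finite[of "insert q X" p] by auto
qed

text \<open>\<open>p\<close> already accounts for the added dimension, so \<open>q\<close> lies in
  the span of \<open>p\<close> and \<open>X\<close>. Two different coefficients would leave a
  nonzero multiple of \<open>p\<close> in \<open>span X\<close>.\<close>

lemma pencil_ex1:
  assumes "finite X" "dim (insert p (insert q X)) = Suc (dim X)" "p \<notin> span X"
  shows "\<exists>!c. q - scale c p \<in> span X"
proof -
  have "dim (insert q (insert p X)) = dim (insert p X)"
    using assms dim_insert_finite[OF assms(1), of p] by (simp add: insert_commute)
  then have "q \<in> span (insert p X)"
    using dim_insert_finite[of "insert p X" q] assms(1) by (metis finite_insert n_not_Suc_n)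
  then obtain c where c: "q - scale c p \<in> span X" by (auto simp: span_insert)
  show ?thesis
  proof (rule ex1I[of _ c])
    fix d assume d: "q - scale d p \<in> span X"
    have "scale (d - c) p = (q - scale c p) - (q - scale d p)" by (simp add: scale_left_diff_distrib)
    then have s: "scale (d - c) p \<in> span X" using span_diff[OF c d] by simp
    show "d = c"
    proof (rule ccontr)
      assume "d \<noteq> c"
      then have "p = scale (inverse (d - c)) (scale (d - c) p)" by simp
      then show False using span_scale[OF s] assms(3) by metis
    qed
  qed (rule c)
qed

text \<open>Columns may coincide, so independence of an indexed family has to be expressed:
  injectivity together with independence of the image.\<close>

lemma independent_family_iff:
  assumes "finite L"
  shows "(inj_on w L \<and> independent (w ` L)) \<longleftrightarrow>
    (\<forall>c. (\<Sum>l\<in>L. scale (c l) (w l)) = 0 \<longrightarrow> (\<forall>l\<in>L. c l = 0))"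
proof
  assume *: "inj_on w L \<and> independent (w ` L)"
  show "\<forall>c. (\<Sum>l\<in>L. scale (c l) (w l)) = 0 \<longrightarrow> (\<forall>l\<in>L. c l = 0)"
  proof (intro allI impI ballI)
    fix c l assume c: "(\<Sum>l\<in>L. scale (c l) (w l)) = 0" and l: "l \<in> L"
    have "(\<Sum>x\<in>w ` L. scale (c (inv_into L w x)) x) = (\<Sum>l\<in>L. scale (c l) (w l))"
      using * by (subst sum.reindex) (auto intro!: sum.cong)
    then have "c (inv_into L w (w l)) = 0"
      using * assms l c independentD[of "w ` L" "w ` L" "\<lambda>x. c (inv_into L w x)" "w l"] by auto
    then show "c l = 0" using * l by simp
  qed
next
  assume *: "\<forall>c. (\<Sum>l\<in>L. scale (c l) (w l)) = 0 \<longrightarrow> (\<forall>l\<in>L. c l = 0)"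
  have inj: "inj_on w L"
  proof (rule inj_onI, rule ccontr)
    fix a b assume ab: "a \<in> L" "b \<in> L" "w a = w b" "a \<noteq> b"
    define c where "c l = (if l = a then 1 else if l = b then -1 else 0 :: 'a)" for l
    have "(\<Sum>l\<in>L. scale (c l) (w l)) = (\<Sum>l\<in>{a, b}. scale (c l) (w l))"
      using ab assms by (intro sum.mono_neutral_right) (auto simp: c_def)
    also have "\<dots> = 0" using ab by (simp add: c_def)
    finally have "c a = 0" using * ab by blast
    then show False by (simp add: c_def)
  qed
  have "independent (w ` L)"
  proof (rule independent_if_scalars_zero)
    show "finite (w ` L)" using assms by simp
    fix u x assume u: "(\<Sum>x\<in>w ` L. scale (u x) x) = 0" and "x \<in> w ` L"
    then obtain l where "l \<in> L" "x = w l" by auto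
    moreover have "(\<Sum>l\<in>L. scale (u (w l)) (w l)) = 0"
      using u inj by (simp add: sum.reindex)
    ultimately show "u x = 0" using *[rule_format, of "\<lambda>l. u (w l)"] by simp
  qed
  with inj show "inj_on w L \<and> independent (w ` L)" by simp
qed

lemma independent_family_card_le:
  assumes "finite R" "inj_on w J" "independent (w ` J)"
  shows "card (J \<inter> R) \<le> dim (w ` R)"
proof -
  have "card (J \<inter> R) = card (w ` (J \<inter> R))"
    using card_image[OF inj_on_subset[OF assms(2), of "J \<inter> R"]] by simp
  moreover have "independent (w ` (J \<inter> R))" by (rule independent_mono[OF assms(3)]) auto
  moreover have "w ` (J \<inter> R) \<subseteq> span (w ` R)"
    using span_superset[of "w ` R"] by blast
  ultimately show ?thesis
    using independent_card_le_dim_finite[of "w ` R" "w ` (J \<inter> R)"] assms(1) by simp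
qed

text \<open>Labels rather than vectors are extended, because \<open>J\<close> will be a set of
  column labels with a minor. Each new basis vector receives one chosen label, and the labels in
  \<open>K\<close> are kept.\<close>

lemma independent_family_extend:
  assumes "finite S" and K: "K \<subseteq> S" "inj_on w K" "independent (w ` K)"
  shows "\<exists>J. K \<subseteq> J \<and> J \<subseteq> S \<and> inj_on w J \<and> independent (w ` J) \<and> card J = dim (w ` S)"
proof -
  obtain B where B: "w ` K \<subseteq> B" "B \<subseteq> w ` S" "independent B" "w ` S \<subseteq> span B"
    using maximal_independent_subset_extend[of "w ` K" "w ` S"] K by blast
  have "\<exists>g. \<forall>x \<in> B - w ` K. g x \<in> S \<and> w (g x) = x" using B by (intro bchoice) auto
  then obtain g where g: "\<And>x. x \<in> B - w ` K \<Longrightarrow> g x \<in> S \<and> w (g x) = x" by blast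
  define J where "J = K \<union> g ` (B - w ` K)"
  have wJ: "w ` J = B" using B g unfolding J_def by (auto simp: image_Un image_image)
  have inj: "inj_on w J"
    unfolding J_def
  proof (rule inj_onI)
    fix a b assume "a \<in> K \<union> g ` (B - w ` K)" "b \<in> K \<union> g ` (B - w ` K)" "w a = w b"
    then show "a = b" using K(2) g by (auto dest: inj_onD)
  qed
  have "card J = card B" using card_image[OF inj] wJ by simp
  also have "\<dots> = dim (w ` S)" using B by (intro basis_card_eq_dim) auto
  finally show ?thesis using inj wJ B K g by (intro exI[of _ J]) (auto simp: J_def)
qed

end

section \<open>Columns and minors\<close>

interpretation cv: vector_space "\<lambda>(c::complex) (v::nat \<Rightarrow> complex). (\<lambda>r. c * v r)"
  by unfold_locales (auto simp: fun_eq_iff algebra_simps)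

text \<open>Padding by zeros puts columns of every height into one fixed type, where
  \<open>span\<close> and \<open>dim\<close> apply without a carrier set.\<close>

definition column :: "nat \<Rightarrow> complex mat \<Rightarrow> nat \<Rightarrow> nat \<Rightarrow> complex" where
  "column k A c = (\<lambda>r. if r < k then A $$ (r, c) else 0)"

text \<open>The sequence \<sigma> may be unordered and may repeat columns, so exchanging columns is
  composition with a transposition.\<close>

definition minor :: "nat \<Rightarrow> complex mat \<Rightarrow> (nat \<Rightarrow> nat) \<Rightarrow> complex" where
  "minor k A \<sigma> = det (mat k k (\<lambda>(r, c). A $$ (r, \<sigma> c)))"

lemma minor_cong: "(\<And>c. c < k \<Longrightarrow> \<sigma> c = \<tau> c) \<Longrightarrow> minor k A \<sigma> = minor k A \<tau>"
  unfolding minor_def by (rule arg_cong[of _ _ det]) auto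

text \<open>A vanishing determinant amounts to a nontrivial kernel vector, that is, a linear
  relation among the selected columns.\<close>

lemma minor_nonzero_iff:
  "minor k A \<sigma> \<noteq> 0 \<longleftrightarrow>
    inj_on (\<lambda>c. column k A (\<sigma> c)) {..<k} \<and> cv.independent ((\<lambda>c. column k A (\<sigma> c)) ` {..<k})"
proof -
  let ?M = "mat k k (\<lambda>(r, c). A $$ (r, \<sigma> c))"
  have M: "?M \<in> carrier_mat k k" by simp
  have mv: "(?M *\<^sub>v v) $ r = (\<Sum>c<k. v $ c * A $$ (r, \<sigma> c))" if "v \<in> carrier_vec k" "r < k" for v r
    using that by (auto simp: scalar_prod_def lessThan_atLeast0 mult.commute intro!: sum.cong)
  have sum0: "(\<Sum>c<k. (\<lambda>r. u c * column k A (\<sigma> c) r)) = 0 \<longleftrightarrow>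
      (\<forall>r<k. (\<Sum>c<k. u c * A $$ (r, \<sigma> c)) = 0)" for u
  proof -
    have "(\<Sum>c<k. (\<lambda>r. u c * column k A (\<sigma> c) r)) r = (\<Sum>c<k. u c * column k A (\<sigma> c) r)" for r
    proof -
      have "(\<Sum>c\<in>S. F c) r = (\<Sum>c\<in>S. F c r)" for S :: "nat set" and F :: "nat \<Rightarrow> nat \<Rightarrow> complex"
        by (induction S rule: infinite_finite_induct) auto
      then show ?thesis .
    qed
    moreover have "(\<Sum>c<k. u c * column k A (\<sigma> c) r) = (if r < k then \<Sum>c<k. u c * A $$ (r, \<sigma> c) else 0)" for r
      by (simp add: column_def)
    ultimately have "(\<Sum>c<k. (\<lambda>r. u c * column k A (\<sigma> c) r)) r =
        (if r < k then \<Sum>c<k. u c * A $$ (r, \<sigma> c) else 0)" for r by metis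
    then show ?thesis by (simp only: fun_eq_iff zero_fun_apply) auto
  qed
  have "det ?M = 0 \<longleftrightarrow> (\<exists>v. v \<in> carrier_vec k \<and> v \<noteq> 0\<^sub>v k \<and> ?M *\<^sub>v v = 0\<^sub>v k)"
    by (rule det_0_iff_vec_prod_zero[OF M])
  also have "\<dots> \<longleftrightarrow> (\<exists>u. (\<forall>r<k. (\<Sum>c<k. u c * A $$ (r, \<sigma> c)) = 0) \<and> (\<exists>c<k. u c \<noteq> 0))"
  proof
    assume "\<exists>v. v \<in> carrier_vec k \<and> v \<noteq> 0\<^sub>v k \<and> ?M *\<^sub>v v = 0\<^sub>v k"
    then obtain v where v: "v \<in> carrier_vec k" "v \<noteq> 0\<^sub>v k" "?M *\<^sub>v v = 0\<^sub>v k" by blast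
    have "\<exists>c<k. v $ c \<noteq> 0" using v(1,2) by (metis eq_vecI carrier_vecD index_zero_vec)
    moreover have "(\<Sum>c<k. v $ c * A $$ (r, \<sigma> c)) = 0" if "r < k" for r
      using mv[OF v(1) that] v(3) that by simp
    ultimately show "\<exists>u. (\<forall>r<k. (\<Sum>c<k. u c * A $$ (r, \<sigma> c)) = 0) \<and> (\<exists>c<k. u c \<noteq> 0)"
      by (intro exI[of _ "\<lambda>c. v $ c"]) auto
  next
    assume "\<exists>u. (\<forall>r<k. (\<Sum>c<k. u c * A $$ (r, \<sigma> c)) = 0) \<and> (\<exists>c<k. u c \<noteq> 0)"
    then obtain u c where u: "\<forall>r<k. (\<Sum>c<k. u c * A $$ (r, \<sigma> c)) = 0" "c < k" "u c \<noteq> 0" by blast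
    have "vec k u \<noteq> 0\<^sub>v k" using u by (metis index_vec index_zero_vec(1))
    moreover have "?M *\<^sub>v vec k u = 0\<^sub>v k"
      using u(1) mv[of "vec k u"] by (intro eq_vecI) auto
    ultimately show "\<exists>v. v \<in> carrier_vec k \<and> v \<noteq> 0\<^sub>v k \<and> ?M *\<^sub>v v = 0\<^sub>v k"
      by (intro exI[of _ "vec k u"]) simp
  qed
  finally show ?thesis
    unfolding cv.independent_family_iff[OF finite_lessThan] sum0 minor_def by auto
qed

lemma minor_permute:
  assumes \<pi>: "\<pi> permutes {0..<k}"
  shows "minor k A (\<lambda>c. \<sigma> (\<pi> c)) = signof \<pi> * minor k A \<sigma>"
proof -
  let ?M = "mat k k (\<lambda>(c, r). A $$ (r, \<sigma> c))"
  have M: "?M \<in> carrier_mat k k" by simp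
  have lt: "\<pi> c < k" if "c < k" for c using permutes_in_image[OF \<pi>, of c] that by simp
  \<comment> \<open>Transposing turns the permutation of columns into a permutation of rows.\<close>
  have T: "minor k A \<tau> = det (mat k k (\<lambda>(c, r). A $$ (r, \<tau> c)))" for \<tau>
  proof -
    have "(mat k k (\<lambda>(r, c). A $$ (r, \<tau> c)))\<^sup>T = mat k k (\<lambda>(c, r). A $$ (r, \<tau> c))" by (intro eq_matI) auto
    then show ?thesis unfolding minor_def by (metis det_transpose mat_carrier)
  qed
  have "mat k k (\<lambda>(c, r). A $$ (r, \<sigma> (\<pi> c))) = mat k k (\<lambda>(i, j). ?M $$ (\<pi> i, j))"
    by (intro eq_matI) (auto simp: lt)
  then show ?thesis unfolding T using det_permute_rows[OF M \<pi>] by simp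
qed

text \<open>The sequences differ by a permutation of positions, whose sign serves all matrices
  simultaneously.\<close>

lemma minor_same_image:
  assumes \<sigma>: "inj_on \<sigma> {0..<k}" and \<tau>: "inj_on \<tau> {0..<k}" and im: "\<sigma> ` {0..<k} = \<tau> ` {0..<k}"
  shows "\<exists>\<epsilon>. \<epsilon> \<noteq> 0 \<and> (\<forall>A. minor k A \<sigma> = \<epsilon> * minor k A \<tau>)"
proof -
  define \<pi> where "\<pi> c = (if c \<in> {0..<k} then inv_into {0..<k} \<tau> (\<sigma> c) else c)" for c
  have "bij_betw (\<lambda>c. inv_into {0..<k} \<tau> (\<sigma> c)) {0..<k} {0..<k}"
    using bij_betw_trans[of \<sigma> "{0..<k}" "\<sigma> ` {0..<k}" "inv_into {0..<k} \<tau>" "{0..<k}"]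
      bij_betw_inv_into[of \<tau> "{0..<k}" "\<tau> ` {0..<k}"] \<sigma> \<tau> im by (auto simp: bij_betw_def comp_def)
  then have "bij_betw \<pi> {0..<k} {0..<k}"
    using bij_betw_cong[of "{0..<k}" \<pi> "\<lambda>c. inv_into {0..<k} \<tau> (\<sigma> c)" "{0..<k}"] by (simp add: \<pi>_def)
  then have \<pi>: "\<pi> permutes {0..<k}" by (rule bij_imp_permutes) (auto simp: \<pi>_def)
  have "\<sigma> c = \<tau> (\<pi> c)" if "c < k" for c
    using that im f_inv_into_f[of "\<sigma> c" \<tau> "{0..<k}"] imageI[of c "{0..<k}" \<sigma>] by (auto simp: \<pi>_def)
  then have "minor k A \<sigma> = signof \<pi> * minor k A \<tau>" for A
    using minor_cong[of k \<sigma> "\<lambda>c. \<tau> (\<pi> c)" A] minor_permute[OF \<pi>, of A \<tau>] by simp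
  moreover have "(signof \<pi> :: complex) \<noteq> 0" by (simp add: sign_def)
  ultimately show ?thesis by blast
qed

text \<open>The three matrices agree off column \<open>c0\<close>, so their cofactors along it
  coincide and Laplace expansion is linear there.\<close>

lemma det_column_linear:
  fixes B C D :: "complex mat"
  assumes B: "B \<in> carrier_mat k k" and C: "C \<in> carrier_mat k k" and D: "D \<in> carrier_mat k k"
    and c0: "c0 < k"
    and off: "\<And>r c. r < k \<Longrightarrow> c < k \<Longrightarrow> c \<noteq> c0 \<Longrightarrow> B $$ (r, c) = C $$ (r, c) \<and> B $$ (r, c) = D $$ (r, c)"
    and on: "\<And>r. r < k \<Longrightarrow> B $$ (r, c0) = C $$ (r, c0) - x * D $$ (r, c0)"
  shows "det B = det C - x * det D"
proof -
  have "mat_delete B r c0 = mat_delete X r c0"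
    if "X \<in> carrier_mat k k" "\<And>r c. r < k \<Longrightarrow> c < k \<Longrightarrow> c \<noteq> c0 \<Longrightarrow> B $$ (r, c) = X $$ (r, c)" for r X
    using B that by (auto simp: mat_delete_def intro!: eq_matI)
  from this[OF C] this[OF D] off
  have "mat_delete B r c0 = mat_delete C r c0 \<and> mat_delete B r c0 = mat_delete D r c0" for r by blast
  then have cof: "cofactor B r c0 = cofactor C r c0 \<and> cofactor B r c0 = cofactor D r c0" if "r < k" for r
    unfolding cofactor_def by metis
  have "det B = (\<Sum>r<k. B $$ (r, c0) * cofactor B r c0)" by (rule laplace_expansion_column[OF B c0])
  also have "\<dots> = (\<Sum>r<k. C $$ (r, c0) * cofactor C r c0 - x * (D $$ (r, c0) * cofactor D r c0))"
  proof (intro sum.cong refl)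
    fix r assume "r \<in> {..<k}"
    then have r: "r < k" by simp
    have "cofactor B r c0 = cofactor C r c0" "cofactor D r c0 = cofactor C r c0" using cof[OF r] by auto
    then show "B $$ (r, c0) * cofactor B r c0 = C $$ (r, c0) * cofactor C r c0 - x * (D $$ (r, c0) * cofactor D r c0)"
      by (simp add: on[OF r] algebra_simps)
  qed
  also have "\<dots> = det C - x * det D"
    by (simp add: sum_subtractf sum_distrib_left laplace_expansion_column[OF C c0] laplace_expansion_column[OF D c0])
  finally show ?thesis .
qed

text \<open>The 0-based column indices of a set of columns indexed by \<open>[n]\<close>, in increasing order.\<close>

definition picks :: "int set \<Rightarrow> nat \<Rightarrow> nat" where
  "picks J = pick ((\<lambda>j. nat (j - 1)) ` J)"

lemma inj_on_index:
  assumes "J \<in> ksubsets k n"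
  shows "inj_on (\<lambda>j. nat (j - 1)) J"
proof (rule inj_onI)
  fix x y assume "x \<in> J" "y \<in> J" "nat (x - 1) = nat (y - 1)"
  moreover from this have "1 \<le> x" "1 \<le> y" using assms by (auto simp: ksubsets_def)
  ultimately show "x = y" by simp
qed

lemma picks_bij:
  assumes J: "J \<in> ksubsets k n"
  shows "inj_on (picks J) {0..<k}" "picks J ` {0..<k} = (\<lambda>j. nat (j - 1)) ` J"
proof -
  let ?J = "(\<lambda>j. nat (j - 1)) ` J"
  have inj: "inj_on (\<lambda>j. nat (j - 1)) J" using J by (rule inj_on_index)
  have "finite J" using J finite_subset by (auto simp: ksubsets_def)
  then have fin: "finite ?J" and card: "card ?J = k" using J card_image[OF inj] by (auto simp: ksubsets_def)
  have sub: "?J \<subseteq> picks J ` {0..<k}"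
  proof
    fix x assume x: "x \<in> ?J"
    have "{a \<in> ?J. a < x} \<subset> ?J" using x by auto
    then have "card {a \<in> ?J. a < x} < k" using card fin psubset_card_mono by blast
    then show "x \<in> picks J ` {0..<k}"
      using pick_card_in_set[OF x] by (intro image_eqI[of _ _ "card {a \<in> ?J. a < x}"]) (auto simp: picks_def)
  qed
  have "card (picks J ` {0..<k}) \<le> k" using card_image_le[of "{0..<k}" "picks J"] by simp
  with sub card have im: "picks J ` {0..<k} = ?J"
    by (metis card_seteq finite_atLeastLessThan finite_imageI)
  then show "picks J ` {0..<k} = ?J" .
  show "inj_on (picks J) {0..<k}" by (rule eq_card_imp_inj_on) (use im card in auto)
qed

lemma det_submatrix_eq_minor:
  assumes A: "A \<in> carrier_mat k n" and J: "J \<in> ksubsets k n"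
  shows "det (submatrix A UNIV ((\<lambda>j. nat (j - 1)) ` J)) = minor k A (picks J)"
proof -
  let ?J = "(\<lambda>j. nat (j - 1)) ` J"
  have inj: "inj_on (\<lambda>j. nat (j - 1)) J" using J by (rule inj_on_index)
  have sub: "?J \<subseteq> {..<n}" using J by (force simp: ksubsets_def)
  have "{j. j < dim_col A \<and> j \<in> ?J} = ?J" using sub A by auto
  then have "card {j. j < dim_col A \<and> j \<in> ?J} = k"
    using card_image[OF inj] J by (simp add: ksubsets_def)
  moreover have "card {i. i < dim_row A \<and> i \<in> UNIV} = k" using A by simp
  ultimately have "submatrix A UNIV ?J = mat k k (\<lambda>(r, c). A $$ (r, picks J c))"
    unfolding submatrix_def picks_def by (simp add: pick_UNIV)
  then show ?thesis by (simp add: minor_def)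
qed

section \<open>Open positroid varieties and ranks\<close>

lemma periodic_cong:
  assumes "\<And>j. Q (j + int n) = Q j" "[a = b] (mod int n)"
  shows "Q a = Q b"
proof -
  have *: "Q (j + int n * int l) = Q j" for j l
  proof (induction l)
    case (Suc l)
    have "Q (j + int n * int (Suc l)) = Q (j + int n * int l + int n)" by (simp add: algebra_simps)
    then show ?case using Suc assms(1) by simp
  qed simp
  obtain m where m: "b = a + int n * m" using assms(2) by (metis cong_iff_lin)
  show ?thesis
  proof (cases "m \<ge> 0")
    case True
    then show ?thesis using *[of a "nat m"] m by simp
  next
    case False
    then show ?thesis using *[of b "nat (- m)"] m by (simp add: algebra_simps)
  qed
qed

definition vcol :: "nat \<Rightarrow> nat \<Rightarrow> complex mat \<Rightarrow> int \<Rightarrow> nat \<Rightarrow> complex" where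
  "vcol k n A a = column k A (nat ((a - 1) mod int n))"

definition rank_of :: "nat \<Rightarrow> nat \<Rightarrow> complex mat \<Rightarrow> int set \<Rightarrow> nat" where
  "rank_of k n A S = cv.dim (vcol k n A ` S)"

lemma vcol_cong: "[a = b] (mod int n) \<Longrightarrow> vcol k n A a = vcol k n A b"
proof -
  assume "[a = b] (mod int n)"
  then have "[a - 1 = b - 1] (mod int n)" by (intro cong_diff) auto
  then show ?thesis by (simp add: vcol_def cong_def)
qed

lemma vcol_residue: "vcol k n A (residue n a) = vcol k n A a"
  by (rule vcol_cong) (rule residue_cong)

lemma vcol_cyc_interval: "vcol k n A ` cyc_interval n j t = vcol k n A ` {j..t}"
  by (auto simp: cyc_interval_def vcol_residue image_image)

lemma vcol_image_period: "vcol k n A ` {j + int n..t + int n} = vcol k n A ` {j..t}"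
proof -
  have eq: "{j + int n..t + int n} = (\<lambda>a. a + int n) ` {j..t}" by simp
  show ?thesis unfolding eq image_image
    by (rule image_cong[OF refl], rule vcol_cong) (simp add: cong_add_int)
qed

lemma vcol_index: "a \<in> {1..int n} \<Longrightarrow> vcol k n A a = column k A (nat (a - 1))"
  by (simp add: vcol_def)

lemma minor_picks_nonzero_iff:
  assumes J: "J \<in> ksubsets k n"
  shows "minor k A (picks J) \<noteq> 0 \<longleftrightarrow> inj_on (vcol k n A) J \<and> cv.independent (vcol k n A ` J)"
proof -
  let ?i = "\<lambda>j. nat (j - 1)"
  have v: "vcol k n A j = column k A (?i j)" if "j \<in> J" for j
    using J that by (intro vcol_index) (auto simp: ksubsets_def)
  have im: "(\<lambda>c. column k A (picks J c)) ` {..<k} = vcol k n A ` J"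
    using picks_bij(2)[OF J] v by (simp add: image_image[symmetric] lessThan_atLeast0 cong: image_cong)
      (simp add: image_image)
  have "inj_on (\<lambda>c. column k A (picks J c)) {..<k} \<longleftrightarrow> inj_on (column k A) (?i ` J)"
    using comp_inj_on_iff[OF picks_bij(1)[OF J], of "column k A"] picks_bij(2)[OF J]
    by (simp add: comp_def lessThan_atLeast0)
  also have "\<dots> \<longleftrightarrow> inj_on (\<lambda>j. column k A (?i j)) J"
    using comp_inj_on_iff[OF inj_on_index[OF J], of "column k A"] by (simp add: comp_def)
  also have "\<dots> \<longleftrightarrow> inj_on (vcol k n A) J" using v by (auto simp: inj_on_def)
  finally show ?thesis unfolding minor_nonzero_iff im by simp
qed

lemma dim_columns_le: "finite S \<Longrightarrow> cv.dim (vcol k n A ` S) \<le> k"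
proof -
  define e where "e r = (\<lambda>r'. if r' = r then 1 else 0 :: complex)" for r :: nat
  have "column k A c \<in> cv.span (e ` {..<k})" for c
  proof -
    have sum_apply: "(\<Sum>r\<in>S. F r) x = (\<Sum>r\<in>S. F r x)" for S :: "nat set" and F :: "nat \<Rightarrow> nat \<Rightarrow> complex" and x
      by (induction S rule: infinite_finite_induct) auto
    have "column k A c = (\<Sum>r<k. (\<lambda>r'. A $$ (r, c) * e r r'))"
      by (rule ext) (auto simp: sum_apply column_def e_def if_distrib cong: if_cong)
    moreover have "\<dots> \<in> cv.span (e ` {..<k})"
      by (intro cv.span_sum cv.span_scale cv.span_base) auto
    ultimately show ?thesis by simp
  qed
  then have "cv.dim (vcol k n A ` S) \<le> card (e ` {..<k})"
    by (intro cv.dim_le_card) (auto simp: vcol_def)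
  also have "\<dots> \<le> k" using card_image_le[of "{..<k}" e] by simp
  finally show ?thesis .
qed

text \<open>Stated for a matrix instead of its row space, because twisting acts on columns;
  rescaling all minors does not affect it.\<close>

definition positroid_minors :: "nat \<Rightarrow> nat \<Rightarrow> (int \<Rightarrow> int) \<Rightarrow> complex mat \<Rightarrow> bool" where
  "positroid_minors k n f A \<longleftrightarrow>
    (\<forall>J \<in> ksubsets k n. J \<notin> positroid k n f \<longrightarrow> minor k A (picks J) = 0) \<and>
    (\<forall>j \<in> {1..int n}. minor k A (picks (target_necklace n f j)) \<noteq> 0)"

text \<open>The necklace entry \<open>I\<^sub>j\<close> is the Gale-minimal basis for \<open><\<^sub>j\<close> exactly if it contains a basis
  of the span of every interval starting at \<open>j\<close>; this turns the Pluecker conditions into conditions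
  on ranks of cyclic intervals.\<close>

lemma positroid_minors_iff_rank:
  assumes f: "f \<in> bounded_affine k n" and n: "n > 0"
  shows "positroid_minors k n f A \<longleftrightarrow>
    (\<forall>j. \<forall>t \<in> {j - 1..j + int n - 1}. rank_of k n A {j..t} = crossings f j t)"
    (is "_ \<longleftrightarrow> (\<forall>j. ?P j)")
proof
  let ?v = "vcol k n A"
  assume pos: "positroid_minors k n f A"
  have P: "?P j" if j: "j \<in> {1..int n}" for j
  proof
    fix t assume t: "t \<in> {j - 1..j + int n - 1}"
    let ?T = "target_necklace n f j" and ?R = "cyc_interval n j t"
    have T: "?T \<in> ksubsets k n" by (rule target_necklace_ksubsets[OF f n])
    have "minor k A (picks ?T) \<noteq> 0" using pos j unfolding positroid_minors_def by blast
    then have indT: "inj_on ?v ?T" "cv.independent (?v ` ?T)"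
      using minor_picks_nonzero_iff[OF T] by blast+
    have finR: "finite ?R" by (simp add: cyc_interval_def)
    have R: "?R \<subseteq> {1..int n}" using residue_in[OF n] by (auto simp: cyc_interval_def)
    have rk: "rank_of k n A {j..t} = cv.dim (?v ` ?R)" by (simp add: rank_of_def vcol_cyc_interval)
    \<comment> \<open>Lower bound: the necklace entry is independent and has
      \<open>crossings f j t\<close> labels in the interval.\<close>
    have ge: "crossings f j t \<le> rank_of k n A {j..t}"
      using cv.independent_family_card_le[OF finR indT]
      by (simp add: rk card_target_necklace[OF f n t])
    \<comment> \<open>Upper bound: a basis \<open>K\<close> of the interval is extended to a basis
      \<open>J\<close> of all columns. The minor of \<open>J\<close> is nonzero, so Gale-minimality
      of the necklace entry bounds the part of \<open>J\<close> in the interval.\<close>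
    obtain K where K: "K \<subseteq> ?R" "inj_on ?v K" "cv.independent (?v ` K)" "card K = cv.dim (?v ` ?R)"
      using cv.independent_family_extend[of ?R "{}" ?v] finR cv.independent_empty by auto
    obtain J where J: "K \<subseteq> J" "J \<subseteq> {1..int n}" "inj_on ?v J" "cv.independent (?v ` J)"
      "card J = cv.dim (?v ` {1..int n})"
      using cv.independent_family_extend[of "{1..int n}" K ?v] K R by auto
    \<comment> \<open>The independent necklace entry gives rank at least \<open>k\<close>; the
      height of the columns gives at most \<open>k\<close>.\<close>
    have "k = card (?T \<inter> {1..int n})" using T by (simp add: ksubsets_def Int_absorb2)
    also have "\<dots> \<le> card J"
      unfolding J(5) by (rule cv.independent_family_card_le[OF _ indT]) simp
    finally have "card J = k" using dim_columns_le[of "{1..int n}" k n A] J(5) by simp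
    then have Jk: "J \<in> ksubsets k n" using J by (simp add: ksubsets_def)
    then have "minor k A (picks J) \<noteq> 0" using J minor_picks_nonzero_iff by blast
    then have "gale_le n j ?T J" using pos Jk j by (auto simp: positroid_minors_def positroid_def)
    then have "card (J \<inter> ?R) \<le> card (?T \<inter> ?R)"
      using gale_le_iff[OF n, of ?T J j] T Jk t by (auto simp: ksubsets_def)
    moreover have "card K \<le> card (J \<inter> ?R)" using K(1) J(1) finR by (intro card_mono) auto
    ultimately have "rank_of k n A {j..t} \<le> crossings f j t"
      using K(4) by (simp add: rk card_target_necklace[OF f n t])
    with ge show "rank_of k n A {j..t} = crossings f j t" by simp
  qed
  have per: "?P (j + int n) = ?P j" for j
  proof -
    have eq: "rank_of k n A {j + int n..t + int n} = crossings f (j + int n) (t + int n) \<longleftrightarrow>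
        rank_of k n A {j..t} = crossings f j t" for t
      by (simp only: rank_of_def vcol_image_period crossings_period[OF f])
    show ?thesis
    proof
      assume *: "?P (j + int n)"
      show "?P j"
      proof
        fix t assume "t \<in> {j - 1..j + int n - 1}"
        then have "t + int n \<in> {j + int n - 1..j + int n + int n - 1}" by simp
        then show "rank_of k n A {j..t} = crossings f j t" using * eq by blast
      qed
    next
      assume *: "?P j"
      show "?P (j + int n)"
      proof
        fix t assume "t \<in> {j + int n - 1..j + int n + int n - 1}"
        then have "t - int n \<in> {j - 1..j + int n - 1}" by simp
        then show "rank_of k n A {j + int n..t} = crossings f (j + int n) t"
          using * eq[of "t - int n"] by simp
      qed
    qed
  qed
  show "\<forall>j. ?P j"
  proof
    fix j
    have "?P (residue n j) = ?P j" by (rule periodic_cong[where Q = ?P, OF per residue_cong])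
    then show "?P j" using P[OF residue_in[OF n]] by simp
  qed
next
  let ?v = "vcol k n A"
  assume P: "\<forall>j. ?P j"
  have T: "target_necklace n f j \<in> ksubsets k n" for j by (rule target_necklace_ksubsets[OF f n])
  have ind: "inj_on ?v (target_necklace n f j) \<and> cv.independent (?v ` target_necklace n f j)" for j
  proof -
    \<comment> \<open>\<open>Y t\<close> lifts the part of the necklace entry up to \<open>t\<close>
      to integers. By the rank conditions each of its labels adds a dimension to all earlier columns
      of the window, so \<open>Y t\<close> stays independent as \<open>t\<close> grows.\<close>
    define Y where "Y t = {b \<in> {j..t}. inv_perm f b < j}" for t
    have "inj_on ?v (Y (j - 1 + int m)) \<and> cv.independent (?v ` Y (j - 1 + int m))" if "m \<le> n" for m
      using that
    proof (induction m)
      case 0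
      then show ?case by (simp add: Y_def cv.independent_empty)
    next
      case (Suc m)
      define t where "t = j + int m"
      have t1: "j - 1 + int (Suc m) = t" "j - 1 + int m = t - 1" by (auto simp: t_def)
      have IH: "inj_on ?v (Y (t - 1))" "cv.independent (?v ` Y (t - 1))" using Suc unfolding t1 by auto
      have ins: "{j..t} = insert t {j..t - 1}" by (auto simp: t_def)
      show ?case unfolding t1
      proof (cases "inv_perm f t < j")
        case True
        then have Y: "Y t = insert t (Y (t - 1))" using ins by (auto simp: Y_def)
        have "rank_of k n A {j..t} = Suc (rank_of k n A {j..t - 1})"
          using P[rule_format, of t j] P[rule_format, of "t - 1" j] crossings_Suc_right[OF f, of j t]
            True Suc.prems by (simp add: t_def)
        then have "?v t \<notin> cv.span (?v ` {j..t - 1})"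
          unfolding rank_of_def ins using cv.dim_insert_finite[of "?v ` {j..t - 1}" "?v t"]
          by (auto split: if_splits)
        moreover have "?v ` Y (t - 1) \<subseteq> ?v ` {j..t - 1}" by (auto simp: Y_def)
        ultimately have ns: "?v t \<notin> cv.span (?v ` Y (t - 1))" using cv.span_mono by blast
        then have "?v t \<notin> ?v ` Y (t - 1)" using cv.span_base by blast
        moreover have "t \<notin> Y (t - 1)" by (simp add: Y_def)
        ultimately show "inj_on ?v (Y t) \<and> cv.independent (?v ` Y t)"
          unfolding Y using IH cv.independent_insertI[OF ns IH(2)] by auto
      next
        case False
        then have "Y t = Y (t - 1)" using ins by (auto simp: Y_def)
        then show "inj_on ?v (Y t) \<and> cv.independent (?v ` Y t)" using IH by simp
      qed
    qed
    from this[of n] have Y: "inj_on ?v (Y (j + int n - 1))" "cv.independent (?v ` Y (j + int n - 1))"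
      by (simp_all add: algebra_simps)
    have tn: "target_necklace n f j = residue n ` Y (j + int n - 1)"
      unfolding target_necklace_eq[OF f] Y_def ..
    have "inj_on (?v \<circ> residue n) (Y (j + int n - 1))"
      using Y(1) by (simp add: comp_def vcol_residue)
    then have "inj_on ?v (residue n ` Y (j + int n - 1))" by (rule inj_on_imageI)
    then show ?thesis unfolding tn using Y(2) by (simp add: image_image vcol_residue)
  qed
  have "J \<in> positroid k n f" if J: "J \<in> ksubsets k n" and nz: "minor k A (picks J) \<noteq> 0" for J
  proof -
    have indJ: "inj_on ?v J" "cv.independent (?v ` J)" using nz minor_picks_nonzero_iff[OF J] by auto
    have "gale_le n j (target_necklace n f j) J" for j
    proof -
      have "card (J \<inter> cyc_interval n j t) \<le> card (target_necklace n f j \<inter> cyc_interval n j t)"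
        if t: "t \<in> {j - 1..j + int n - 1}" for t
      proof -
        let ?R = "cyc_interval n j t"
        have finR: "finite ?R" by (simp add: cyc_interval_def)
        have "card (J \<inter> ?R) \<le> cv.dim (?v ` ?R)"
          by (rule cv.independent_family_card_le[OF finR indJ])
        also have "\<dots> = crossings f j t"
          using P[rule_format, OF t] by (simp add: rank_of_def vcol_cyc_interval)
        finally show ?thesis by (simp add: card_target_necklace[OF f n t])
      qed
      then show ?thesis using gale_le_iff[OF n, of "target_necklace n f j" J j] T[of j] J
        by (auto simp: ksubsets_def)
    qed
    then show ?thesis using J by (simp add: positroid_def)
  qed
  then show "positroid_minors k n f A"
    unfolding positroid_minors_def using ind minor_picks_nonzero_iff[OF T] by blast
qed

section \<open>A double ascent and the columns \<open>i\<close>, \<open>i + 1\<close>\<close>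

text \<open>A column operation of determinant \<open>-1\<close> on the columns \<open>p, q\<close>;
  exchanging \<open>p\<close> with \<open>q\<close> and negating \<beta> inverts it.\<close>

definition twist :: "nat \<Rightarrow> nat \<Rightarrow> nat \<Rightarrow> nat \<Rightarrow> complex \<Rightarrow> complex mat \<Rightarrow> complex mat" where
  "twist k n p q \<beta> A = mat k n (\<lambda>(r, c). if c = p then A $$ (r, q) - \<beta> * A $$ (r, p)
     else if c = q then A $$ (r, p) else A $$ (r, c))"

definition idx :: "nat \<Rightarrow> int \<Rightarrow> nat" where
  "idx n a = nat ((a - 1) mod int n)"

lemma vcol_idx: "vcol k n A a = column k A (idx n a)"
  by (simp add: vcol_def idx_def)

lemma idx_less: "n > 0 \<Longrightarrow> idx n a < n"
  by (simp add: idx_def nat_less_iff)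

lemma idx_eq_iff: "n > 0 \<Longrightarrow> idx n a = idx n b \<longleftrightarrow> [a = b] (mod int n)"
proof -
  assume n: "n > 0"
  then have "idx n a = idx n b \<longleftrightarrow> [a - 1 = b - 1] (mod int n)"
    unfolding idx_def cong_def by (subst eq_nat_nat_iff) auto
  also have "\<dots> \<longleftrightarrow> [a = b] (mod int n)" by (simp add: cong_iff_dvd_diff)
  finally show ?thesis .
qed

lemma twist_carrier [simp]: "twist k n p q \<beta> A \<in> carrier_mat k n"
  by (simp add: twist_def)

lemma twist_inverse:
  assumes "A \<in> carrier_mat k n" "p \<noteq> q" "p < n" "q < n"
  shows "twist k n q p (- \<beta>) (twist k n p q \<beta> A) = A"
  using assms by (auto simp: twist_def intro!: eq_matI)

lemma column_twist:
  assumes "c < n" "p < n" "q < n"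
  shows "column k (twist k n p q \<beta> A) c =
    (if c = p then column k A q - (\<lambda>r. \<beta> * column k A p r) else if c = q then column k A p else column k A c)"
  using assms by (auto simp: column_def twist_def fun_eq_iff)

lemma cong_add1_iff: "[a + 1 = b + 1] (mod int n) \<longleftrightarrow> [a = b] (mod int n)" for a b :: int
  by (simp add: cong_iff_dvd_diff)

text \<open>If \<open>S\<close> meets both special classes the operation takes place inside the
  span; if it meets neither, nothing changes. The inverse twist then supplies the opposite
  inclusion.\<close>

lemma span_twist_subset:
  assumes n: "n > 0" and xy: "(\<exists>a \<in> S. [a = x] (mod int n)) \<longleftrightarrow> (\<exists>a \<in> S. [a = y] (mod int n))"
  shows "cv.span (vcol k n (twist k n (idx n x) (idx n y) \<beta> A) ` S) \<subseteq> cv.span (vcol k n A ` S)"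
proof (rule cv.span_minimal[OF _ cv.subspace_span], rule image_subsetI)
  fix a assume a: "a \<in> S"
  let ?v = "vcol k n A" let ?w = "vcol k n (twist k n (idx n x) (idx n y) \<beta> A)"
  have base: "?v b \<in> cv.span (?v ` S)" if "b' \<in> S" "[b' = b] (mod int n)" for b b'
    using that vcol_cong[of b' b n k A] by (metis cv.span_base image_eqI)
  have w: "?w a = (if [a = x] (mod int n) then ?v y - (\<lambda>r. \<beta> * ?v x r)
      else if [a = y] (mod int n) then ?v x else ?v a)"
    unfolding vcol_idx column_twist[OF idx_less[OF n] idx_less[OF n] idx_less[OF n]] idx_eq_iff[OF n]
    by (simp)
  show "?w a \<in> cv.span (?v ` S)"
  proof (cases "[a = x] (mod int n)")
    case True
    then obtain b where "b \<in> S" "[b = y] (mod int n)" using xy a by blast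
    then show ?thesis using True base a w by (auto intro!: cv.span_diff cv.span_scale)
  next
    case False
    then show ?thesis using xy base a w by (cases "[a = y] (mod int n)") auto
  qed
qed

lemma span_twist:
  assumes n: "n > 0" and A: "A \<in> carrier_mat k n" and ne: "\<not> [x = y] (mod int n)"
    and xy: "(\<exists>a \<in> S. [a = x] (mod int n)) \<longleftrightarrow> (\<exists>a \<in> S. [a = y] (mod int n))"
  shows "cv.span (vcol k n (twist k n (idx n x) (idx n y) \<beta> A) ` S) = cv.span (vcol k n A ` S)"
proof
  show "cv.span (vcol k n (twist k n (idx n x) (idx n y) \<beta> A) ` S) \<subseteq> cv.span (vcol k n A ` S)"
    by (rule span_twist_subset[OF n xy])
  have "twist k n (idx n y) (idx n x) (- \<beta>) (twist k n (idx n x) (idx n y) \<beta> A) = A"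
    using ne idx_eq_iff[OF n] idx_less[OF n] by (intro twist_inverse[OF A]) auto
  then show "cv.span (vcol k n A ` S) \<subseteq> cv.span (vcol k n (twist k n (idx n x) (idx n y) \<beta> A) ` S)"
    using span_twist_subset[OF n, of S y x k "- \<beta>" "twist k n (idx n x) (idx n y) \<beta> A"] xy by simp
qed

section \<open>Intervals that do not separate \<open>i\<close> from \<open>i + 1\<close>\<close>

locale double_move =
  fixes n k :: nat and i :: int and f :: "int \<Rightarrow> int"
  assumes n2: "n \<ge> 2" and f: "f \<in> bounded_affine k n"
    and sf: "simple_refl n i \<star> f \<in> bounded_affine k n"
    and fs: "f \<star> simple_refl n i \<in> bounded_affine k n"
    and sfs: "simple_refl n i \<star> f \<star> simple_refl n i \<in> bounded_affine k n"
    and len: "aff_length n (simple_refl n i \<star> f \<star> simple_refl n i) = aff_length n f + 2"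
begin

abbreviation "s \<equiv> simple_refl n i"
abbreviation "a \<equiv> inv_perm f i"
abbreviation "b \<equiv> inv_perm f (i + 1)"
abbreviation "c \<equiv> f i"
abbreviation "d \<equiv> f (i + 1)"

lemmas ascent = double_ascent[OF n2 f sf fs sfs len]

lemma n0: "n > 0" using n2 by simp

lemma not_cong: "\<not> [i + 1 = i] (mod int n)" "\<not> [i = i + 1] (mod int n)"
  using not_cong_add1[OF n2, of i] by (auto simp: cong_sym_eq)

lemma not_cong_between:
  assumes "i + 2 \<le> x" "x \<le> i + int n - 1"
  shows "\<not> [x = i] (mod int n)" "\<not> [x = i + 1] (mod int n)"
proof -
  show "\<not> [x = i] (mod int n)" using cong_imp_eq[of i x n] assms by (auto simp: cong_sym_eq)
  show "\<not> [x = i + 1] (mod int n)" using cong_imp_eq[of "i + 1" x n] assms by (auto simp: cong_sym_eq)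
qed

lemma not_cong_before:
  assumes "i + 2 - int n \<le> x" "x \<le> i - 1"
  shows "\<not> [x = i] (mod int n)" "\<not> [x = i + 1] (mod int n)"
  using not_cong_between[of "x + int n"] assms by (auto simp: cong_add_int)

text \<open>An integer is carried across the threshold \<open>j\<close> only if \<open>j\<close> is
  the upper member of an exchanged pair.\<close>

lemma s_less_iff: "\<not> [j = i + 1] (mod int n) \<Longrightarrow> j \<le> s y \<longleftrightarrow> j \<le> y"
proof -
  assume j: "\<not> [j = i + 1] (mod int n)"
  have "j \<noteq> y + 1" if "[y = i] (mod int n)" using that j by (auto simp: cong_add1_iff)
  moreover have "j \<noteq> y" if "[y = i + 1] (mod int n)" using that j by auto
  ultimately show ?thesis unfolding simple_refl_cases by auto
qed

lemma s_le_iff: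
  assumes "\<not> [t = i] (mod int n)"
  shows "s y \<le> t \<longleftrightarrow> y \<le> t"
proof -
  have "\<not> [t + 1 = i + 1] (mod int n)" using assms by (simp add: cong_add1_iff)
  from s_less_iff[OF this, of y] show ?thesis by linarith
qed

lemma s_strict_less_iff: "\<not> [j = i + 1] (mod int n) \<Longrightarrow> s y < j \<longleftrightarrow> y < j"
  using s_less_iff[of j y] by linarith

text \<open>An integer interval can cut an exchanged pair only by starting at its upper or ending at
  its lower member. The other crossing numbers are blind to \<open>s\<close> on either side, and
  twisting preserves the corresponding spans.\<close>

definition "good j t \<longleftrightarrow> \<not> [j = i + 1] (mod int n) \<and> \<not> [t = i] (mod int n)"

lemma crossings_right: "good j t \<Longrightarrow> crossings (g \<star> s) j t = crossings g j t"
  by (simp add: crossings_def aff_mult_def good_def s_less_iff s_le_iff)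

text \<open>On this side \<open>s\<close> permutes positions, and it preserves the set of positions
  below \<open>j\<close>.\<close>

lemma crossings_left:
  assumes "good j t"
  shows "crossings (s \<star> g) j t = crossings g j t"
proof -
  have "bij_betw s {a. a < j \<and> j \<le> g (s a) \<and> g (s a) \<le> t} {a. a < j \<and> j \<le> g a \<and> g a \<le> t}"
    by (rule bij_betw_byWitness[where f' = s])
      (use assms in \<open>auto simp: good_def simple_refl_involution[OF n2] s_strict_less_iff\<close>)
  from bij_betw_same_card[OF this] show ?thesis by (simp add: crossings_def aff_mult_def)
qed

definition "good_ranks A \<longleftrightarrow>
  (\<forall>j. \<forall>t \<in> {j - 1..j + int n - 1}. good j t \<longrightarrow> rank_of k n A {j..t} = crossings f j t)"

lemma good_interval:
  assumes "good j t"
  shows "(\<exists>x \<in> {j..t}. [x = i] (mod int n)) \<longleftrightarrow> (\<exists>x \<in> {j..t}. [x = i + 1] (mod int n))"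
proof
  assume "\<exists>x \<in> {j..t}. [x = i] (mod int n)"
  then obtain x where x: "x \<in> {j..t}" "[x = i] (mod int n)" by blast
  then have "x \<noteq> t" using assms by (auto simp: good_def)
  with x show "\<exists>x \<in> {j..t}. [x = i + 1] (mod int n)"
    by (intro bexI[of _ "x + 1"]) (auto simp: cong_add1_iff)
next
  assume "\<exists>x \<in> {j..t}. [x = i + 1] (mod int n)"
  then obtain x where x: "x \<in> {j..t}" "[x = i + 1] (mod int n)" by blast
  then have "x \<noteq> j" using assms by (auto simp: good_def)
  with x show "\<exists>x \<in> {j..t}. [x = i] (mod int n)"
    using cong_add1_iff[of "x - 1" i n] by (intro bexI[of _ "x - 1"]) auto
qed

lemma good_ranks_twist:
  assumes A: "A \<in> carrier_mat k n" and xy: "x = i \<and> y = i + 1 \<or> x = i + 1 \<and> y = i"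
  shows "good_ranks (twist k n (idx n x) (idx n y) \<beta> A) \<longleftrightarrow> good_ranks A"
proof -
  have "rank_of k n (twist k n (idx n x) (idx n y) \<beta> A) {j..t} = rank_of k n A {j..t}" if "good j t" for j t
    unfolding rank_of_def
    by (rule cv.span_eq_dim, rule span_twist[OF n0 A]) (use xy good_interval[OF that] not_cong in auto)
  then show ?thesis by (simp add: good_ranks_def)
qed

text \<open>The intervals that are not good start at \<open>i + 1\<close> or end at \<open>i\<close>
  modulo \<open>n\<close>; periodicity moves them to fixed representatives. The one of full length
  reduces to a good interval.\<close>

lemma positroid_minors_split:
  assumes g: "g \<in> bounded_affine k n" and gf: "\<And>j t. good j t \<Longrightarrow> crossings g j t = crossings f j t"
  shows "positroid_minors k n g A \<longleftrightarrow> good_ranks A \<and>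
    (\<forall>j \<in> {i + 2 - int n..i}. rank_of k n A {j..i} = crossings g j i) \<and>
    (\<forall>t \<in> {i + 1..i + int n - 1}. rank_of k n A {i + 1..t} = crossings g (i + 1) t)"
    (is "_ \<longleftrightarrow> _ \<and> ?L \<and> ?R")
proof
  assume *: "positroid_minors k n g A"
  then have *: "\<forall>j. \<forall>t \<in> {j - 1..j + int n - 1}. rank_of k n A {j..t} = crossings g j t"
    using positroid_minors_iff_rank[OF g n0] by simp
  then have "good_ranks A" using gf by (simp add: good_ranks_def)
  moreover have ?L ?R using * by auto
  ultimately show "good_ranks A \<and> ?L \<and> ?R" by blast
next
  assume "good_ranks A \<and> ?L \<and> ?R"
  then have H: "good_ranks A" and L: ?L and R: ?R by auto
  have rper: "rank_of k n A {j + int n..t + int n} = rank_of k n A {j..t}" for j t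
    by (simp add: rank_of_def vcol_image_period)
  have shift: "rank_of k n A {j..t} = crossings g j t \<longleftrightarrow> rank_of k n A {j'..t'} = crossings g j' t'"
    if "[j = j'] (mod int n)" "t - j = t' - j'" for j j' t t'
  proof -
    \<comment> \<open>The rank condition for a fixed length, viewed as a periodic property of the
      starting point.\<close>
    let ?Q = "\<lambda>j'. rank_of k n A {j'..j' + (t - j)} = crossings g j' (j' + (t - j))"
    have "?Q (x + int n) = ?Q x" for x
    proof -
      have e: "x + int n + (t - j) = x + (t - j) + int n" by simp
      show ?thesis unfolding e rper crossings_period[OF g] ..
    qed
    then have "?Q j = ?Q j'" by (rule periodic_cong[OF _ that(1)])
    moreover have "j + (t - j) = t" "j' + (t - j) = t'" using that(2) by auto
    ultimately show ?thesis by simp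
  qed
  have "rank_of k n A {j..t} = crossings g j t" if t: "t \<in> {j - 1..j + int n - 1}" for j t
  proof -
    consider "t = j - 1" | "good j t" | "[j = i + 1] (mod int n)" "j \<le> t" | "\<not> [j = i + 1] (mod int n)" "[t = i] (mod int n)" "j \<le> t"
      using t by (fastforce simp: good_def)
    then show ?thesis
    proof cases
      case 1
      then show ?thesis using crossings_empty[OF g, of t j] by (simp add: rank_of_def cv.dim_empty_finite)
    next
      case 2
      then show ?thesis using H t gf by (simp add: good_ranks_def)
    next
      case 3
      show ?thesis
      \<comment> \<open>The hypothesis stops one short of full length. The full interval starting at
        \<open>i + 1\<close> has the same columns as \<open>i..i+n-1\<close>, which is good.\<close>
      proof (cases "t = j + int n - 1")
        case True
        have "\<not> [i + int n - 1 = i] (mod int n)"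
          using cong_add1_iff[of "i + int n - 1" i n] cong_add_int[of i n "i + 1"] not_cong(2) by simp
        then have "good i (i + int n - 1)" using not_cong by (simp add: good_def)
        then have "rank_of k n A {i..i + int n - 1} = crossings g i (i + int n - 1)"
          using H gf n2 by (simp add: good_ranks_def)
        moreover have "rank_of k n A {i + 1..i + int n} = rank_of k n A {i..i + int n - 1}"
        proof -
          have "vcol k n A (i + int n) = vcol k n A i" by (rule vcol_cong) (simp add: cong_add_int)
          moreover have "{i + 1..i + int n} = insert (i + int n) {i + 1..i + int n - 1}"
            "{i..i + int n - 1} = insert i {i + 1..i + int n - 1}" using n2 by auto
          ultimately show ?thesis by (simp add: rank_of_def)
        qed
        ultimately have "rank_of k n A {i + 1..i + int n} = crossings g (i + 1) (i + int n)"
          using crossings_full_const[OF g, of i] by simp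
        then show ?thesis using shift[OF 3(1), of t "i + int n"] True by simp
      next
        case False
        define t' where "t' = i + 1 + (t - j)"
        have "t' \<in> {i + 1..i + int n - 1}" using False t 3(2) by (auto simp: t'_def)
        then show ?thesis using R shift[OF 3(1), of t t'] by (simp add: t'_def)
      qed
    next
      case 4
      define j' where "j' = i - (t - j)"
      have jj: "[j = j'] (mod int n)"
      proof -
        have "[t - (t - j) = i - (t - j)] (mod int n)" using 4(2) by (intro cong_diff) auto
        then show ?thesis by (simp add: j'_def)
      qed
      \<comment> \<open>A full interval ending at \<open>i\<close> would start at
        \<open>i + 1\<close> modulo \<open>n\<close> and belong to the previous case.\<close>
      have "t - j \<noteq> int n - 1"
      proof
        assume "t - j = int n - 1"
        then have "j' + int n = i + 1" by (simp add: j'_def)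
        then have "[j' = i + 1] (mod int n)" by (metis cong_add_int cong_refl)
        with jj 4(1) show False using cong_trans by blast
      qed
      then have "j' \<in> {i + 2 - int n..i}" using t 4(3) by (auto simp: j'_def)
      then show ?thesis using L shift[OF jj, of t i] by (simp add: j'_def)
    qed
  qed
  then show "positroid_minors k n g A" using positroid_minors_iff_rank[OF g n0] by blast
qed

text \<open>The endpoints make \<open>v_i\<close> and \<open>v_{i+1}\<close> together add exactly
  one dimension: of the preimages \<open>a < b\<close> only \<open>a\<close> lies before
  \<open>b\<close>, and of the values \<open>c < d\<close> only \<open>d\<close> lies beyond
  \<open>c\<close>.\<close>

definition "left_span A = cv.span (vcol k n A ` {b..i - 1})"
definition "right_span A = cv.span (vcol k n A ` {i + 2..c})"

context
  fixes A
  assumes H: "good_ranks A"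
begin

lemma left_ranks:
  assumes j: "j \<in> {i + 2 - int n..i}"
  shows "rank_of k n A {j..i - 1} = crossings f j (i - 1)"
    "rank_of k n A {j..i + 1} = crossings f j (i - 1) + (if a < j then 1 else 0) + (if b < j then 1 else 0)"
proof -
  have j1: "\<not> [j = i + 1] (mod int n)" using not_cong_before[of j] not_cong j by (cases "j = i") auto
  have "\<not> [i - 1 = i] (mod int n)" using not_cong_add1[OF n2, of "i - 1"] by (simp add: cong_sym_eq)
  then have "good j (i - 1)" "good j (i + 1)" using j1 not_cong by (auto simp: good_def)
  then show "rank_of k n A {j..i - 1} = crossings f j (i - 1)"
    and "rank_of k n A {j..i + 1} = crossings f j (i - 1) + (if a < j then 1 else 0) + (if b < j then 1 else 0)"
    using H j crossings_Suc_right[OF f, of j "i + 1"] crossings_Suc_right[OF f, of j i]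
    by (auto simp: good_ranks_def)
qed

lemma left_dims:
  assumes j: "j \<in> {i + 2 - int n..i}"
  shows "cv.dim (insert (vcol k n A i) (insert (vcol k n A (i + 1)) (vcol k n A ` {j..i - 1}))) =
    cv.dim (vcol k n A ` {j..i - 1}) + (if a < j then 1 else 0) + (if b < j then 1 else 0)"
proof -
  have "{j..i + 1} = insert i (insert (i + 1) {j..i - 1})" using j by auto
  then show ?thesis using left_ranks[OF j] by (simp add: rank_of_def insert_commute)
qed

lemma right_ranks:
  assumes t: "t \<in> {i + 1..i + int n - 1}"
  shows "rank_of k n A {i + 2..t} = crossings f (i + 2) t"
    "rank_of k n A {i..t} = crossings f (i + 2) t + (if t < c then 1 else 0) + (if t < d then 1 else 0)"
proof -
  have t1: "\<not> [t = i] (mod int n)" using not_cong_between[of t] not_cong t by (cases "t = i + 1") auto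
  have "\<not> [i + 2 = i + 1] (mod int n)" using not_cong_add1[OF n2, of "i + 1"] by (simp add: add.assoc)
  then have "good i t" "good (i + 2) t" using t1 not_cong by (auto simp: good_def)
  then show "rank_of k n A {i + 2..t} = crossings f (i + 2) t"
    and "rank_of k n A {i..t} = crossings f (i + 2) t + (if t < c then 1 else 0) + (if t < d then 1 else 0)"
    using H t crossings_Suc_left[OF f, of i t] crossings_Suc_left[OF f, of "i + 1" t]
    by (auto simp: good_ranks_def add.assoc)
qed

lemma right_dims:
  assumes t: "t \<in> {i + 1..i + int n - 1}"
  shows "cv.dim (insert (vcol k n A i) (insert (vcol k n A (i + 1)) (vcol k n A ` {i + 2..t}))) =
    cv.dim (vcol k n A ` {i + 2..t}) + (if t < c then 1 else 0) + (if t < d then 1 else 0)"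
proof -
  have "{i..t} = insert i (insert (i + 1) {i + 2..t})" using t by auto
  then show ?thesis using right_ranks[OF t] by (simp add: rank_of_def)
qed

lemma left_pencil:
  "cv.dim (insert (vcol k n A i) (insert (vcol k n A (i + 1)) (vcol k n A ` {b..i - 1}))) =
    Suc (cv.dim (vcol k n A ` {b..i - 1}))"
  using left_dims[of b] ascent by simp

lemma right_pencil:
  "cv.dim (insert (vcol k n A i) (insert (vcol k n A (i + 1)) (vcol k n A ` {i + 2..c}))) =
    Suc (cv.dim (vcol k n A ` {i + 2..c}))"
  using right_dims[of c] ascent by simp

text \<open>\<open>g\<close> demands that column \<open>i\<close> be new over \<open>j..i-1\<close>
  exactly when its preimage lies before \<open>j\<close>. By the good ranks \<open>v_i\<close> is
  never new for \<open>j \<le> a\<close>, always new for \<open>j > b\<close>, and behaves in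
  between as at \<open>j = b\<close>; so the whole family of conditions collapses to one
  membership.\<close>

lemma left_condition:
  assumes g: "g \<in> bounded_affine k n" and gf: "\<And>j t. good j t \<Longrightarrow> crossings g j t = crossings f j t"
    and e: "inv_perm g i = a \<or> inv_perm g i = b"
  shows "(\<forall>j \<in> {i + 2 - int n..i}. rank_of k n A {j..i} = crossings g j i) \<longleftrightarrow>
    (vcol k n A i \<in> left_span A \<longleftrightarrow> inv_perm g i = b)"
proof -
  let ?v = "vcol k n A" let ?X = "\<lambda>j. vcol k n A ` {j..i - 1}"
  have fin: "finite (?X j)" for j by simp
  have step: "rank_of k n A {j..i} = crossings g j i \<longleftrightarrow> (?v i \<in> cv.span (?X j) \<longleftrightarrow> j \<le> inv_perm g i)"
    if j: "j \<in> {i + 2 - int n..i}" for j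
  proof -
    have "\<not> [j = i + 1] (mod int n)" using not_cong_before[of j] not_cong j by (cases "j = i") auto
    moreover have "\<not> [i - 1 = i] (mod int n)" using not_cong_add1[OF n2, of "i - 1"] by (simp add: cong_sym_eq)
    ultimately have "good j (i - 1)" by (simp add: good_def)
    then have "crossings g j i = rank_of k n A {j..i - 1} + (if inv_perm g i < j then 1 else 0)"
      using crossings_Suc_right[OF g, of j i] j gf left_ranks(1)[OF j] by simp
    moreover have "{j..i} = insert i {j..i - 1}" using j by auto
    ultimately show ?thesis using cv.dim_insert_finite[OF fin, of "?v i" j] by (auto simp: rank_of_def)
  qed
  have member: "?v i \<in> cv.span (?X j) \<longleftrightarrow> j \<le> a \<or> j \<le> b \<and> ?v i \<in> cv.span (?X b)"
    if j: "j \<in> {i + 2 - int n..i}" for j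
    by (rule cv.pencil_member[OF fin fin left_pencil]) (use left_dims[OF j] ascent in auto)
  have b: "b \<in> {i + 2 - int n..i}" using ascent by auto
  have "(\<forall>j \<in> {i + 2 - int n..i}. rank_of k n A {j..i} = crossings g j i) \<longleftrightarrow>
      (\<forall>j \<in> {i + 2 - int n..i}. (j \<le> a \<or> j \<le> b \<and> ?v i \<in> cv.span (?X b)) \<longleftrightarrow> j \<le> inv_perm g i)"
    using step member by simp
  \<comment> \<open>The instance \<open>j = b\<close> distinguishes the two possible preimages;
    given it, the other instances hold because \<open>a < b\<close>.\<close>
  also have "\<dots> \<longleftrightarrow> (?v i \<in> cv.span (?X b) \<longleftrightarrow> inv_perm g i = b)"
    using e b ascent by (auto dest: bspec[of _ _ b])
  finally show ?thesis by (simp add: left_span_def)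
qed

text \<open>Mirror image of \<open>left_condition\<close>: column \<open>i + 1\<close> is tested
  against the intervals starting at \<open>i + 2\<close>, and \<open>t = c\<close> is
  decisive.\<close>

lemma right_condition:
  assumes g: "g \<in> bounded_affine k n" and gf: "\<And>j t. good j t \<Longrightarrow> crossings g j t = crossings f j t"
    and e: "g (i + 1) = c \<or> g (i + 1) = d"
  shows "(\<forall>t \<in> {i + 1..i + int n - 1}. rank_of k n A {i + 1..t} = crossings g (i + 1) t) \<longleftrightarrow>
    (vcol k n A (i + 1) \<in> right_span A \<longleftrightarrow> g (i + 1) = c)"
proof -
  let ?v = "vcol k n A" let ?Y = "\<lambda>t. vcol k n A ` {i + 2..t}"
  have fin: "finite (?Y t)" for t by simp
  have step: "rank_of k n A {i + 1..t} = crossings g (i + 1) t \<longleftrightarrow>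
      (?v (i + 1) \<in> cv.span (?Y t) \<longleftrightarrow> g (i + 1) \<le> t)"
    if t: "t \<in> {i + 1..i + int n - 1}" for t
  proof -
    have "\<not> [t = i] (mod int n)" using not_cong_between[of t] not_cong t by (cases "t = i + 1") auto
    moreover have "\<not> [i + 2 = i + 1] (mod int n)"
      using not_cong_add1[OF n2, of "i + 1"] by (simp add: add.assoc)
    ultimately have "good (i + 2) t" by (simp add: good_def)
    then have "crossings g (i + 1) t = rank_of k n A {i + 2..t} + (if t < g (i + 1) then 1 else 0)"
      using crossings_Suc_left[OF g, of "i + 1" t] t gf right_ranks(1)[OF t] by (simp add: add.assoc)
    moreover have "{i + 1..t} = insert (i + 1) {i + 2..t}" using t by auto
    ultimately show ?thesis using cv.dim_insert_finite[OF fin, of "?v (i + 1)" t] by (auto simp: rank_of_def)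
  qed
  have member: "?v (i + 1) \<in> cv.span (?Y t) \<longleftrightarrow> d \<le> t \<or> c \<le> t \<and> ?v (i + 1) \<in> cv.span (?Y c)"
    if t: "t \<in> {i + 1..i + int n - 1}" for t
    by (rule cv.pencil_member[OF fin fin right_pencil[unfolded insert_commute[of "?v i"]]])
      (use right_dims[OF t] ascent in \<open>auto simp: insert_commute\<close>)
  have c: "c \<in> {i + 1..i + int n - 1}" using ascent by auto
  have "(\<forall>t \<in> {i + 1..i + int n - 1}. rank_of k n A {i + 1..t} = crossings g (i + 1) t) \<longleftrightarrow>
      (\<forall>t \<in> {i + 1..i + int n - 1}. (d \<le> t \<or> c \<le> t \<and> ?v (i + 1) \<in> cv.span (?Y c)) \<longleftrightarrow> g (i + 1) \<le> t)"
    using step member by simp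
  also have "\<dots> \<longleftrightarrow> (?v (i + 1) \<in> cv.span (?Y c) \<longleftrightarrow> g (i + 1) = c)"
    using e c ascent by (auto dest: bspec[of _ _ c])
  finally show ?thesis by (simp add: right_span_def)
qed

end

lemma s_simps: "s i = i + 1" "s (i + 1) = i"
  using simple_refl_left simple_refl_right[OF n2] by auto

lemma s_between: "i + 2 \<le> x \<Longrightarrow> x \<le> i + int n - 1 \<Longrightarrow> s x = x"
  using not_cong_between[of x] by (simp add: simple_refl_other)

lemma s_before: "i + 2 - int n \<le> x \<Longrightarrow> x \<le> i - 1 \<Longrightarrow> s x = x"
  using not_cong_before[of x] by (simp add: simple_refl_other)

lemma inv_perm_eqI:
  assumes "g \<in> bounded_affine k n" "g x = y"
  shows "inv_perm g y = x"
  using inv_perm_f[OF assms(1), of x] assms(2) by simp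

lemma inv_fs: "inv_perm (f \<star> s) i = b" "inv_perm (f \<star> s) (i + 1) = a"
  by (rule inv_perm_eqI[OF fs], simp add: aff_mult_def f_inv_perm[OF f] s_simps)+

lemma inv_sfs: "inv_perm (s \<star> f \<star> s) i = b"
  using ascent by (intro inv_perm_eqI[OF sfs]) (simp add: aff_mult_def f_inv_perm[OF f] s_simps s_before)

lemma fs_right: "(f \<star> s) (i + 1) = d"
  using ascent s_between[of d] by (simp add: aff_mult_def)

lemma sfs_right: "(s \<star> f \<star> s) (i + 1) = c"
  using ascent s_between[of c] by (simp add: aff_mult_def s_simps)

text \<open>The type is read off from the preimage of \<open>i\<close> and the value at
  \<open>i + 1\<close>: these are \<open>a, d\<close> for \<open>f\<close>, then \<open>b, d\<close>
  for \<open>f \<star> s\<close>, and \<open>b, c\<close> for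
  \<open>s \<star> f \<star> s\<close>.\<close>

lemma positroid_f: "positroid_minors k n f A \<longleftrightarrow>
    good_ranks A \<and> vcol k n A i \<notin> left_span A \<and> vcol k n A (i + 1) \<notin> right_span A"
proof (cases "good_ranks A")
  case True
  show ?thesis
    unfolding positroid_minors_split[OF f refl] left_condition[OF True f refl disjI1[OF refl]]
      right_condition[OF True f refl disjI2[OF refl]]
    using True ascent by auto
next
  case False
  then show ?thesis using positroid_minors_split[OF f refl] by blast
qed

lemma positroid_fs: "positroid_minors k n (f \<star> s) A \<longleftrightarrow>
    good_ranks A \<and> vcol k n A i \<in> left_span A \<and> vcol k n A (i + 1) \<notin> right_span A"
proof -
  have gf: "\<And>j t. good j t \<Longrightarrow> crossings (f \<star> s) j t = crossings f j t"
    by (simp add: crossings_right)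
  note split = positroid_minors_split[OF fs, OF gf]
  show ?thesis
  proof (cases "good_ranks A")
    case True
    have "(\<forall>j \<in> {i + 2 - int n..i}. rank_of k n A {j..i} = crossings (f \<star> s) j i) \<longleftrightarrow>
        vcol k n A i \<in> left_span A"
      using left_condition[OF True fs, OF gf] inv_fs(1) by simp
    moreover have "(\<forall>t \<in> {i + 1..i + int n - 1}. rank_of k n A {i + 1..t} = crossings (f \<star> s) (i + 1) t) \<longleftrightarrow>
        vcol k n A (i + 1) \<notin> right_span A"
      using right_condition[OF True fs, OF gf] fs_right ascent by simp
    ultimately show ?thesis using split[of A] True by blast
  next
    case False
    then show ?thesis using split[of A] by blast
  qed
qed

lemma positroid_sfs: "positroid_minors k n (s \<star> f \<star> s) A \<longleftrightarrow>
    good_ranks A \<and> vcol k n A i \<in> left_span A \<and> vcol k n A (i + 1) \<in> right_span A"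
proof -
  have gf: "\<And>j t. good j t \<Longrightarrow> crossings (s \<star> f \<star> s) j t = crossings f j t"
    by (simp add: crossings_right crossings_left)
  note split = positroid_minors_split[OF sfs, OF gf]
  show ?thesis
  proof (cases "good_ranks A")
    case True
    have "(\<forall>j \<in> {i + 2 - int n..i}. rank_of k n A {j..i} = crossings (s \<star> f \<star> s) j i) \<longleftrightarrow>
        vcol k n A i \<in> left_span A"
      using left_condition[OF True sfs, OF gf] inv_sfs by simp
    moreover have "(\<forall>t \<in> {i + 1..i + int n - 1}. rank_of k n A {i + 1..t} = crossings (s \<star> f \<star> s) (i + 1) t) \<longleftrightarrow>
        vcol k n A (i + 1) \<in> right_span A"
      using right_condition[OF True sfs, OF gf] sfs_right ascent by simp
    ultimately show ?thesis using split[of A] True by blast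
  next
    case False
    then show ?thesis using split[of A] by blast
  qed
qed

end

section \<open>Row spaces\<close>

context vec_space begin

text \<open>Independent subsets of \<open>W\<close> have at most \<open>n\<close> elements, so a
  maximal one exists; it is a basis, and span and independence are the same in \<open>W\<close> as
  in the ambient space.\<close>

lemma subspace_basis_exists:
  assumes W: "subspace class_ring W V"
  shows "\<exists>B. finite B \<and> B \<subseteq> carrier_vec n \<and> span B = W \<and> card B = vectorspace.dim class_ring (vs W)"
proof -
  interpret W: vectorspace class_ring "vs W" using W by (rule subspace_is_vs)
  have sub: "submodule class_ring W V" using W by (simp add: subspace_def)
  then have WV: "W \<subseteq> carrier_vec n" by (auto simp: submodule_def)
  have li: "W.lin_dep S = lin_dep S" if "S \<subseteq> W" for S using span_li_not_depend(2)[OF that sub] .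
  have "\<exists>B. finite B \<and> maximal B (\<lambda>S. S \<subseteq> carrier (vs W) \<and> \<not> W.lin_dep S)"
  proof (rule maximal_exists[where N = n and B = "{}"])
    show "\<And>S. S \<subseteq> carrier (vs W) \<and> \<not> W.lin_dep S \<Longrightarrow> finite S \<and> card S \<le> n"
      using li li_le_dim[OF fin_dim] WV dim_is_n by auto
    show "{} \<subseteq> carrier (vs W) \<and> \<not> W.lin_dep {}" by (simp add: W.lin_dep_def)
  qed
  then obtain B where B: "finite B" "maximal B (\<lambda>S. S \<subseteq> carrier (vs W) \<and> \<not> W.lin_dep S)" by blast
  have basis: "W.basis B" by (rule W.max_li_is_basis[OF B(2)])
  then have BW: "B \<subseteq> W" "W.span B = W" by (auto simp: W.basis_def)
  then have "span B = W" using span_li_not_depend(1)[OF BW(1) sub] by simp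
  then show ?thesis using B(1) BW WV W.dim_basis[OF B(1) basis] by auto
qed

lemma row_space_carrier: "A \<in> carrier_mat k n \<Longrightarrow> row_space A \<subseteq> carrier_vec n"
  by (subst row_space_eq) auto

end

lemma mem_row_space_iff:
  fixes A :: "complex mat"
  assumes "A \<in> carrier_mat k n"
  shows "w \<in> vec_space.row_space n A \<longleftrightarrow>
    (\<exists>y. w = vec n (\<lambda>c. \<Sum>r<k. y r * A $$ (r, c)))"
proof -
  interpret vec_space "TYPE(complex)" n .
  have eq: "A\<^sup>T *\<^sub>v y = vec n (\<lambda>c. \<Sum>r<k. y $ r * A $$ (r, c))" if "y \<in> carrier_vec k" for y
    using assms that by (intro eq_vecI) (auto simp: scalar_prod_def lessThan_atLeast0 mult.commute intro!: sum.cong)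
  show ?thesis unfolding row_space_eq[OF assms]
  proof
    assume "w \<in> {w \<in> carrier_vec (dim_col A). \<exists>y\<in>carrier_vec (dim_row A). A\<^sup>T *\<^sub>v y = w}"
    then obtain y where "y \<in> carrier_vec k" "A\<^sup>T *\<^sub>v y = w" using assms by auto
    then show "\<exists>y. w = vec n (\<lambda>c. \<Sum>r<k. y r * A $$ (r, c))"
      using eq by (intro exI[of _ "\<lambda>r. y $ r"]) auto
  next
    assume "\<exists>y. w = vec n (\<lambda>c. \<Sum>r<k. y r * A $$ (r, c))"
    then obtain y where y: "w = vec n (\<lambda>c. \<Sum>r<k. y r * A $$ (r, c))" by blast
    have "A\<^sup>T *\<^sub>v vec k y = w" unfolding y eq[of "vec k y", simplified]
      by (intro eq_vecI) (auto intro!: sum.cong)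
    then show "w \<in> {w \<in> carrier_vec (dim_col A). \<exists>y\<in>carrier_vec (dim_row A). A\<^sup>T *\<^sub>v y = w}"
      using assms y by (auto intro!: bexI[of _ "vec k y"])
  qed
qed

text \<open>The vectors of a basis, taken as rows, show that the choice in \<open>row_matrix\<close>
  can be met.\<close>

lemma row_matrix_spec:
  assumes "W \<in> Gr k n"
  shows "row_matrix k n W \<in> carrier_mat k n" "vec_space.row_space n (row_matrix k n W) = W"
proof -
  interpret vec_space "TYPE(complex)" n .
  obtain B where B: "finite B" "B \<subseteq> carrier_vec n" "span B = W" "card B = k"
    using subspace_basis_exists[of W] assms by (auto simp: Gr_def)
  obtain xs where xs: "set xs = B" "distinct xs" using finite_distinct_list[OF B(1)] by blast
  have "mat_of_rows n xs \<in> carrier_mat k n" using xs B(4) distinct_card[of xs] by auto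
  moreover have "row_space (mat_of_rows n xs) = W"
    unfolding row_space_def using rows_mat_of_rows[of xs n] xs B by simp
  ultimately have "\<exists>A. A \<in> carrier_mat k n \<and> row_space A = W" by blast
  from someI_ex[OF this]
  show "row_matrix k n W \<in> carrier_mat k n" "row_space (row_matrix k n W) = W"
    unfolding row_matrix_def by blast+
qed

text \<open>A nonzero minor rules out relations among the rows, so they are distinct and form a
  basis of their span.\<close>

lemma row_space_in_Gr:
  fixes A :: "complex mat"
  assumes A: "A \<in> carrier_mat k n" and nz: "minor k A \<sigma> \<noteq> 0" and \<sigma>: "\<And>c. c < k \<Longrightarrow> \<sigma> c < n"
  shows "vec_space.row_space n A \<in> Gr k n"
proof -
  interpret vec_space "TYPE(complex)" n .
  let ?M = "mat k k (\<lambda>(r, c). A $$ (r, \<sigma> c))"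
  have M: "?M \<in> carrier_mat k k" "det ?M \<noteq> 0" using nz by (auto simp: minor_def)
  \<comment> \<open>A relation among the rows kills the selected square submatrix from the left. It
    is applied once to two equal rows and once to a linear dependence.\<close>
  have ker: "u r = 0" if u: "\<And>c. c < n \<Longrightarrow> (\<Sum>r<k. u r * A $$ (r, c)) = 0" and r: "r < k" for u r
  proof (rule ccontr)
    assume "u r \<noteq> 0"
    then have "vec k u \<noteq> 0\<^sub>v k" using r by (metis index_vec index_zero_vec(1))
    moreover have "?M\<^sup>T *\<^sub>v vec k u = 0\<^sub>v k"
    proof (rule eq_vecI)
      fix c assume "c < dim_vec (0\<^sub>v k :: complex vec)"
      then have c: "c < k" by simp
      have "(?M\<^sup>T *\<^sub>v vec k u) $ c = (\<Sum>r<k. u r * A $$ (r, \<sigma> c))"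
        using c by (auto simp: scalar_prod_def lessThan_atLeast0 mult.commute intro!: sum.cong)
      then show "(?M\<^sup>T *\<^sub>v vec k u) $ c = 0\<^sub>v k $ c" using u[OF \<sigma>[OF c]] c by simp
    qed simp
    ultimately have "det (?M\<^sup>T) = 0"
      using det_0_iff_vec_prod_zero[of "?M\<^sup>T" k] M(1)
      by (metis transpose_carrier_mat vec_carrier)
    then show False using M det_transpose by metis
  qed
  have inj: "inj_on (row A) {..<k}"
  proof (rule inj_onI, rule ccontr)
    fix r r' assume r: "r \<in> {..<k}" "r' \<in> {..<k}" "row A r = row A r'" "r \<noteq> r'"
    define u where "u x = (if x = r then 1 else if x = r' then -1 else 0 :: complex)" for x
    have "u r = 0"
    proof (rule ker)
      fix c assume c: "c < n"
      have "(\<Sum>x<k. u x * A $$ (x, c)) = (\<Sum>x\<in>{r, r'}. u x * A $$ (x, c))"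
        using r by (intro sum.mono_neutral_right) (auto simp: u_def)
      also have "\<dots> = A $$ (r, c) - A $$ (r', c)" using r by (simp add: u_def)
      also have "\<dots> = 0" using arg_cong[OF r(3), of "\<lambda>v. v $ c"] r(1,2) A c by simp
      finally show "(\<Sum>x<k. u x * A $$ (x, c)) = 0" .
    qed (use r in auto)
    then show False by (simp add: u_def)
  qed
  have rows: "set (rows A) = row A ` {..<k}" using A by (auto simp: rows_def)
  have sub: "set (rows A) \<subseteq> carrier_vec n" using A by (auto simp: rows_def)
  have li: "lin_indpt (set (rows A))"
  proof
    assume "lin_dep (set (rows A))"
    then obtain S g v where S: "finite S" "S \<subseteq> set (rows A)" "lincomb g S = 0\<^sub>v n" "v \<in> S" "g v \<noteq> 0"
      by (auto simp: lin_dep_def)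
    define u where "u r = (if row A r \<in> S then g (row A r) else 0)" for r
    obtain r where r: "r < k" "v = row A r" using S(2,4) rows by auto
    have "u r = 0"
    proof (rule ker)
      fix c assume c: "c < n"
      have SA: "S = row A ` {r \<in> {..<k}. row A r \<in> S}" using S(2) rows by auto
      have "(\<Sum>r<k. u r * A $$ (r, c)) = (\<Sum>r\<in>{r \<in> {..<k}. row A r \<in> S}. g (row A r) * row A r $ c)"
        using A c by (intro sum.mono_neutral_cong_right) (auto simp: u_def)
      also have "\<dots> = (\<Sum>v\<in>S. g v * v $ c)"
        by (subst (2) SA, subst sum.reindex) (auto intro: inj_on_subset[OF inj])
      also have "\<dots> = lincomb g S $ c" using lincomb_index[OF c, of S g] S(2) sub by auto
      finally show "(\<Sum>r<k. u r * A $$ (r, c)) = 0" using S(3) c by simp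
    qed (use r in auto)
    then show False using S r by (simp add: u_def)
  qed
  have subsp: "subspace class_ring (row_space A) V"
    unfolding row_space_def by (rule span_is_subspace) (use sub in simp)
  then interpret W: vectorspace class_ring "vs (row_space A)" by (rule subspace_is_vs)
  have sm: "submodule class_ring (row_space A) V" using subsp by (simp add: subspace_def)
  have RW: "set (rows A) \<subseteq> row_space A" unfolding row_space_def by (rule in_own_span) (use sub in simp)
  have "W.basis (set (rows A))"
    unfolding W.basis_def using span_li_not_depend[OF RW sm] li RW by (auto simp: row_space_def)
  then have "W.dim = card (set (rows A))" by (intro W.dim_basis) auto
  also have "\<dots> = k" unfolding rows using card_image[OF inj] by simp
  finally show ?thesis using subsp by (simp add: Gr_def)
qed

text \<open>Inclusion of row spaces means \<open>B = g A\<close> for a square matrix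
  \<open>g\<close>; its determinant is the factor for every column sequence.\<close>

lemma row_space_eq_imp_minors:
  fixes A B :: "complex mat"
  assumes A: "A \<in> carrier_mat k n" and B: "B \<in> carrier_mat k n"
    and sub: "vec_space.row_space n B \<subseteq> vec_space.row_space n A"
  shows "\<exists>c. \<forall>\<sigma>. (\<forall>x<k. \<sigma> x < n) \<longrightarrow> minor k B \<sigma> = c * minor k A \<sigma>"
proof -
  have "\<exists>y. \<forall>c<n. B $$ (r, c) = (\<Sum>s<k. y s * A $$ (s, c))" if r: "r < k" for r
  proof -
    have "vec n (\<lambda>c. \<Sum>s<k. (if s = r then 1 else 0) * B $$ (s, c)) \<in> vec_space.row_space n B"
      unfolding mem_row_space_iff[OF B] by (rule exI) (rule refl)
    moreover have "vec n (\<lambda>c. \<Sum>s<k. (if s = r then 1 else 0) * B $$ (s, c)) = vec n (\<lambda>c. B $$ (r, c))"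
      using r by (intro eq_vecI) (simp_all add: if_distrib if_distribR cong: if_cong)
    ultimately have "vec n (\<lambda>c. B $$ (r, c)) \<in> vec_space.row_space n A" using sub by auto
    then obtain y where y: "vec n (\<lambda>c. B $$ (r, c)) = vec n (\<lambda>c. \<Sum>s<k. y s * A $$ (s, c))"
      unfolding mem_row_space_iff[OF A] by blast
    have "B $$ (r, c) = (\<Sum>s<k. y s * A $$ (s, c))" if "c < n" for c
      using arg_cong[OF y, of "\<lambda>v. v $ c"] that by simp
    then show ?thesis by blast
  qed
  then obtain y where y: "\<And>r c. r < k \<Longrightarrow> c < n \<Longrightarrow> B $$ (r, c) = (\<Sum>s<k. y r s * A $$ (s, c))" by metis
  define g where "g = mat k k (\<lambda>(r, s). y r s)"
  have "minor k B \<sigma> = det g * minor k A \<sigma>" if \<sigma>: "\<forall>x<k. \<sigma> x < n" for \<sigma>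
  proof -
    have "mat k k (\<lambda>(r, c). B $$ (r, \<sigma> c)) = g * mat k k (\<lambda>(r, c). A $$ (r, \<sigma> c))"
      using y \<sigma> by (intro eq_matI) (auto simp: g_def scalar_prod_def lessThan_atLeast0)
    moreover have "g \<in> carrier_mat k k" by (simp add: g_def)
    ultimately show ?thesis unfolding minor_def using det_mult[of g k "mat k k (\<lambda>(r, c). A $$ (r, \<sigma> c))"] by simp
  qed
  then show ?thesis by blast
qed

text \<open>Extends the Pluecker coordinates to arbitrary column sequences, so that exchanging
  columns requires no sorting and no signs.\<close>

definition minor_at :: "nat \<Rightarrow> nat \<Rightarrow> (nat \<Rightarrow> nat) \<Rightarrow> complex vec set \<Rightarrow> complex" where
  "minor_at k n \<sigma> W = minor k (row_matrix k n W) \<sigma>"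

lemma picks_less: "J \<in> ksubsets k n \<Longrightarrow> c < k \<Longrightarrow> picks J c < n"
proof -
  assume J: "J \<in> ksubsets k n" and c: "c < k"
  then have "picks J c \<in> (\<lambda>j. nat (j - 1)) ` J" using picks_bij(2)[OF J] by force
  then show ?thesis using J by (force simp: ksubsets_def)
qed

lemma plucker_eq_minor_at: "W \<in> Gr k n \<Longrightarrow> J \<in> ksubsets k n \<Longrightarrow> plucker k n J W = minor_at k n (picks J) W"
  unfolding plucker_def minor_at_def using det_submatrix_eq_minor row_matrix_spec(1) by blast

text \<open>\<open>A\<close> and the chosen matrix are multiples of each other by square matrices;
  one nonvanishing minor on either side shows that the factor is nonzero.\<close>

lemma minor_at_row_space:
  fixes A :: "complex mat"
  assumes A: "A \<in> carrier_mat k n" and Gr: "vec_space.row_space n A \<in> Gr k n"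
    and nz: "minor k A \<tau> \<noteq> 0 \<or> minor_at k n \<tau> (vec_space.row_space n A) \<noteq> 0" and \<tau>: "\<And>c. c < k \<Longrightarrow> \<tau> c < n"
  shows "\<exists>c. c \<noteq> 0 \<and> (\<forall>\<sigma>. (\<forall>x<k. \<sigma> x < n) \<longrightarrow> minor_at k n \<sigma> (vec_space.row_space n A) = c * minor k A \<sigma>)"
proof -
  let ?W = "vec_space.row_space n A"
  note B = row_matrix_spec[OF Gr]
  obtain c where c: "\<And>\<sigma>. (\<forall>x<k. \<sigma> x < n) \<Longrightarrow> minor k (row_matrix k n ?W) \<sigma> = c * minor k A \<sigma>"
    using row_space_eq_imp_minors[OF A B(1)] B(2) by auto
  obtain d where d: "\<And>\<sigma>. (\<forall>x<k. \<sigma> x < n) \<Longrightarrow> minor k A \<sigma> = d * minor k (row_matrix k n ?W) \<sigma>"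
    using row_space_eq_imp_minors[OF B(1) A] B(2) by auto
  have "c \<noteq> 0" using c[of \<tau>] d[of \<tau>] nz \<tau> by (auto simp: minor_at_def)
  then show ?thesis using c unfolding minor_at_def by blast
qed

text \<open>Distinct columns only have to be sorted. A repeated column gives zero, written as
  \<open>0\<close> times some coordinate so that the result is still a form of degree one;
  \<open>k \<le> n\<close> supplies that coordinate.\<close>

lemma minor_as_pluecker:
  assumes k: "k \<le> n" and \<sigma>: "\<And>c. c < k \<Longrightarrow> \<sigma> c < n"
  shows "\<exists>\<epsilon>. \<exists>J \<in> ksubsets k n. \<forall>A. minor k A \<sigma> = \<epsilon> * minor k A (picks J)"
proof (cases "inj_on \<sigma> {0..<k}")
  case True
  define J where "J = (\<lambda>c. int c + 1) ` \<sigma> ` {0..<k}"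
  have "card J = k" unfolding J_def using card_image[OF True] by (subst card_image) (auto simp: inj_on_def)
  then have J: "J \<in> ksubsets k n" using \<sigma> by (auto simp: ksubsets_def J_def) (metis of_nat_less_iff zless_imp_add1_zle add.commute)
  have "\<sigma> ` {0..<k} = picks J ` {0..<k}"
    unfolding picks_bij(2)[OF J] by (simp add: J_def image_image)
  from minor_same_image[OF True picks_bij(1)[OF J] this] J show ?thesis by blast
next
  case False
  have "minor k A \<sigma> = 0" for A
  proof -
    obtain c c' where "c < k" "c' < k" "c \<noteq> c'" "\<sigma> c = \<sigma> c'" using False by (auto simp: inj_on_def)
    then show ?thesis unfolding minor_def
      by (intro det_identical_columns[of _ k c c']) (auto intro!: eq_vecI)
  qed
  moreover have "{1..int k} \<in> ksubsets k n" using k by (simp add: ksubsets_def)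
  ultimately show ?thesis by (intro exI[of _ 0] bexI[of _ "{1..int k}"]) auto
qed

lemma minor_at_form:
  assumes k: "k \<le> n" and \<sigma>: "\<And>c. c < k \<Longrightarrow> \<sigma> c < n"
  shows "\<exists>F. plucker_form k n 1 F \<and> (\<forall>W \<in> Gr k n. minor_at k n \<sigma> W = F W)"
proof -
  obtain \<epsilon> J where J: "J \<in> ksubsets k n" "\<And>A. minor k A \<sigma> = \<epsilon> * minor k A (picks J)"
    using minor_as_pluecker[of k n \<sigma>, OF k \<sigma>] by blast
  have "plucker_form k n (0 + 1) (\<lambda>W. \<epsilon> * plucker k n J W)"
    by (intro plucker_form.mult plucker_form.const plucker_form.coord J(1))
  moreover have "minor_at k n \<sigma> W = \<epsilon> * plucker k n J W" if "W \<in> Gr k n" for W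
    using plucker_eq_minor_at[OF that J(1)] J(2) by (simp add: minor_at_def)
  ultimately show ?thesis by auto
qed

lemma regular_minor_quotient:
  assumes k: "k \<le> n" and \<sigma>: "\<And>c. c < k \<Longrightarrow> \<sigma> c < n" and \<tau>: "\<And>c. c < k \<Longrightarrow> \<tau> c < n"
    and S: "S \<subseteq> Gr k n" and nz: "\<And>W. W \<in> S \<Longrightarrow> minor_at k n \<tau> W \<noteq> 0"
  shows "regular (Gr_sub k n S) S (\<lambda>W. minor_at k n \<sigma> W / minor_at k n \<tau> W)"
proof -
  obtain F where F: "plucker_form k n 1 F" "\<And>W. W \<in> Gr k n \<Longrightarrow> minor_at k n \<sigma> W = F W"
    using minor_at_form[of k n \<sigma>, OF k \<sigma>] by auto
  obtain G where G: "plucker_form k n 1 G" "\<And>W. W \<in> Gr k n \<Longrightarrow> minor_at k n \<tau> W = G W"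
    using minor_at_form[of k n \<tau>, OF k \<tau>] by auto
  define V where "V = {W \<in> Gr k n. G W \<noteq> 0}"
  have V: "openin (Gr_zariski k n) V" unfolding V_def by (rule openin_Gr_nonzero[OF G(1)])
  have reg: "regular (grassmannian k n) V (\<lambda>W. F W / G W)"
    unfolding regular_grassmannian
  proof (intro conjI ballI V)
    fix W assume "W \<in> V"
    then show "\<exists>d F' G' V'. plucker_form k n d F' \<and> plucker_form k n d G' \<and> openin (Gr_zariski k n) V' \<and>
        W \<in> V' \<and> V' \<subseteq> V \<and> (\<forall>W \<in> V'. G' W \<noteq> 0 \<and> F W / G W = F' W / G' W)"
      using F(1) G(1) V by (rule_tac exI[of _ 1], rule_tac exI[of _ F], rule_tac exI[of _ G], rule_tac exI[of _ V])
        (auto simp: V_def)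
  qed
  have SV: "S \<subseteq> V"
  proof
    fix W assume "W \<in> S"
    then show "W \<in> V" using S nz[of W] G(2)[of W] by (auto simp: V_def)
  qed
  show ?thesis unfolding regular_subvariety
  proof (intro conjI ballI)
    show "openin (subtopology (zariski (grassmannian k n)) S) S"
      using openin_topspace[of "subtopology (Gr_zariski k n) S"] S by (simp add: Int_absorb1)
    fix W assume "W \<in> S"
    then show "\<exists>V g. openin (zariski (grassmannian k n)) V \<and> W \<in> V \<and> regular (grassmannian k n) V g \<and>
        (\<forall>y \<in> S \<inter> V. minor_at k n \<sigma> y / minor_at k n \<tau> y = g y)"
      using V SV reg S F(2) G(2)
      by (rule_tac exI[of _ V], rule_tac exI[of _ "\<lambda>W. F W / G W"]) auto
  qed
qed

section \<open>Twisting subspaces\<close>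

definition twist_vec :: "nat \<Rightarrow> nat \<Rightarrow> nat \<Rightarrow> complex \<Rightarrow> complex vec \<Rightarrow> complex vec" where
  "twist_vec n p q \<beta> u = vec n (\<lambda>c. if c = p then u $ q - \<beta> * u $ p else if c = q then u $ p else u $ c)"

lemma row_space_twist:
  fixes A :: "complex mat"
  assumes A: "A \<in> carrier_mat k n" and p: "p < n" "q < n"
  shows "vec_space.row_space n (twist k n p q \<beta> A) = twist_vec n p q \<beta> ` vec_space.row_space n A"
proof -
  have eq: "vec n (\<lambda>c. \<Sum>r<k. y r * twist k n p q \<beta> A $$ (r, c)) =
      twist_vec n p q \<beta> (vec n (\<lambda>c. \<Sum>r<k. y r * A $$ (r, c)))" for y
    using p by (intro eq_vecI)
      (auto simp: twist_vec_def twist_def sum_distrib_left sum_subtractf[symmetric] algebra_simps intro!: sum.cong)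
  show ?thesis
  proof (intro equalityI subsetI)
    fix w assume "w \<in> vec_space.row_space n (twist k n p q \<beta> A)"
    then obtain y where "w = vec n (\<lambda>c. \<Sum>r<k. y r * twist k n p q \<beta> A $$ (r, c))"
      unfolding mem_row_space_iff[OF twist_carrier] by blast
    then show "w \<in> twist_vec n p q \<beta> ` vec_space.row_space n A"
      unfolding eq by (rule image_eqI) (unfold mem_row_space_iff[OF A], rule exI, rule refl)
  next
    fix w assume "w \<in> twist_vec n p q \<beta> ` vec_space.row_space n A"
    then obtain u where "w = twist_vec n p q \<beta> u" "u \<in> vec_space.row_space n A" by blast
    then obtain y where "w = twist_vec n p q \<beta> (vec n (\<lambda>c. \<Sum>r<k. y r * A $$ (r, c)))"
      unfolding mem_row_space_iff[OF A] by blast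
    then show "w \<in> vec_space.row_space n (twist k n p q \<beta> A)"
      unfolding eq[symmetric] mem_row_space_iff[OF twist_carrier] by blast
  qed
qed

text \<open>Acting on vectors makes the map on subspaces independent of a chosen matrix;
  \<open>row_space_twist\<close> links it to the column operation.\<close>

definition twist_space :: "nat \<Rightarrow> nat \<Rightarrow> nat \<Rightarrow> complex \<Rightarrow> complex vec set \<Rightarrow> complex vec set" where
  "twist_space n p q \<beta> W = twist_vec n p q \<beta> ` W"

lemma twist_space_inverse:
  assumes W: "W \<in> Gr k n" and p: "p < n" "q < n" "p \<noteq> q"
  shows "twist_space n q p (- \<beta>) (twist_space n p q \<beta> W) = W"
proof -
  have "twist_vec n q p (- \<beta>) (twist_vec n p q \<beta> u) = u" if "u \<in> carrier_vec n" for u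
    using p that by (intro eq_vecI) (auto simp: twist_vec_def)
  moreover have "W \<subseteq> carrier_vec n"
    using vec_space.row_space_carrier[OF row_matrix_spec(1)[OF W]] row_matrix_spec(2)[OF W] by simp
  ultimately show ?thesis unfolding twist_space_def image_image by (force simp: subset_iff)
qed

text \<open>Only the column taken at \<open>p\<close> is a difference. Expanding it linearly gives
  the transposed sequence and a correction in which \<open>p\<close> stays in place while
  \<open>q\<close> still turns into \<open>p\<close>.\<close>

lemma minor_twist:
  assumes p: "p < n" "q < n" "p \<noteq> q" and \<sigma>: "\<And>c. c < k \<Longrightarrow> \<sigma> c < n" and inj: "inj_on \<sigma> {0..<k}"
  shows "minor k (twist k n p q \<beta> A) \<sigma> = minor k A (\<lambda>c. Transposition.transpose p q (\<sigma> c)) -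
    \<beta> * (if p \<in> \<sigma> ` {0..<k} then minor k A (\<lambda>c. if \<sigma> c = p then p else Transposition.transpose p q (\<sigma> c)) else 0)"
proof (cases "p \<in> \<sigma> ` {0..<k}")
  case False
  have "mat k k (\<lambda>(r, c). twist k n p q \<beta> A $$ (r, \<sigma> c)) =
      mat k k (\<lambda>(r, c). A $$ (r, Transposition.transpose p q (\<sigma> c)))"
    using False \<sigma> by (intro eq_matI) (auto simp: twist_def Transposition.transpose_def)
  then show ?thesis using False by (simp add: minor_def)
next
  case True
  then obtain c0 where c0: "c0 < k" "\<sigma> c0 = p" by auto
  have ne: "\<sigma> c \<noteq> p" if "c < k" "c \<noteq> c0" for c using inj that c0 by (auto dest: inj_onD)
  have "det (mat k k (\<lambda>(r, c). twist k n p q \<beta> A $$ (r, \<sigma> c))) =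
      det (mat k k (\<lambda>(r, c). A $$ (r, Transposition.transpose p q (\<sigma> c)))) -
      \<beta> * det (mat k k (\<lambda>(r, c). A $$ (r, if \<sigma> c = p then p else Transposition.transpose p q (\<sigma> c))))"
    by (rule det_column_linear[of _ k _ _ c0])
      (use c0 ne \<sigma> p in \<open>auto simp: twist_def Transposition.transpose_def\<close>)
  then show ?thesis using True by (simp add: minor_def)
qed

text \<open>Division by the coordinate of \<open>I\<close>, which vanishes nowhere on
  \<open>S\<close>, yields globally regular representatives of all coordinates of the twisted point.
  The hypothesis \<open>img\<close> keeps the twisted matrix of full rank.\<close>

lemma (in space_with_functions) morphism_twist:
  assumes k: "k \<le> n" and w: "morphism X (Gr_sub k n S) w" and S: "S \<subseteq> Gr k n"
    and I: "I \<in> ksubsets k n" and nz: "\<And>W. W \<in> S \<Longrightarrow> minor_at k n (picks I) W \<noteq> 0"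
    and t: "regular X (points X) t" and p: "p < n" "q < n" "p \<noteq> q"
    and img: "\<And>x. x \<in> points X \<Longrightarrow> \<exists>J \<in> ksubsets k n.
      minor k (twist k n p q (t x) (row_matrix k n (w x))) (picks J) \<noteq> 0"
  shows "morphism X (grassmannian k n) (\<lambda>x. twist_space n p q (t x) (w x))"
proof (rule morphism_grassmannian)
  let ?\<tau> = "Transposition.transpose p q"
  have wS: "w x \<in> S" if "x \<in> points X" for x
    using w that S by (auto simp: morphism_def continuous_map_def)
  have pts: "points (Gr_sub k n S) = S" using S by auto
  have \<tau>: "?\<tau> c < n" if "c < n" for c using that p by (auto simp: Transposition.transpose_def)
  have reg: "regular X (points X) (\<lambda>x. minor_at k n \<sigma> (w x) / minor_at k n (picks I) (w x))"
    if "\<And>c. c < k \<Longrightarrow> \<sigma> c < n" for \<sigma>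
    using morphism_regular[OF w, unfolded pts, OF regular_minor_quotient[of k n \<sigma> "picks I" S, OF k that picks_less[OF I] S nz]]
    by (simp add: comp_def)
  let ?p = "\<lambda>J x. minor_at k n (\<lambda>c. ?\<tau> (picks J c)) (w x) / minor_at k n (picks I) (w x) -
      t x * (if p \<in> picks J ` {0..<k} then minor_at k n (\<lambda>c. if picks J c = p then p else ?\<tau> (picks J c)) (w x) /
        minor_at k n (picks I) (w x) else 0)"
  show "regular X (points X) (?p J)" if J: "J \<in> ksubsets k n" for J
  proof -
    have 1: "regular X (points X) (\<lambda>x. minor_at k n (\<lambda>c. ?\<tau> (picks J c)) (w x) / minor_at k n (picks I) (w x))"
      by (rule reg) (rule \<tau>[OF picks_less[OF J]])
    have 2: "regular X (points X) (\<lambda>x. minor_at k n (\<lambda>c. if picks J c = p then p else ?\<tau> (picks J c)) (w x) /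
        minor_at k n (picks I) (w x))"
      by (rule reg) (use p \<tau>[OF picks_less[OF J]] in simp)
    show ?thesis
    proof (cases "p \<in> picks J ` {0..<k}")
      case True
      then show ?thesis unfolding if_P[OF True] by (intro regular_diff regular_mult 1 2 t)
    next
      case False
      then show ?thesis unfolding if_not_P[OF False]
        by (intro regular_diff regular_mult 1 t regular_const) simp
    qed
  qed
  fix x assume x: "x \<in> points X"
  have W: "w x \<in> Gr k n" using wS[OF x] S by auto
  let ?A = "row_matrix k n (w x)" let ?B = "twist k n p q (t x) ?A"
  have rs: "vec_space.row_space n ?B = twist_space n p q (t x) (w x)"
    using row_space_twist[OF row_matrix_spec(1)[OF W] p(1,2)] row_matrix_spec(2)[OF W]
    by (simp add: twist_space_def)
  obtain J where J: "J \<in> ksubsets k n" "minor k ?B (picks J) \<noteq> 0" using img[OF x] by blast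
  show Gr: "twist_space n p q (t x) (w x) \<in> Gr k n"
    using row_space_in_Gr[OF twist_carrier J(2) picks_less[OF J(1)]] unfolding rs .
  obtain c where c: "c \<noteq> 0" "\<And>\<sigma>. (\<forall>x<k. \<sigma> x < n) \<Longrightarrow>
      minor_at k n \<sigma> (twist_space n p q (t x) (w x)) = c * minor k ?B \<sigma>"
    using minor_at_row_space[OF twist_carrier, of n k p q "t x" ?A "picks J"] Gr J picks_less[OF J(1)]
    unfolding rs by blast
  show "\<exists>c. c \<noteq> 0 \<and> (\<forall>J \<in> ksubsets k n. plucker k n J (twist_space n p q (t x) (w x)) = c * ?p J x)"
  proof (intro exI[of _ "c * minor_at k n (picks I) (w x)"] conjI ballI)
    show "c * minor_at k n (picks I) (w x) \<noteq> 0" using c(1) nz wS[OF x] by simp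
    fix K assume K: "K \<in> ksubsets k n"
    have "plucker k n K (twist_space n p q (t x) (w x)) = c * minor k ?B (picks K)"
      using plucker_eq_minor_at[OF Gr K] c(2)[of "picks K"] picks_less[OF K] by simp
    also have "minor k ?B (picks K) = minor_at k n (picks I) (w x) * ?p K x"
    proof -
      have mt: "minor k ?B (picks K) = minor k ?A (\<lambda>c. ?\<tau> (picks K c)) - t x *
          (if p \<in> picks K ` {0..<k} then minor k ?A (\<lambda>c. if picks K c = p then p else ?\<tau> (picks K c)) else 0)"
        by (rule minor_twist[OF p picks_less[OF K] picks_bij(1)[OF K]])
      have "minor k ?A (picks I) \<noteq> 0" using nz[OF wS[OF x]] by (simp add: minor_at_def)
      then show ?thesis
        unfolding mt minor_at_def by (cases "p \<in> picks K ` {0..<k}") (simp_all add: right_diff_distrib)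
    qed
    finally show "plucker k n K (twist_space n p q (t x) (w x)) =
        c * minor_at k n (picks I) (w x) * ?p K x" by simp
  qed
qed

text \<open>Cramer's rule for the one column that changes.\<close>

lemma minor_replace_column:
  assumes n: "n > 0" and A: "A \<in> carrier_mat k n" and T: "T \<in> ksubsets k n"
    and x: "residue n x \<in> T" and y: "residue n y \<notin> T"
    and rel: "vcol k n A y - (\<lambda>r. \<gamma> * vcol k n A x r) \<in> cv.span (vcol k n A ` (T - {residue n x}))"
  shows "minor k A (\<lambda>c. Transposition.transpose (idx n x) (idx n y) (picks T c)) = \<gamma> * minor k A (picks T)"
proof -
  let ?p = "idx n x" and ?q = "idx n y"
  let ?B = "twist k n ?p ?q \<gamma> A"
  have T1: "T \<subseteq> {1..int n}" using T by (simp add: ksubsets_def)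
  have xy: "\<not> [x = y] (mod int n)" using x y residue_eq_iff by metis
  have pq: "?p < n" "?q < n" "?p \<noteq> ?q" using idx_less[OF n] idx_eq_iff[OF n] xy by auto
  have idxT: "(\<lambda>j. nat (j - 1)) ` T = idx n ` T"
    using T1 by (intro image_cong) (auto simp: idx_def)
  have res: "idx n (residue n z) = idx n z" for z
    using residue_cong[of n z] idx_eq_iff[OF n] by blast
  have im: "picks T ` {0..<k} = idx n ` T" using picks_bij(2)[OF T] idxT by simp
  have pT: "?p \<in> picks T ` {0..<k}" unfolding im using x res by (metis image_eqI)
  have "?q \<notin> idx n ` T"
  proof
    assume "?q \<in> idx n ` T"
    then obtain z where z: "z \<in> T" "[y = z] (mod int n)" using idx_eq_iff[OF n] by auto
    then have "residue n y = z" using T1 residue_eq_iff residue_id by (metis subsetD)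
    then show False using y z by simp
  qed
  then have qT: "picks T c \<noteq> ?q" if "c < k" for c using im that by force
  \<comment> \<open>Twisting by \<gamma> makes the column labelled by \<open>x\<close> dependent on
    the others from \<open>T\<close>. Expanding this vanishing minor by \<open>minor_twist\<close>
    gives the claim.\<close>
  have "minor k ?B (picks T) = 0"
  proof (rule ccontr)
    assume "minor k ?B (picks T) \<noteq> 0"
    then have ind: "inj_on (vcol k n ?B) T" "cv.independent (vcol k n ?B ` T)"
      using minor_picks_nonzero_iff[OF T] by blast+
    have w: "vcol k n ?B z = (if [z = x] (mod int n) then vcol k n A y - (\<lambda>r. \<gamma> * vcol k n A x r)
      else if [z = y] (mod int n) then vcol k n A x else vcol k n A z)" for z
      unfolding vcol_idx column_twist[OF idx_less[OF n] idx_less[OF n] idx_less[OF n]] idx_eq_iff[OF n]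
      by simp
    have same: "vcol k n ?B z = vcol k n A z" if z: "z \<in> T - {residue n x}" for z
    proof -
      have "residue n z = z" using z T1 residue_id by blast
      then have "\<not> [z = x] (mod int n)" "\<not> [z = y] (mod int n)"
        using z y residue_eq_iff by (metis DiffE insertI1, metis DiffE)
      then show ?thesis by (simp add: w)
    qed
    have wx: "vcol k n ?B (residue n x) = vcol k n A y - (\<lambda>r. \<gamma> * vcol k n A x r)"
      by (simp add: w residue_cong)
    have "vcol k n ?B ` (T - {residue n x}) = vcol k n A ` (T - {residue n x})"
      by (rule image_cong[OF refl same])
    with rel have "vcol k n ?B (residue n x) \<in> cv.span (vcol k n ?B ` (T - {residue n x}))"
      by (simp only: wx)
    moreover have "vcol k n ?B ` (T - {residue n x}) = vcol k n ?B ` T - {vcol k n ?B (residue n x)}"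
      using ind(1) x by (auto dest: inj_onD)
    ultimately show False using ind(2) x unfolding cv.dependent_def by auto
  qed
  moreover have "minor k ?B (picks T) = minor k A (\<lambda>c. Transposition.transpose ?p ?q (picks T c)) -
      \<gamma> * minor k A (\<lambda>c. if picks T c = ?p then ?p else Transposition.transpose ?p ?q (picks T c))"
    using minor_twist[OF pq picks_less[OF T] picks_bij(1)[OF T], of \<gamma> A] pT by simp
  moreover have "minor k A (\<lambda>c. if picks T c = ?p then ?p else Transposition.transpose ?p ?q (picks T c)) =
      minor k A (picks T)"
    by (rule minor_cong) (use qT in \<open>auto simp: Transposition.transpose_def\<close>)
  ultimately show ?thesis by simp
qed

section \<open>Bases read off from necklaces, and charts\<close>

lemma (in vector_space) independent_card_eq_dim_span:
  assumes "finite S" "independent B" "B \<subseteq> span S" "card B = dim S"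
  shows "S \<subseteq> span B"
proof (rule subsetI, rule ccontr)
  fix x assume x: "x \<in> S" "x \<notin> span B"
  have ind: "independent (insert x B)" using x(2) assms(2) by (rule independent_insertI)
  have sub: "insert x B \<subseteq> span S" using assms(3) span_base[OF x(1)] by simp
  have "x \<notin> B" using x(2) span_base[of x B] by blast
  then show False using assms(4) independent_card_le_dim_finite[OF assms(1) ind sub] by auto
qed

text \<open>The independent columns with labels of \<open>T\<close> in the interval are as many as
  its rank, so they span it; the label of \<open>x\<close> lies outside and may be dropped.\<close>

lemma span_target_necklace:
  assumes n: "n > 0" and T: "T \<in> ksubsets k n" and nz: "minor k A (picks T) \<noteq> 0"
    and x: "residue n x \<notin> cyc_interval n j t"
    and card: "card (T \<inter> cyc_interval n j t) = rank_of k n A {j..t}"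
  shows "cv.span (vcol k n A ` {j..t}) \<subseteq> cv.span (vcol k n A ` (T - {residue n x}))"
proof -
  let ?v = "vcol k n A" and ?R = "cyc_interval n j t"
  have ind: "inj_on ?v T" "cv.independent (?v ` T)" using nz minor_picks_nonzero_iff[OF T] by blast+
  have b1: "cv.independent (?v ` (T \<inter> ?R))" by (rule cv.independent_mono[OF ind(2)]) auto
  have b2: "card (?v ` (T \<inter> ?R)) = cv.dim (?v ` ?R)"
    using card card_image[OF inj_on_subset[OF ind(1), of "T \<inter> ?R"]]
    by (simp add: rank_of_def vcol_cyc_interval)
  have b3: "?v ` (T \<inter> ?R) \<subseteq> cv.span (?v ` ?R)" using cv.span_superset[of "?v ` ?R"] by blast
  have b4: "finite (?v ` ?R)" by (simp add: cyc_interval_def)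
  have "?v ` ?R \<subseteq> cv.span (?v ` (T \<inter> ?R))" by (rule cv.independent_card_eq_dim_span[OF b4 b1 b3 b2])
  also have "\<dots> \<subseteq> cv.span (?v ` (T - {residue n x}))" by (rule cv.span_mono) (use x in auto)
  finally have "?v ` {j..t} \<subseteq> cv.span (?v ` (T - {residue n x}))" by (simp add: vcol_cyc_interval)
  then show ?thesis by (rule cv.span_minimal) (rule cv.subspace_span)
qed

lemma positroid_minors_necklace:
  assumes g: "g \<in> bounded_affine k n" and n: "n > 0" and "positroid_minors k n g A"
  shows "minor k A (picks (target_necklace n g j)) \<noteq> 0"
proof -
  have "target_necklace n g j = target_necklace n g (residue n j)"
    by (rule periodic_cong[where Q = "target_necklace n g", OF target_necklace_cong[OF g] cong_sym[OF residue_cong]])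
  then show ?thesis using assms(3) residue_in[OF n, of j] by (simp add: positroid_minors_def)
qed

text \<open>Minors of \<open>A\<close> and Pluecker coordinates are proportional once one of them is
  nonzero. The coordinate of \<open>I\<close> provides this in both directions, and a nonzero minor
  also places the row space in the Grassmannian.\<close>

lemma chart_iff:
  fixes A :: "complex mat"
  assumes g: "g \<in> bounded_affine k n" and n: "n > 0" and I: "I \<in> ksubsets k n" and A: "A \<in> carrier_mat k n"
  shows "vec_space.row_space n A \<in> open_positroid_chart k n g I \<longleftrightarrow>
    positroid_minors k n g A \<and> minor k A (picks I) \<noteq> 0"
proof -
  let ?W = "vec_space.row_space n A"
  have scale: "(?W \<in> open_positroid_chart k n g I) = (positroid_minors k n g A \<and> minor k A (picks I) \<noteq> 0)"
    if Gr: "?W \<in> Gr k n" and nz: "minor k A (picks I) \<noteq> 0 \<or> minor_at k n (picks I) ?W \<noteq> 0"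
  proof -
    obtain c where c: "c \<noteq> 0" "\<And>\<sigma>. (\<forall>x<k. \<sigma> x < n) \<Longrightarrow> minor_at k n \<sigma> ?W = c * minor k A \<sigma>"
      using minor_at_row_space[OF A Gr nz picks_less[OF I]] by blast
    have pl: "plucker k n J ?W = c * minor k A (picks J)" if "J \<in> ksubsets k n" for J
      using plucker_eq_minor_at[OF Gr that] c(2)[of "picks J"] picks_less[OF that] by simp
    have T: "target_necklace n g j \<in> ksubsets k n" for j by (rule target_necklace_ksubsets[OF g n])
    show ?thesis
      unfolding open_positroid_chart_def open_positroid_def positroid_minors_def
      using Gr c(1) I T by (auto simp: pl)
  qed
  show ?thesis
  proof
    assume W: "?W \<in> open_positroid_chart k n g I"
    then have Gr: "?W \<in> Gr k n" and nz: "plucker k n I ?W \<noteq> 0"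
      by (auto simp: open_positroid_chart_def open_positroid_def)
    then show "positroid_minors k n g A \<and> minor k A (picks I) \<noteq> 0"
      using scale W plucker_eq_minor_at[OF Gr I] by simp
  next
    assume *: "positroid_minors k n g A \<and> minor k A (picks I) \<noteq> 0"
    then have "?W \<in> Gr k n" by (intro row_space_in_Gr[OF A _ picks_less[OF I]]) auto
    then show "?W \<in> open_positroid_chart k n g I" using scale * by blast
  qed
qed

lemma chart_subset_Gr: "open_positroid_chart k n g I \<subseteq> Gr k n"
  by (auto simp: open_positroid_chart_def open_positroid_def)

lemma chart_row_matrix:
  assumes g: "g \<in> bounded_affine k n" and n: "n > 0" and I: "I \<in> ksubsets k n"
    and W: "W \<in> open_positroid_chart k n g I"
  shows "row_matrix k n W \<in> carrier_mat k n" "vec_space.row_space n (row_matrix k n W) = W"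
    "positroid_minors k n g (row_matrix k n W)" "minor k (row_matrix k n W) (picks I) \<noteq> 0"
proof -
  have "W \<in> Gr k n" using W chart_subset_Gr by blast
  note A = row_matrix_spec[OF this]
  show "row_matrix k n W \<in> carrier_mat k n" "vec_space.row_space n (row_matrix k n W) = W" by (rule A)+
  then show "positroid_minors k n g (row_matrix k n W)" "minor k (row_matrix k n W) (picks I) \<noteq> 0"
    using chart_iff[OF g n I A(1)] W by auto
qed

section \<open>The two scalars as quotients of minors\<close>

context double_move
begin

lemma inverse_cong_less: "inv_perm f (i + int n) = a + int n"
  by (rule bounded_affine_inv_period[OF f])

lemma left_intervals: "residue n i \<notin> cyc_interval n b (i - 1)" "residue n (i + 1) \<notin> cyc_interval n b (i - 1)"
  using not_cong_before ascent by (auto simp: cyc_interval_def residue_eq_iff cong_sym_eq)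

lemma right_intervals: "residue n i \<notin> cyc_interval n (i + 2) c" "residue n (i + 1) \<notin> cyc_interval n (i + 2) c"
  using not_cong_between ascent by (auto simp: cyc_interval_def residue_eq_iff cong_sym_eq)

text \<open>The entry at \<open>b\<close> suits \<beta>: it contains \<open>i\<close>, since
  \<open>a < b\<close>, but not \<open>i + 1\<close>, whose preimage is \<open>b\<close> itself, and
  it contains labels of a basis of the left span.\<close>

abbreviation "TL \<equiv> target_necklace n f b"

lemma TL: "TL \<in> ksubsets k n" "residue n i \<in> TL" "residue n (i + 1) \<notin> TL"
proof -
  show "TL \<in> ksubsets k n" by (rule target_necklace_ksubsets[OF f n0])
  have "i \<in> {y \<in> {b..b + int n - 1}. inv_perm f y < b}" using ascent by auto
  then show "residue n i \<in> TL" unfolding target_necklace_eq[OF f] by blast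
  show "residue n (i + 1) \<notin> TL"
  proof
    assume "residue n (i + 1) \<in> TL"
    then obtain y where y: "y \<in> {b..b + int n - 1}" "inv_perm f y < b" "[i + 1 = y] (mod int n)"
      unfolding target_necklace_eq[OF f] by (auto simp: residue_eq_iff)
    have "i + 1 = y" using y ascent by (intro cong_inj_window[of _ _ n b]) auto
    then show False using y by simp
  qed
qed

text \<open>The left span is generated by columns of \<open>TL\<close> other than \<open>i\<close>;
  modulo these, exchanging \<open>i\<close> for \<open>i + 1\<close> multiplies the column by
  \<beta>.\<close>

lemma left_coefficient:
  assumes A: "A \<in> carrier_mat k n" and pos: "positroid_minors k n f A"
    and \<beta>: "vcol k n A (i + 1) - (\<lambda>r. \<beta> * vcol k n A i r) \<in> left_span A"
  shows "minor k A (\<lambda>c. Transposition.transpose (idx n i) (idx n (i + 1)) (picks TL c)) = \<beta> * minor k A (picks TL)"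
proof (rule minor_replace_column[OF n0 A TL])
  have rk: "rank_of k n A {b..i - 1} = crossings f b (i - 1)"
    using pos ascent unfolding positroid_minors_iff_rank[OF f n0] by auto
  have "card (TL \<inter> cyc_interval n b (i - 1)) = rank_of k n A {b..i - 1}"
    using card_target_necklace[OF f n0, of "i - 1" b] ascent rk by simp
  from span_target_necklace[OF n0 TL(1) positroid_minors_necklace[OF f n0 pos] left_intervals(1) this]
  show "vcol k n A (i + 1) - (\<lambda>r. \<beta> * vcol k n A i r) \<in> cv.span (vcol k n A ` (TL - {residue n i}))"
    using \<beta> by (auto simp: left_span_def)
qed

text \<open>The entry at \<open>i + 1\<close> contains \<open>i + 1\<close> but not
  \<open>i\<close>, and its part in \<open>i+1..c\<close> is a basis there. As
  \<open>g (i + 1) = d\<close> lies beyond \<open>c\<close>, dropping \<open>i + 1\<close> leaves a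
  basis of the right span. The case \<open>f\<close> yields the equation of the closed part, the
  case \<open>f \<star> s\<close> the shift on the open part.\<close>

lemma right_coefficient:
  fixes g
  defines "T \<equiv> target_necklace n g (i + 1)"
  assumes g: "g = f \<or> g = f \<star> s" and A: "A \<in> carrier_mat k n" and pos: "positroid_minors k n g A"
    and \<alpha>: "vcol k n A i - (\<lambda>r. \<alpha> * vcol k n A (i + 1) r) \<in> right_span A"
  shows "minor k A (\<lambda>c. Transposition.transpose (idx n (i + 1)) (idx n i) (picks T c)) = \<alpha> * minor k A (picks T)"
proof -
  have gb: "g \<in> bounded_affine k n" using g f fs by auto
  have inv: "inv_perm g (i + 1) < i + 1" "i + 1 \<le> inv_perm g (i + int n)"
    using g ascent inv_fs inverse_cong_less bounded_affine_inv_period[OF fs, of i] by auto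
  have T: "T \<in> ksubsets k n" unfolding T_def by (rule target_necklace_ksubsets[OF gb n0])
  have "i + 1 \<in> {y \<in> {i + 1..i + 1 + int n - 1}. inv_perm g y < i + 1}" using inv n0 by simp
  then have T1: "residue n (i + 1) \<in> T" unfolding T_def target_necklace_eq[OF gb] by blast
  have T2: "residue n i \<notin> T"
  proof
    assume "residue n i \<in> T"
    then obtain y where y: "y \<in> {i + 1..i + 1 + int n - 1}" "inv_perm g y < i + 1" "[i = y] (mod int n)"
      unfolding T_def target_necklace_eq[OF gb] by (auto simp: residue_eq_iff)
    \<comment> \<open>In the window starting at \<open>i + 1\<close> the class of \<open>i\<close>
      is represented by \<open>i + n\<close>.\<close>
    have "i + int n = y" using y n0 by (intro cong_inj_window[of _ _ n "i + 1"]) (auto simp: cong_add_int)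
    then show False using y inv by simp
  qed
  have rk: "rank_of k n A {j..t} = crossings g j t" if "t \<in> {j - 1..j + int n - 1}" for j t
    using pos that unfolding positroid_minors_iff_rank[OF gb n0] by blast
  have gd: "g (i + 1) = d" using g fs_right by auto
  have r1: "rank_of k n A {i + 1..c} = Suc (rank_of k n A {i + 2..c})"
    using rk[of c "i + 1"] rk[of c "i + 2"] crossings_Suc_left[OF gb, of "i + 1" c] ascent gd
    by (simp add: add.assoc)
  have "cyc_interval n (i + 1) c = insert (residue n (i + 1)) (cyc_interval n (i + 2) c)"
  proof -
    have "{i + 1..c} = insert (i + 1) {i + 2..c}" using ascent by auto
    then show ?thesis by (simp add: cyc_interval_def)
  qed
  then have "card (T \<inter> cyc_interval n (i + 1) c) = Suc (card (T \<inter> cyc_interval n (i + 2) c))"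
    using T1 right_intervals(2) by (simp add: cyc_interval_def)
  moreover have "card (T \<inter> cyc_interval n (i + 1) c) = rank_of k n A {i + 1..c}"
    unfolding T_def using card_target_necklace[OF gb n0, of c "i + 1"] rk[of c "i + 1"] ascent by simp
  ultimately have card: "card (T \<inter> cyc_interval n (i + 2) c) = rank_of k n A {i + 2..c}" using r1 by simp
  have nz: "minor k A (picks T) \<noteq> 0" unfolding T_def by (rule positroid_minors_necklace[OF gb n0 pos])
  show ?thesis
  proof (rule minor_replace_column[OF n0 A T T1 T2])
    show "vcol k n A i - (\<lambda>r. \<alpha> * vcol k n A (i + 1) r) \<in> cv.span (vcol k n A ` (T - {residue n (i + 1)}))"
      using span_target_necklace[OF n0 T nz right_intervals(2) card] \<alpha> by (auto simp: right_span_def)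
  qed
qed

section \<open>How twisting changes the type\<close>

abbreviation "p \<equiv> idx n i"
abbreviation "q \<equiv> idx n (i + 1)"

lemma pq: "p < n" "q < n" "p \<noteq> q" "q \<noteq> p"
  using idx_less[OF n0] idx_eq_iff[OF n0] not_cong by auto

lemma vcol_twist:
  "vcol k n (twist k n p q \<beta> A) i = vcol k n A (i + 1) - (\<lambda>r. \<beta> * vcol k n A i r)"
  "vcol k n (twist k n p q \<beta> A) (i + 1) = vcol k n A i"
  "vcol k n (twist k n q p \<beta> A) (i + 1) = vcol k n A i - (\<lambda>r. \<beta> * vcol k n A (i + 1) r)"
  "vcol k n (twist k n q p \<beta> A) i = vcol k n A (i + 1)"
  unfolding vcol_idx using pq by (simp_all add: column_twist)

lemma spans_twist:
  assumes A: "A \<in> carrier_mat k n"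
  shows "left_span (twist k n p q \<beta> A) = left_span A" "right_span (twist k n p q \<beta> A) = right_span A"
    "left_span (twist k n q p \<beta> A) = left_span A" "right_span (twist k n q p \<beta> A) = right_span A"
proof -
  have l: "(\<exists>x \<in> {b..i - 1}. [x = i] (mod int n)) = False" "(\<exists>x \<in> {b..i - 1}. [x = i + 1] (mod int n)) = False"
    using not_cong_before ascent by auto
  have r: "(\<exists>x \<in> {i + 2..c}. [x = i] (mod int n)) = False" "(\<exists>x \<in> {i + 2..c}. [x = i + 1] (mod int n)) = False"
    using not_cong_between ascent by auto
  show "left_span (twist k n p q \<beta> A) = left_span A" "right_span (twist k n p q \<beta> A) = right_span A"
    "left_span (twist k n q p \<beta> A) = left_span A" "right_span (twist k n q p \<beta> A) = right_span A"
    unfolding left_span_def right_span_def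
    by (rule span_twist[OF n0 A not_cong(2)], simp only: l r)+
      (rule span_twist[OF n0 A not_cong(1)], simp only: l r)+
qed

lemma good_twist:
  assumes A: "A \<in> carrier_mat k n"
  shows "good_ranks (twist k n p q \<beta> A) = good_ranks A" "good_ranks (twist k n q p \<beta> A) = good_ranks A"
  using good_ranks_twist[OF A] by auto

text \<open>The new column \<open>i\<close> lies in the left span by the choice of \<beta>. The new
  column \<open>i + 1\<close> is the old \<open>v_i\<close>, so its relation to the right span
  selects the target.\<close>

lemma twist_forward:
  assumes A: "A \<in> carrier_mat k n" and pos: "positroid_minors k n f A"
    and \<beta>: "vcol k n A (i + 1) - (\<lambda>r. \<beta> * vcol k n A i r) \<in> left_span A"
  shows "vcol k n A i \<in> right_span A \<Longrightarrow> positroid_minors k n (s \<star> f \<star> s) (twist k n p q \<beta> A)"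
    "vcol k n A i \<notin> right_span A \<Longrightarrow> positroid_minors k n (f \<star> s) (twist k n p q \<beta> A)"
  using pos \<beta> unfolding positroid_f positroid_fs positroid_sfs vcol_twist spans_twist[OF A] good_twist[OF A]
  by auto

lemma left_exists:
  assumes "positroid_minors k n f A"
  shows "\<exists>!\<beta>. vcol k n A (i + 1) - (\<lambda>r. \<beta> * vcol k n A i r) \<in> left_span A"
  using assms cv.pencil_ex1[of "vcol k n A ` {b..i - 1}" "vcol k n A i" "vcol k n A (i + 1)"] left_pencil[of A]
  unfolding positroid_f by (simp add: left_span_def)

lemma right_exists:
  assumes "positroid_minors k n f A \<or> positroid_minors k n (f \<star> s) A"
  shows "\<exists>!\<alpha>. vcol k n A i - (\<lambda>r. \<alpha> * vcol k n A (i + 1) r) \<in> right_span A"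
  using assms cv.pencil_ex1[of "vcol k n A ` {i + 2..c}" "vcol k n A (i + 1)" "vcol k n A i"] right_pencil[of A]
  unfolding positroid_f positroid_fs by (auto simp: right_span_def insert_commute)

text \<open>In terms of the columns \<open>v\<close> of \<open>A\<close> and \<open>w\<close> of \<open>B\<close> below, \<open>v\<^sub>i = w\<^sub>i\<^sub>+\<^sub>1\<close> and
  \<open>v\<^sub>i\<^sub>+\<^sub>1 = w\<^sub>i + t w\<^sub>i\<^sub>+\<^sub>1\<close>.\<close>

lemma twist_backward_sfs:
  fixes t :: complex and B :: "complex mat"
  assumes B: "B \<in> carrier_mat k n" and pos: "positroid_minors k n (s \<star> f \<star> s) B"
  defines "A \<equiv> twist k n q p (- t) B"
  shows "positroid_minors k n f A" "vcol k n A i \<in> right_span A"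
    "vcol k n A (i + 1) - (\<lambda>r. t * vcol k n A i r) \<in> left_span A"
proof -
  let ?w = "vcol k n B"
  have v: "vcol k n A i = ?w (i + 1)" "vcol k n A (i + 1) = ?w i + (\<lambda>r. t * ?w (i + 1) r)"
    unfolding A_def vcol_twist by (auto simp: fun_eq_iff)
  have sp: "left_span A = left_span B" "right_span A = right_span B" "good_ranks A = good_ranks B"
    unfolding A_def spans_twist[OF B] good_twist[OF B] by auto
  have H: "good_ranks B" "?w i \<in> left_span B" "?w (i + 1) \<in> right_span B"
    using pos unfolding positroid_sfs by auto
  have nl: "?w (i + 1) \<notin> left_span B"
    using cv.pencil_complement[of "vcol k n B ` {b..i - 1}" "?w i" "?w (i + 1)"] left_pencil[OF H(1)] H(2)
    by (simp add: left_span_def)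
  have nr: "?w i \<notin> right_span B"
    using cv.pencil_complement[of "vcol k n B ` {i + 2..c}" "?w (i + 1)" "?w i"] right_pencil[OF H(1)] H(3)
    by (simp add: right_span_def insert_commute)
  have "?w i + (\<lambda>r. t * ?w (i + 1) r) \<notin> right_span B"
  proof
    assume "?w i + (\<lambda>r. t * ?w (i + 1) r) \<in> right_span B"
    moreover have "(\<lambda>r. t * ?w (i + 1) r) \<in> right_span B"
      using H(3) cv.span_scale unfolding right_span_def by blast
    ultimately have "(?w i + (\<lambda>r. t * ?w (i + 1) r)) - (\<lambda>r. t * ?w (i + 1) r) \<in> right_span B"
      unfolding right_span_def by (rule cv.span_diff)
    with nr show False by simp
  qed
  then show "positroid_minors k n f A" unfolding positroid_f v sp using H nl by auto
  show "vcol k n A i \<in> right_span A" unfolding v sp by (rule H(3))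
  show "vcol k n A (i + 1) - (\<lambda>r. t * vcol k n A i r) \<in> left_span A" unfolding v sp using H(2) by simp
qed

text \<open>If the restored \<open>v_{i+1}\<close> lay in the right span, subtracting
  \<open>w_i - \<alpha> w_{i+1}\<close> would leave \<open>(t + \<alpha>) w_{i+1}\<close> there.
  Hence -\<alpha> is the only value of \<open>t\<close> to avoid.\<close>

lemma twist_backward_fs:
  fixes t :: complex and B :: "complex mat"
  assumes B: "B \<in> carrier_mat k n" and pos: "positroid_minors k n (f \<star> s) B"
    and \<alpha>: "vcol k n B i - (\<lambda>r. \<alpha> * vcol k n B (i + 1) r) \<in> right_span B" and t: "t + \<alpha> \<noteq> 0"
  defines "A \<equiv> twist k n q p (- t) B"
  shows "positroid_minors k n f A" "vcol k n A i \<notin> right_span A"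
    "vcol k n A (i + 1) - (\<lambda>r. t * vcol k n A i r) \<in> left_span A"
proof -
  let ?w = "vcol k n B"
  have v: "vcol k n A i = ?w (i + 1)" "vcol k n A (i + 1) = ?w i + (\<lambda>r. t * ?w (i + 1) r)"
    unfolding A_def vcol_twist by (auto simp: fun_eq_iff)
  have sp: "left_span A = left_span B" "right_span A = right_span B" "good_ranks A = good_ranks B"
    unfolding A_def spans_twist[OF B] good_twist[OF B] by auto
  have H: "good_ranks B" "?w i \<in> left_span B" "?w (i + 1) \<notin> right_span B"
    using pos unfolding positroid_fs by auto
  have nl: "?w (i + 1) \<notin> left_span B"
    using cv.pencil_complement[of "vcol k n B ` {b..i - 1}" "?w i" "?w (i + 1)"] left_pencil[OF H(1)] H(2)
    by (simp add: left_span_def)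
  have "?w i + (\<lambda>r. t * ?w (i + 1) r) \<notin> right_span B"
  proof
    assume "?w i + (\<lambda>r. t * ?w (i + 1) r) \<in> right_span B"
    then have "(?w i + (\<lambda>r. t * ?w (i + 1) r)) - (?w i - (\<lambda>r. \<alpha> * ?w (i + 1) r)) \<in> right_span B"
      using \<alpha> unfolding right_span_def by (rule cv.span_diff)
    moreover have "(?w i + (\<lambda>r. t * ?w (i + 1) r)) - (?w i - (\<lambda>r. \<alpha> * ?w (i + 1) r)) =
        (\<lambda>r. (t + \<alpha>) * ?w (i + 1) r)" by (auto simp: fun_eq_iff algebra_simps)
    ultimately have "(\<lambda>r. inverse (t + \<alpha>) * ((t + \<alpha>) * ?w (i + 1) r)) \<in> right_span B"
      using cv.span_scale unfolding right_span_def by metis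
    moreover have "(\<lambda>r. inverse (t + \<alpha>) * ((t + \<alpha>) * ?w (i + 1) r)) = ?w (i + 1)"
      using t by (auto simp: fun_eq_iff)
    ultimately show False using H(3) by simp
  qed
  then show "positroid_minors k n f A" unfolding positroid_f v sp using H nl by auto
  show "vcol k n A i \<notin> right_span A" unfolding v sp by (rule H(3))
  show "vcol k n A (i + 1) - (\<lambda>r. t * vcol k n A i r) \<in> left_span A" unfolding v sp using H(2) by simp
qed

text \<open>For \<alpha> = -\<beta> the vector in the right span would be \<open>v_{i+1}\<close>
  itself; this makes the shifted coordinate nonzero.\<close>

lemma right_coefficient_twist:
  assumes A: "A \<in> carrier_mat k n" and pos: "positroid_minors k n f A"
    and \<alpha>: "vcol k n (twist k n p q \<beta> A) i - (\<lambda>r. \<alpha> * vcol k n (twist k n p q \<beta> A) (i + 1) r) \<in> right_span A"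
  shows "\<beta> + \<alpha> \<noteq> 0"
proof
  assume "\<beta> + \<alpha> = 0"
  then have "\<alpha> = - \<beta>" by (simp add: eq_neg_iff_add_eq_0 add.commute)
  then have "vcol k n (twist k n p q \<beta> A) i - (\<lambda>r. \<alpha> * vcol k n (twist k n p q \<beta> A) (i + 1) r) = vcol k n A (i + 1)"
    unfolding vcol_twist by (auto simp: fun_eq_iff)
  then show False using \<alpha> pos unfolding positroid_f by simp
qed

lemma idx_refl_set: "idx n ` refl_set n i I = Transposition.transpose p q ` idx n ` I"
proof -
  have "idx n (residue n (s x)) = Transposition.transpose p q (idx n x)" for x
  proof -
    have "idx n (residue n (s x)) = idx n (s x)" using residue_cong idx_eq_iff[OF n0] by blast
    also have "\<dots> = Transposition.transpose p q (idx n x)"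
    proof (cases "[x = i] (mod int n)")
      case True
      then have "[x + 1 = i + 1] (mod int n)" by (simp add: cong_add1_iff)
      then have "idx n (x + 1) = q" "idx n x = p" using True idx_eq_iff[OF n0] by auto
      then show ?thesis using True by (simp add: simple_refl_cases)
    next
      case False
      show ?thesis
      proof (cases "[x = i + 1] (mod int n)")
        case True
        then have "[x - 1 = i] (mod int n)" using cong_add1_iff[of "x - 1" i n] by simp
        then have "idx n (x - 1) = p" "idx n x = q" using True idx_eq_iff[OF n0] by auto
        then show ?thesis using True False by (simp add: simple_refl_cases)
      next
        case 2: False
        then have "idx n x \<noteq> p" "idx n x \<noteq> q" using False idx_eq_iff[OF n0] by auto
        then show ?thesis using False 2 by (simp add: simple_refl_cases Transposition.transpose_def)
      qed
    qed
    finally show ?thesis .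
  qed
  then show ?thesis by (simp add: refl_set_def image_image)
qed

lemma index_idx: "J \<in> ksubsets k n \<Longrightarrow> (\<lambda>j. nat (j - 1)) ` J = idx n ` J"
  by (intro image_cong) (auto simp: idx_def ksubsets_def dest: subsetD)

lemma refl_set_ksubsets:
  assumes I: "I \<in> ksubsets k n"
  shows "refl_set n i I \<in> ksubsets k n"
proof -
  have "inj_on (\<lambda>x. residue n (s x)) I"
  proof (rule inj_onI)
    fix x y assume xy: "x \<in> I" "y \<in> I" "residue n (s x) = residue n (s y)"
    then have "[s x = s y] (mod int n)" by (simp add: residue_eq_iff)
    then obtain m where "s y = s x + int n * m" by (metis cong_iff_lin)
    then have "s y = s (x + int n * m)"
      using period_mult[of s n x m] simple_refl_period by simp
    then have "y = x + int n * m" using simple_refl_involution[OF n2] by metis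
    then have "[x = y] (mod int n)" by (metis cong_iff_lin)
    then have "residue n x = residue n y" by (simp add: residue_eq_iff)
    moreover have "x \<in> {1..int n}" "y \<in> {1..int n}" using xy I by (auto simp: ksubsets_def)
    ultimately show "x = y" by (metis residue_id)
  qed
  then have "card (refl_set n i I) = card I" unfolding refl_set_def by (rule card_image)
  then show ?thesis using I residue_in[OF n0] by (auto simp: ksubsets_def refl_set_def)
qed

text \<open>The correction term of \<open>minor_twist\<close> can occur only if \<open>i + 1\<close>
  belongs to \<open>I\<close>. By hypothesis \<open>I\<close> then contains \<open>i\<close> too, so
  the correction uses column \<open>p\<close> twice and vanishes, whatever \<beta> is.\<close>

lemma minor_twist_chart:
  assumes I: "I \<in> ksubsets k n" and ii: "residue n (i + 1) \<in> I \<longrightarrow> i \<in> I"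
  shows "\<exists>\<epsilon>. \<epsilon> \<noteq> 0 \<and> (\<forall>\<beta> A. minor k (twist k n p q \<beta> A) (picks (refl_set n i I)) = \<epsilon> * minor k A (picks I))"
proof -
  let ?J = "refl_set n i I" and ?\<tau> = "Transposition.transpose p q"
  have J: "?J \<in> ksubsets k n" by (rule refl_set_ksubsets[OF I])
  have imJ: "picks ?J ` {0..<k} = ?\<tau> ` idx n ` I"
    using picks_bij(2)[OF J] index_idx[OF J] idx_refl_set by simp
  have imI: "picks I ` {0..<k} = idx n ` I" using picks_bij(2)[OF I] index_idx[OF I] by simp
  have "(\<lambda>c. ?\<tau> (picks ?J c)) ` {0..<k} = ?\<tau> ` (picks ?J ` {0..<k})" by (simp add: image_image)
  also have "\<dots> = picks I ` {0..<k}" unfolding imJ imI by (simp add: image_image)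
  finally have im: "(\<lambda>c. ?\<tau> (picks ?J c)) ` {0..<k} = picks I ` {0..<k}" .
  have inj: "inj_on (\<lambda>c. ?\<tau> (picks ?J c)) {0..<k}"
    using comp_inj_on[OF picks_bij(1)[OF J] inj_on_subset[OF inj_transpose subset_UNIV, of p q]]
    by (simp add: comp_def)
  obtain \<epsilon> where \<epsilon>: "\<epsilon> \<noteq> 0" "\<And>A. minor k A (\<lambda>c. ?\<tau> (picks ?J c)) = \<epsilon> * minor k A (picks I)"
    using minor_same_image[OF inj picks_bij(1)[OF I] im] by blast
  have zero: "minor k A (\<lambda>c. if picks ?J c = p then p else ?\<tau> (picks ?J c)) = 0"
    if pJ: "p \<in> picks ?J ` {0..<k}" for A
  proof -
    obtain z where z: "z \<in> idx n ` I" "p = ?\<tau> z" using pJ unfolding imJ by blast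
    have "?\<tau> p = ?\<tau> (?\<tau> z)" by (rule arg_cong[OF z(2)])
    then have "q \<in> idx n ` I" using z(1) by simp
    then obtain x where x: "x \<in> I" "[i + 1 = x] (mod int n)" using idx_eq_iff[OF n0] by auto
    have "residue n x = x" using x(1) I residue_id[of x n] by (auto simp: ksubsets_def)
    then have "residue n (i + 1) = x" using x(2) residue_eq_iff by metis
    then have "i \<in> I" using ii x by simp
    then have "?\<tau> p \<in> picks ?J ` {0..<k}" unfolding imJ by (intro imageI)
    then have "q \<in> picks ?J ` {0..<k}" by simp
    \<comment> \<open>Both places receive the old column \<open>p\<close>: the first is kept, the
      second is transposed from \<open>q\<close>.\<close>
    then obtain c0 c1 where c: "c0 < k" "c1 < k" "picks ?J c0 = p" "picks ?J c1 = q" using pJ by auto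
    then have "c0 \<noteq> c1" using pq by auto
    then show ?thesis unfolding minor_def
      by (intro det_identical_columns[of _ k c0 c1]) (use c pq in \<open>auto intro!: eq_vecI simp: Transposition.transpose_def\<close>)
  qed
  have "minor k (twist k n p q \<beta> A) (picks ?J) = \<epsilon> * minor k A (picks I)" for \<beta> A
  proof -
    have "minor k (twist k n p q \<beta> A) (picks ?J) = minor k A (\<lambda>c. ?\<tau> (picks ?J c)) -
      \<beta> * (if p \<in> picks ?J ` {0..<k} then minor k A (\<lambda>c. if picks ?J c = p then p else ?\<tau> (picks ?J c)) else 0)"
      by (rule minor_twist[OF pq(1-3) picks_less[OF J] picks_bij(1)[OF J]])
    then show ?thesis using zero \<epsilon>(2) by simp
  qed
  then show ?thesis using \<epsilon>(1) by blast
qed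

end

section \<open>The decomposition\<close>

lemma (in space_with_functions) morphism_ident: "morphism X X (\<lambda>x. x)"
  unfolding morphism_def
proof (intro conjI allI impI)
  fix V f assume V: "openin (zariski X) V" "regular X V f"
  have "{x \<in> points X. x \<in> V} = V" using openin_subset[OF V(1)] by auto
  then show "regular X {x \<in> points X. x \<in> V} (f \<circ> (\<lambda>x. x))" using V(2) by (simp add: comp_def)
qed simp

lemma space_with_functions_Gr_sub: "space_with_functions (Gr_sub k n S)"
  by (rule space_with_functions.space_with_functions_subvariety[OF space_with_functions_grassmannian])

lemma space_with_functions_punctured_line: "space_with_functions punctured_line"
  unfolding punctured_line_def by (rule affine_line.space_with_functions_subvariety)

lemma points_Gr_sub: "S \<subseteq> Gr k n \<Longrightarrow> points (Gr_sub k n S) = S"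
  by auto

context double_move
begin

abbreviation "TF \<equiv> target_necklace n f (i + 1)"
abbreviation "TR \<equiv> target_necklace n (f \<star> s) (i + 1)"

text \<open>Cramer quotient for \<beta>, meant for points of type \<open>f\<close>, where the
  necklace minor in the denominator is nonzero.\<close>

definition "left_coeff W =
  minor_at k n (\<lambda>x. Transposition.transpose p q (picks TL x)) W / minor_at k n (picks TL) W"

text \<open>Cramer quotient for \<alpha>, meant for points of type \<open>f \<star> s\<close> and
  therefore built from the necklace of that permutation.\<close>

definition "right_coeff W =
  minor_at k n (\<lambda>x. Transposition.transpose q p (picks TR x)) W / minor_at k n (picks TR) W"

lemma transpose_less: "x < n \<Longrightarrow> Transposition.transpose p q x < n" "x < n \<Longrightarrow> Transposition.transpose q p x < n"
  using pq by (auto simp: Transposition.transpose_def)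

lemma necklace_ksubsets: "TF \<in> ksubsets k n" "TR \<in> ksubsets k n"
  using target_necklace_ksubsets[OF f n0] target_necklace_ksubsets[OF fs n0] by auto

lemma left_coeff:
  assumes A: "A \<in> carrier_mat k n" and pos: "positroid_minors k n f A"
    and \<beta>: "vcol k n A (i + 1) - (\<lambda>r. \<beta> * vcol k n A i r) \<in> left_span A"
  shows "left_coeff (vec_space.row_space n A) = \<beta>"
proof -
  have nz: "minor k A (picks TL) \<noteq> 0" by (rule positroid_minors_necklace[OF f n0 pos])
  obtain e where e: "e \<noteq> 0" "\<And>\<sigma>. (\<forall>x<k. \<sigma> x < n) \<Longrightarrow>
      minor_at k n \<sigma> (vec_space.row_space n A) = e * minor k A \<sigma>"
    using minor_at_row_space[OF A row_space_in_Gr[OF A nz picks_less[OF TL(1)]] disjI1[OF nz] picks_less[OF TL(1)]]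
    by blast
  show ?thesis
    using left_coefficient[OF A pos \<beta>] nz e picks_less[OF TL(1)] transpose_less by (simp add: left_coeff_def)
qed

lemma right_coeff:
  assumes A: "A \<in> carrier_mat k n" and pos: "positroid_minors k n (f \<star> s) A"
    and \<alpha>: "vcol k n A i - (\<lambda>r. \<alpha> * vcol k n A (i + 1) r) \<in> right_span A"
  shows "right_coeff (vec_space.row_space n A) = \<alpha>"
proof -
  note T = necklace_ksubsets(2)
  have nz: "minor k A (picks TR) \<noteq> 0" by (rule positroid_minors_necklace[OF fs n0 pos])
  obtain e where e: "e \<noteq> 0" "\<And>\<sigma>. (\<forall>x<k. \<sigma> x < n) \<Longrightarrow>
      minor_at k n \<sigma> (vec_space.row_space n A) = e * minor k A \<sigma>"
    using minor_at_row_space[OF A row_space_in_Gr[OF A nz picks_less[OF T]] disjI1[OF nz] picks_less[OF T]]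
    by blast
  show ?thesis
    using right_coefficient[OF disjI2[OF refl] A pos \<alpha>] nz e picks_less[OF T] transpose_less
    by (simp add: right_coeff_def)
qed

text \<open>The numerator of the Cramer quotient for \<open>f\<close> equals \<alpha> times a
  nonzero minor, and \<alpha> = 0 says that \<open>v_i\<close> itself lies in the right
  span.\<close>

lemma right_member_iff:
  assumes A: "A \<in> carrier_mat k n" and pos: "positroid_minors k n f A"
  shows "minor_at k n (\<lambda>x. Transposition.transpose q p (picks TF x)) (vec_space.row_space n A) = 0 \<longleftrightarrow>
    vcol k n A i \<in> right_span A"
proof -
  note T = necklace_ksubsets(1)
  have nz: "minor k A (picks TF) \<noteq> 0" by (rule positroid_minors_necklace[OF f n0 pos])
  obtain e where e: "e \<noteq> 0" "\<And>\<sigma>. (\<forall>x<k. \<sigma> x < n) \<Longrightarrow>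
      minor_at k n \<sigma> (vec_space.row_space n A) = e * minor k A \<sigma>"
    using minor_at_row_space[OF A row_space_in_Gr[OF A nz picks_less[OF T]] disjI1[OF nz] picks_less[OF T]]
    by blast
  obtain \<alpha> where \<alpha>: "vcol k n A i - (\<lambda>r. \<alpha> * vcol k n A (i + 1) r) \<in> right_span A"
    and uniq: "\<And>\<gamma>. vcol k n A i - (\<lambda>r. \<gamma> * vcol k n A (i + 1) r) \<in> right_span A \<Longrightarrow> \<gamma> = \<alpha>"
    using right_exists[OF disjI1[OF pos]] by blast
  have zero: "vcol k n A i - (\<lambda>r. 0 * vcol k n A (i + 1) r) = vcol k n A i" by (simp add: fun_eq_iff)
  have "minor_at k n (\<lambda>x. Transposition.transpose q p (picks TF x)) (vec_space.row_space n A) =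
      e * (\<alpha> * minor k A (picks TF))"
    using right_coefficient[OF disjI1[OF refl] A pos \<alpha>] e(2) picks_less[OF T] transpose_less by simp
  then have "minor_at k n (\<lambda>x. Transposition.transpose q p (picks TF x)) (vec_space.row_space n A) = 0 \<longleftrightarrow> \<alpha> = 0"
    using e(1) nz by simp
  also have "\<dots> \<longleftrightarrow> vcol k n A i \<in> right_span A"
    using \<alpha> uniq[of 0] zero by auto
  finally show ?thesis .
qed

section \<open>The isomorphisms for the closed and the open part\<close>

context
  fixes I
  assumes kn: "k \<le> n" and I: "I \<in> ksubsets k n" and ii: "residue n (i + 1) \<in> I \<longrightarrow> i \<in> I"
begin

abbreviation "sI \<equiv> refl_set n i I"
abbreviation "C\<^sub>f \<equiv> open_positroid_chart k n f I"
abbreviation "C\<^sub>f\<^sub>s \<equiv> open_positroid_chart k n (f \<star> s) sI"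
abbreviation "C\<^sub>s\<^sub>f\<^sub>s \<equiv> open_positroid_chart k n (s \<star> f \<star> s) sI"

text \<open>By \<open>right_member_iff\<close> this single equation cuts out the points with
  \<open>v_i\<close> in the right span, which is what makes the locus closed.\<close>

definition "closed_part =
  {W \<in> C\<^sub>f. minor_at k n (\<lambda>x. Transposition.transpose q p (picks TF x)) W = 0}"

definition "open_part =
  {W \<in> C\<^sub>f. minor_at k n (\<lambda>x. Transposition.transpose q p (picks TF x)) W \<noteq> 0}"

lemma sI: "sI \<in> ksubsets k n" by (rule refl_set_ksubsets[OF I])

lemma parts_Gr: "closed_part \<subseteq> Gr k n" "open_part \<subseteq> Gr k n"
  using chart_subset_Gr[of k n f I] by (auto simp: closed_part_def open_part_def)

lemma twist_minor_nonzero: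
  "minor k (twist k n p q \<beta> A) (picks sI) \<noteq> 0 \<longleftrightarrow> minor k A (picks I) \<noteq> 0"
  using minor_twist_chart[OF I ii] by (metis mult_eq_0_iff)

lemma forward:
  assumes W: "W \<in> C\<^sub>f"
  defines "B \<equiv> twist k n p q (left_coeff W) (row_matrix k n W)"
  shows "vec_space.row_space n B = twist_space n p q (left_coeff W) W"
    "minor k B (picks sI) \<noteq> 0"
    "W \<in> closed_part \<Longrightarrow> twist_space n p q (left_coeff W) W \<in> C\<^sub>s\<^sub>f\<^sub>s"
    "W \<in> open_part \<Longrightarrow> twist_space n p q (left_coeff W) W \<in> C\<^sub>f\<^sub>s \<and>
      left_coeff W + right_coeff (twist_space n p q (left_coeff W) W) \<noteq> 0"
proof -
  let ?A = "row_matrix k n W"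
  note A = chart_row_matrix[OF f n0 I W]
  have B: "B \<in> carrier_mat k n" by (simp add: B_def)
  show rs: "vec_space.row_space n B = twist_space n p q (left_coeff W) W"
    unfolding B_def row_space_twist[OF A(1) pq(1,2)] A(2) twist_space_def ..
  show nz: "minor k B (picks sI) \<noteq> 0" unfolding B_def twist_minor_nonzero by (rule A(4))
  obtain \<beta> where \<beta>: "vcol k n ?A (i + 1) - (\<lambda>r. \<beta> * vcol k n ?A i r) \<in> left_span ?A"
    using left_exists[OF A(3)] by blast
  have "left_coeff W = \<beta>" using left_coeff[OF A(1,3) \<beta>] A(2) by simp
  with \<beta> have lc: "vcol k n ?A (i + 1) - (\<lambda>r. left_coeff W * vcol k n ?A i r) \<in> left_span ?A" by simp
  note mem = right_member_iff[OF A(1,3), unfolded A(2)]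
  show "twist_space n p q (left_coeff W) W \<in> C\<^sub>s\<^sub>f\<^sub>s" if "W \<in> closed_part"
  proof -
    have "positroid_minors k n (s \<star> f \<star> s) B"
      unfolding B_def by (rule twist_forward(1)[OF A(1,3) lc]) (use that mem in \<open>simp add: closed_part_def\<close>)
    then show ?thesis using chart_iff[OF sfs n0 sI B] nz rs by simp
  qed
  show "twist_space n p q (left_coeff W) W \<in> C\<^sub>f\<^sub>s \<and>
      left_coeff W + right_coeff (twist_space n p q (left_coeff W) W) \<noteq> 0" if "W \<in> open_part"
  proof
    have pos: "positroid_minors k n (f \<star> s) B"
      unfolding B_def by (rule twist_forward(2)[OF A(1,3) lc]) (use that mem in \<open>simp add: open_part_def\<close>)
    then show "twist_space n p q (left_coeff W) W \<in> C\<^sub>f\<^sub>s" using chart_iff[OF fs n0 sI B] nz rs by simp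
    obtain \<alpha> where \<alpha>: "vcol k n B i - (\<lambda>r. \<alpha> * vcol k n B (i + 1) r) \<in> right_span B"
      using right_exists[OF disjI2[OF pos]] by blast
    have "\<alpha> = right_coeff (twist_space n p q (left_coeff W) W)"
      using right_coeff[OF B pos \<alpha>] rs by simp
    moreover have "right_span B = right_span ?A" unfolding B_def by (rule spans_twist(2)[OF A(1)])
    ultimately show "left_coeff W + right_coeff (twist_space n p q (left_coeff W) W) \<noteq> 0"
      using right_coefficient_twist[OF A(1,3), of "left_coeff W" \<alpha>] \<alpha> by (simp add: B_def)
  qed
qed

text \<open>Common to both inverse maps: once type \<open>f\<close> and the scalar \<open>t\<close>
  are verified for \<open>A\<close>, twisting \<open>A\<close> forward recovers \<open>B\<close>,
  which settles the chart condition, and \<open>left_coeff\<close> returns \<open>t\<close>.\<close>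

lemma backward_chart:
  fixes t :: complex and B :: "complex mat"
  assumes B: "B \<in> carrier_mat k n" "vec_space.row_space n B = W" "minor k B (picks sI) \<noteq> 0"
  defines "A \<equiv> twist k n q p (- t) B"
  assumes pos: "positroid_minors k n f A"
    and lc: "vcol k n A (i + 1) - (\<lambda>r. t * vcol k n A i r) \<in> left_span A"
  shows "vec_space.row_space n A = twist_space n q p (- t) W" "minor k A (picks I) \<noteq> 0"
    "twist_space n q p (- t) W \<in> C\<^sub>f" "left_coeff (twist_space n q p (- t) W) = t"
proof -
  have A: "A \<in> carrier_mat k n" by (simp add: A_def)
  show rs: "vec_space.row_space n A = twist_space n q p (- t) W"
    unfolding A_def row_space_twist[OF B(1) pq(2,1)] B(2) twist_space_def ..
  have "twist k n p q t A = B"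
    unfolding A_def using twist_inverse[OF B(1) pq(4) pq(2,1), of "- t"] by simp
  then show nz: "minor k A (picks I) \<noteq> 0" using twist_minor_nonzero[of t A] B(3) by simp
  show "twist_space n q p (- t) W \<in> C\<^sub>f" using chart_iff[OF f n0 I A] pos nz rs by simp
  show "left_coeff (twist_space n q p (- t) W) = t" using left_coeff[OF A pos lc] rs by simp
qed

lemma backward_sfs:
  assumes W: "W \<in> C\<^sub>s\<^sub>f\<^sub>s"
  shows "twist_space n q p (- t) W \<in> closed_part" "left_coeff (twist_space n q p (- t) W) = t"
    "minor k (twist k n q p (- t) (row_matrix k n W)) (picks I) \<noteq> 0"
proof -
  let ?A = "twist k n q p (- t) (row_matrix k n W)"
  note B = chart_row_matrix[OF sfs n0 sI W]
  note tb = twist_backward_sfs[OF B(1,3), of t]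
  note bc = backward_chart[OF B(1,2,4) tb(1,3)]
  show "twist_space n q p (- t) W \<in> closed_part"
    using bc(3) right_member_iff[OF twist_carrier tb(1)] tb(2) bc(1) by (simp add: closed_part_def)
  show "left_coeff (twist_space n q p (- t) W) = t" by (rule bc(4))
  show "minor k ?A (picks I) \<noteq> 0" by (rule bc(2))
qed

lemma backward_fs:
  assumes W: "W \<in> C\<^sub>f\<^sub>s" and t: "t + right_coeff W \<noteq> 0"
  shows "twist_space n q p (- t) W \<in> open_part" "left_coeff (twist_space n q p (- t) W) = t"
    "minor k (twist k n q p (- t) (row_matrix k n W)) (picks I) \<noteq> 0"
proof -
  let ?A = "twist k n q p (- t) (row_matrix k n W)" let ?B = "row_matrix k n W"
  note B = chart_row_matrix[OF fs n0 sI W]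
  obtain \<alpha> where \<alpha>: "vcol k n ?B i - (\<lambda>r. \<alpha> * vcol k n ?B (i + 1) r) \<in> right_span ?B"
    using right_exists[OF disjI2[OF B(3)]] by blast
  have "t + \<alpha> \<noteq> 0" using right_coeff[OF B(1,3) \<alpha>] t B(2) by simp
  note tb = twist_backward_fs[OF B(1,3) \<alpha> this]
  note bc = backward_chart[OF B(1,2,4) tb(1,3)]
  show "twist_space n q p (- t) W \<in> open_part"
    using bc(3) right_member_iff[OF twist_carrier tb(1)] tb(2) bc(1) by (simp add: open_part_def)
  show "left_coeff (twist_space n q p (- t) W) = t" by (rule bc(4))
  show "minor k ?A (picks I) \<noteq> 0" by (rule bc(2))
qed

lemma chart_minor_nonzero:
  assumes g: "g \<in> bounded_affine k n" and K: "K \<in> ksubsets k n" and W: "W \<in> open_positroid_chart k n g K"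
  shows "minor_at k n (picks K) W \<noteq> 0" "minor_at k n (picks (target_necklace n g j)) W \<noteq> 0"
proof -
  show "minor_at k n (picks K) W \<noteq> 0" unfolding minor_at_def by (rule chart_row_matrix(4)[OF g n0 K W])
  show "minor_at k n (picks (target_necklace n g j)) W \<noteq> 0"
    unfolding minor_at_def by (rule positroid_minors_necklace[OF g n0 chart_row_matrix(3)[OF g n0 K W]])
qed

lemma regular_left_coeff:
  assumes "S \<subseteq> C\<^sub>f"
  shows "regular (Gr_sub k n S) S left_coeff"
  unfolding left_coeff_def[abs_def]
proof (rule regular_minor_quotient[OF kn])
  show "S \<subseteq> Gr k n" using assms chart_subset_Gr by blast
  show "minor_at k n (picks TL) W \<noteq> 0" if "W \<in> S" for W
    using chart_minor_nonzero(2)[OF f I] assms that by blast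
qed (use picks_less[OF TL(1)] transpose_less in auto)

lemma regular_right_coeff: "regular (Gr_sub k n C\<^sub>f\<^sub>s) C\<^sub>f\<^sub>s right_coeff"
  unfolding right_coeff_def[abs_def]
  by (rule regular_minor_quotient[OF kn])
    (use chart_minor_nonzero(2)[OF fs sI] chart_subset_Gr picks_less[OF necklace_ksubsets(2)] transpose_less in auto)

lemma morphism_forward:
  assumes S: "S = closed_part \<or> S = open_part"
  shows "morphism (Gr_sub k n S) (grassmannian k n) (\<lambda>W. twist_space n p q (left_coeff W) W)"
proof -
  have SC: "S \<subseteq> C\<^sub>f" using S by (auto simp: closed_part_def open_part_def)
  then have SG: "S \<subseteq> Gr k n" using chart_subset_Gr by blast
  note pts = points_Gr_sub[OF SG]
  interpret X: space_with_functions "Gr_sub k n S" by (rule space_with_functions_Gr_sub)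
  show ?thesis
  proof (rule X.morphism_twist[OF kn X.morphism_ident SG I _ _ pq(1-3)])
    show "minor_at k n (picks I) W \<noteq> 0" if "W \<in> S" for W
      using chart_minor_nonzero(1)[OF f I] SC that by blast
    show "regular (Gr_sub k n S) (points (Gr_sub k n S)) left_coeff"
      unfolding pts by (rule regular_left_coeff[OF SC])
    show "\<exists>J \<in> ksubsets k n. minor k (twist k n p q (left_coeff W) (row_matrix k n W)) (picks J) \<noteq> 0"
      if "W \<in> points (Gr_sub k n S)" for W
      using forward(2) SC that unfolding pts by (intro bexI[OF _ sI]) blast
  qed
qed

text \<open>Point and scalar both vary over a general \<open>X\<close>, because the inverse maps are
  defined on products.\<close>

lemma morphism_backward:
  assumes X: "space_with_functions X" and K: "C = C\<^sub>f\<^sub>s \<or> C = C\<^sub>s\<^sub>f\<^sub>s"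
    and w: "morphism X (Gr_sub k n C) w" and t: "regular X (points X) t"
    and img: "\<And>x. x \<in> points X \<Longrightarrow> minor k (twist k n q p (- t x) (row_matrix k n (w x))) (picks I) \<noteq> 0"
  shows "morphism X (grassmannian k n) (\<lambda>x. twist_space n q p (- t x) (w x))"
proof -
  interpret X: space_with_functions X by (rule X)
  show ?thesis
  proof (rule X.morphism_twist[OF kn w _ sI _ X.regular_uminus[OF t] pq(2,1,4)])
    show "C \<subseteq> Gr k n" using K chart_subset_Gr by blast
    show "minor_at k n (picks sI) W \<noteq> 0" if "W \<in> C" for W
      using K that chart_minor_nonzero(1)[OF fs sI] chart_minor_nonzero(1)[OF sfs sI] by blast
    show "\<exists>J \<in> ksubsets k n. minor k (twist k n q p (- t x) (row_matrix k n (w x))) (picks J) \<noteq> 0"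
      if "x \<in> points X" for x
      using img[OF that] by (intro bexI[OF _ I])
  qed
qed

lemma twist_space_back: "W \<in> Gr k n \<Longrightarrow> twist_space n p q t (twist_space n q p (- t) W) = W"
  using twist_space_inverse[of W k n q p "- t"] pq by simp

text \<open>Here \<beta> is unrestricted and serves directly as coordinate on the line;
  \<open>left_coeff\<close> recovers it after untwisting.\<close>

lemma closed_part_iso: "Gr_sub k n closed_part \<cong>\<^sub>v Gr_sub k n C\<^sub>s\<^sub>f\<^sub>s \<times>\<^sub>v affine_line"
proof -
  let ?X = "Gr_sub k n closed_part" and ?Y = "Gr_sub k n C\<^sub>s\<^sub>f\<^sub>s"
  let ?\<phi> = "\<lambda>W. (twist_space n p q (left_coeff W) W, left_coeff W)"
  let ?\<psi> = "\<lambda>x. twist_space n q p (- snd x) (fst x)"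
  interpret X: space_with_functions ?X by (rule space_with_functions_Gr_sub)
  interpret P: two_spaces_with_functions ?Y affine_line
    by (simp add: two_spaces_with_functions_def space_with_functions_Gr_sub affine_line.space_with_functions_axioms)
  interpret YL: space_with_functions "?Y \<times>\<^sub>v affine_line" by (rule P.space_with_functions_prod)
  have ptsX: "points ?X = closed_part" by (rule points_Gr_sub[OF parts_Gr(1)])
  have ptsY: "points ?Y = C\<^sub>s\<^sub>f\<^sub>s" by (rule points_Gr_sub[OF chart_subset_Gr])
  have ptsP: "points (?Y \<times>\<^sub>v affine_line) = C\<^sub>s\<^sub>f\<^sub>s \<times> UNIV"
    using P.points_prod ptsY by simp
  have sub: "closed_part \<subseteq> C\<^sub>f" by (auto simp: closed_part_def)
  have "morphism ?X ?Y (\<lambda>W. twist_space n p q (left_coeff W) W)"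
    using morphism_forward[OF disjI1[OF refl]] forward(3) sub
    by (intro X.morphism_into_subvariety) (auto simp: ptsX)
  moreover have "morphism ?X affine_line left_coeff"
    using regular_left_coeff[OF sub] ptsX by (intro X.morphism_affine_line) simp
  ultimately have m1: "morphism ?X (?Y \<times>\<^sub>v affine_line) ?\<phi>"
    by (intro X.morphism_Pair P.X.space_with_functions_axioms affine_line.space_with_functions_axioms)
  have t: "regular (?Y \<times>\<^sub>v affine_line) (points (?Y \<times>\<^sub>v affine_line)) snd"
    using morphism_regular[OF P.morphism_snd, of id] regular_affine_line_id by simp
  have "morphism (?Y \<times>\<^sub>v affine_line) (grassmannian k n) ?\<psi>"
    using backward_sfs(3) ptsP
    by (intro morphism_backward[OF YL.space_with_functions_axioms disjI2[OF refl] P.morphism_fst t]) auto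
  then have m2: "morphism (?Y \<times>\<^sub>v affine_line) ?X ?\<psi>"
    using backward_sfs(1) ptsP by (intro YL.morphism_into_subvariety) auto
  show ?thesis unfolding var_iso_def
  proof (intro exI[of _ ?\<phi>] exI[of _ ?\<psi>] conjI m1 m2 ballI)
    fix W assume "W \<in> points ?X"
    then have "W \<in> Gr k n" using parts_Gr(1) ptsX by blast
    then show "?\<psi> (?\<phi> W) = W" using twist_space_inverse[OF _ pq(1-3)] by simp
  next
    fix y assume "y \<in> points (?Y \<times>\<^sub>v affine_line)"
    then have y: "fst y \<in> C\<^sub>s\<^sub>f\<^sub>s" unfolding ptsP by auto
    then have "fst y \<in> Gr k n" using chart_subset_Gr by blast
    then show "?\<phi> (?\<psi> y) = y" using backward_sfs(2)[OF y, of "snd y"] twist_space_back by simp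
  qed
qed

text \<open>The second coordinate is \<beta> + \<alpha>, with \<alpha> taken at the twisted point.
  As \<alpha> can be recomputed from the first coordinate, the shift is invertible by regular
  functions, and the excluded value of \<beta> becomes \<open>0\<close>.\<close>

lemma open_part_iso: "Gr_sub k n open_part \<cong>\<^sub>v Gr_sub k n C\<^sub>f\<^sub>s \<times>\<^sub>v punctured_line"
proof -
  let ?X = "Gr_sub k n open_part" and ?Y = "Gr_sub k n C\<^sub>f\<^sub>s"
  let ?w = "\<lambda>W. twist_space n p q (left_coeff W) W"
  let ?\<phi> = "\<lambda>W. (?w W, left_coeff W + right_coeff (?w W))"
  let ?t = "\<lambda>x. snd x - right_coeff (fst x)"
  let ?\<psi> = "\<lambda>x. twist_space n q p (- ?t x) (fst x)"
  interpret X: space_with_functions ?X by (rule space_with_functions_Gr_sub)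
  interpret P: two_spaces_with_functions ?Y punctured_line
    by (simp add: two_spaces_with_functions_def space_with_functions_Gr_sub space_with_functions_punctured_line)
  interpret YL: space_with_functions "?Y \<times>\<^sub>v punctured_line" by (rule P.space_with_functions_prod)
  have ptsX: "points ?X = open_part" by (rule points_Gr_sub[OF parts_Gr(2)])
  have ptsY: "points ?Y = C\<^sub>f\<^sub>s" by (rule points_Gr_sub[OF chart_subset_Gr])
  have ptsL: "points punctured_line = - {0}" by (simp add: punctured_line_def)
  have ptsP: "points (?Y \<times>\<^sub>v punctured_line) = C\<^sub>f\<^sub>s \<times> - {0}"
    using P.points_prod ptsY ptsL by simp
  have sub: "open_part \<subseteq> C\<^sub>f" by (auto simp: open_part_def)
  have fw: "?w W \<in> C\<^sub>f\<^sub>s" "left_coeff W + right_coeff (?w W) \<noteq> 0" if "W \<in> open_part" for W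
    using forward(4)[of W] that sub by auto
  have w: "morphism ?X ?Y ?w"
    using morphism_forward[OF disjI2[OF refl]] fw(1)
    by (intro X.morphism_into_subvariety) (auto simp: ptsX)
  have "regular ?X (points ?X) (right_coeff \<circ> ?w)"
    using morphism_regular[OF w, of right_coeff] regular_right_coeff ptsY by simp
  then have "regular ?X (points ?X) (\<lambda>W. left_coeff W + right_coeff (?w W))"
    using regular_left_coeff[OF sub] ptsX by (intro X.regular_add) (simp_all add: comp_def)
  then have "morphism ?X punctured_line (\<lambda>W. left_coeff W + right_coeff (?w W))"
    unfolding punctured_line_def using fw(2)
    by (intro X.morphism_into_subvariety X.morphism_affine_line) (auto simp: ptsX)
  then have m1: "morphism ?X (?Y \<times>\<^sub>v punctured_line) ?\<phi>"
    by (intro X.morphism_Pair P.X.space_with_functions_axioms P.Y.space_with_functions_axioms w)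
  have "morphism (?Y \<times>\<^sub>v punctured_line) affine_line (id \<circ> snd)"
    by (rule morphism_comp[OF P.morphism_snd]) (simp only: punctured_line_def morphism_subvariety_inclusion)
  then have "regular (?Y \<times>\<^sub>v punctured_line) (points (?Y \<times>\<^sub>v punctured_line)) snd"
    using morphism_regular[of _ affine_line _ id] regular_affine_line_id by fastforce
  moreover have "regular (?Y \<times>\<^sub>v punctured_line) (points (?Y \<times>\<^sub>v punctured_line)) (right_coeff \<circ> fst)"
    using morphism_regular[OF P.morphism_fst, of right_coeff] regular_right_coeff ptsY by simp
  ultimately have t: "regular (?Y \<times>\<^sub>v punctured_line) (points (?Y \<times>\<^sub>v punctured_line)) ?t"
    unfolding comp_def by (rule YL.regular_diff)
  have nz: "?t x + right_coeff (fst x) \<noteq> 0" "fst x \<in> C\<^sub>f\<^sub>s" if "x \<in> points (?Y \<times>\<^sub>v punctured_line)" for x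
    using that unfolding ptsP by auto
  have "morphism (?Y \<times>\<^sub>v punctured_line) (grassmannian k n) ?\<psi>"
    by (rule morphism_backward[OF YL.space_with_functions_axioms disjI1[OF refl] P.morphism_fst t])
      (rule backward_fs(3)[OF nz(2,1)])
  then have m2: "morphism (?Y \<times>\<^sub>v punctured_line) ?X ?\<psi>"
    using backward_fs(1)[OF nz(2,1)] by (intro YL.morphism_into_subvariety) auto
  show ?thesis unfolding var_iso_def
  proof (intro exI[of _ ?\<phi>] exI[of _ ?\<psi>] conjI m1 m2 ballI)
    fix W assume "W \<in> points ?X"
    then have "W \<in> Gr k n" using parts_Gr(2) ptsX by blast
    then show "?\<psi> (?\<phi> W) = W" using twist_space_inverse[OF _ pq(1-3)] by simp
  next
    fix y assume y: "y \<in> points (?Y \<times>\<^sub>v punctured_line)"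
    have "fst y \<in> Gr k n" using nz(2)[OF y] chart_subset_Gr by blast
    then have "?w (?\<psi> y) = fst y"
      unfolding backward_fs(2)[OF nz(2,1)[OF y]] by (rule twist_space_back)
    then show "?\<phi> (?\<psi> y) = y" using backward_fs(2)[OF nz(2,1)[OF y]] by (simp add: prod_eq_iff)
  qed
qed

text \<open>On the Grassmannian the defining minor agrees with a form of degree one, so its
  nonvanishing is a basic open condition.\<close>

lemma open_part_open: "openin (zariski (Gr_sub k n C\<^sub>f)) open_part"
proof -
  obtain F where F: "plucker_form k n 1 F"
    "\<And>W. W \<in> Gr k n \<Longrightarrow> minor_at k n (\<lambda>x. Transposition.transpose q p (picks TF x)) W = F W"
    using minor_at_form[of k n "\<lambda>x. Transposition.transpose q p (picks TF x)"] kn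
      picks_less[OF necklace_ksubsets(1)] transpose_less by blast
  have "open_part = {W \<in> Gr k n. F W \<noteq> 0} \<inter> C\<^sub>f"
  proof -
    have "W \<in> Gr k n \<and> minor_at k n (\<lambda>x. Transposition.transpose q p (picks TF x)) W = F W"
      if "W \<in> C\<^sub>f" for W
      using that chart_subset_Gr F(2) by blast
    then show ?thesis by (auto simp: open_part_def)
  qed
  then show ?thesis using openin_Gr_nonzero[OF F(1)] by (auto simp: openin_subtopology)
qed

lemma decomposition:
  "C\<^sub>f = closed_part \<union> open_part \<and> closed_part \<inter> open_part = {} \<and>
    closedin (zariski (Gr_sub k n C\<^sub>f)) closed_part \<and> openin (zariski (Gr_sub k n C\<^sub>f)) open_part"
proof -
  have "closed_part = C\<^sub>f - open_part" by (auto simp: closed_part_def open_part_def)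
  moreover have "points (Gr_sub k n C\<^sub>f) = C\<^sub>f" by (rule points_Gr_sub[OF chart_subset_Gr])
  ultimately have "closedin (zariski (Gr_sub k n C\<^sub>f)) closed_part"
    using closedin_diff[OF closedin_topspace open_part_open] by simp
  then show ?thesis using open_part_open by (auto simp: closed_part_def open_part_def)
qed

end

end

theorem corollary6p8:
  fixes n k :: nat and i :: int and I :: "int set" and f :: "int \<Rightarrow> int"
  defines "s \<equiv> simple_refl n i"
  assumes "n \<ge> 2" and "k \<le> n"
    and "i \<in> {1..int n}" and "I \<in> ksubsets k n"
    and "f \<in> bounded_affine k n"
    and "s \<star> f \<in> bounded_affine k n"
    and "f \<star> s \<in> bounded_affine k n"
    and "s \<star> f \<star> s \<in> bounded_affine k n"
    and "aff_length n (s \<star> f \<star> s) = aff_length n f + 2"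
    and "residue n (i + 1) \<in> I \<longrightarrow> i \<in> I"
  shows "\<exists>Z U.
    open_positroid_chart k n f I = Z \<union> U \<and> Z \<inter> U = {} \<and>
    closedin (zariski (Gr_sub k n (open_positroid_chart k n f I))) Z \<and>
    openin (zariski (Gr_sub k n (open_positroid_chart k n f I))) U \<and>
    Gr_sub k n Z \<cong>\<^sub>v
      Gr_sub k n (open_positroid_chart k n (s \<star> f \<star> s) (refl_set n i I)) \<times>\<^sub>v affine_line \<and>
    Gr_sub k n U \<cong>\<^sub>v
      Gr_sub k n (open_positroid_chart k n (f \<star> s) (refl_set n i I)) \<times>\<^sub>v punctured_line"
proof -
  interpret double_move n k i f
    by unfold_locales (use assms(2,6-10) in \<open>simp_all add: s_def\<close>)
  note hyps = \<open>k \<le> n\<close> \<open>I \<in> ksubsets k n\<close> \<open>residue n (i + 1) \<in> I \<longrightarrow> i \<in> I\<close>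
  show ?thesis
    unfolding s_def
    using decomposition[OF hyps] closed_part_iso[OF hyps] open_part_iso[OF hyps] by blast
qed

end
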